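(* If $f\in h^p$ for some $p\ge 2$, then $$\int_0^1 \max_{|z|=r}|f(z)|^p\,dr\le\int_{\mathbb{T}}|f(z)|^p\,|dz|.$$
   Context: $\mathbb{D}=\{z\in\mathbb{C}:|z|<1\}$ and $\mathbb{T}=\{z\in\mathbb{C}:|z|=1\}$. A complex-valued function $f=u+iv$ is harmonic in $\mathbb{D}$ if $u,v$ are real-valued harmonic functions in $\mathbb{D}$. For $p>0$, $h^p$ is the set of complex-valued harmonic functions $f$ in $\mathbb{D}$ with $\sup_{0<r<1}M_p(r,f)<\infty$, where $M_p(r,f)=\left(\frac{1}{2\pi}\int_0^{2\pi}|f(re^{i\theta})|^p\,d\theta\right)^{1/p}$. On $\mathbb{T}$, $f(e^{i\theta})$ denotes the radial limit $\lim_{r\to1^-}f(re^{i\theta})$ (existing for almost every $\theta$ here), and $\int_{\mathbb{T}}|f(z)|^p|dz|=\int_0^{2\pi}|f(e^{i\theta})|^p\,d\theta$. *)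

theory Defs
  imports "HOL-Analysis.Analysis"
begin

text \<open>
  A real-valued function is harmonic on an open set if it is twice continuously
  differentiable there and its Laplacian vanishes. The plane is identified with the
  complex numbers; \<open>ux\<close>, \<open>uy\<close>, \<open>uxx\<close>, \<open>uxy\<close>, \<open>uyx\<close>, \<open>uyy\<close> are the partial derivatives
  with respect to the real part \<open>x\<close> and the imaginary part \<open>y\<close> (\<open>uxy\<close> is the
  \<open>y\<close>-derivative of \<open>ux\<close>).
\<close>

definition real_harmonic_on :: "(complex \<Rightarrow> real) \<Rightarrow> complex set \<Rightarrow> bool" where
  "real_harmonic_on u S \<longleftrightarrow> open S \<and>
     (\<exists>ux uy uxx uxy uyx uyy :: complex \<Rightarrow> real.
        (\<forall>z\<in>S. (u has_derivative (\<lambda>h. ux z * Re h + uy z * Im h)) (at z)) \<and>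
        (\<forall>z\<in>S. (ux has_derivative (\<lambda>h. uxx z * Re h + uxy z * Im h)) (at z)) \<and>
        (\<forall>z\<in>S. (uy has_derivative (\<lambda>h. uyx z * Re h + uyy z * Im h)) (at z)) \<and>
        continuous_on S uxx \<and> continuous_on S uxy \<and>
        continuous_on S uyx \<and> continuous_on S uyy \<and>
        (\<forall>z\<in>S. uxx z + uyy z = 0))"

definition harmonic_on :: "(complex \<Rightarrow> complex) \<Rightarrow> complex set \<Rightarrow> bool" where
  "harmonic_on f S \<longleftrightarrow>
     real_harmonic_on (\<lambda>z. Re (f z)) S \<and> real_harmonic_on (\<lambda>z. Im (f z)) S"

definition integral_mean :: "real \<Rightarrow> real \<Rightarrow> (complex \<Rightarrow> complex) \<Rightarrow> real" where
  "integral_mean p r f =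
     (1 / (2 * pi) *
        integral {0..2 * pi} (\<lambda>\<theta>. norm (f (of_real r * cis \<theta>)) powr p)) powr (1 / p)"

text \<open>
  The supremum of the integral means over \<open>0 < r < 1\<close> being finite is expressed by
  boundedness. Values of \<open>f\<close> outside the open unit disc are irrelevant. Only
  \<open>p > 0\<close> is meaningful.
\<close>

definition harmonic_hardy :: "real \<Rightarrow> (complex \<Rightarrow> complex) set" where
  "harmonic_hardy p =
     {f. harmonic_on f (ball 0 1) \<and>
         bdd_above ((\<lambda>r. integral_mean p r f) ` {0<..<1})}"

text \<open>
  The radial limit at a point of the unit circle; an unspecified constant where the
  limit does not exist. For functions in \<open>harmonic_hardy p\<close> with \<open>p > 1\<close> it exists at
  almost every boundary point.
\<close>

definition radial_limit :: "(complex \<Rightarrow> complex) \<Rightarrow> complex \<Rightarrow> complex" where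
  "radial_limit f \<zeta> = Lim (at_left (1::real)) (\<lambda>r. f (of_real r * \<zeta>))"

end

theory Submission
  imports Defs "HOL-Complex_Analysis.Complex_Analysis" "HOL-Probability.Probability"
    "HOL-Real_Asymp.Real_Asymp"
begin

text \<open>
  Let \<open>F\<close> be the radial limit function of \<open>f\<close>. Since \<open>f\<close> is the Poisson integral of \<open>F\<close>, Jensen's
  inequality bounds \<open>|f|\<close> to the power \<open>p / 2\<close> by the Poisson integral of \<open>G = |F| powr (p / 2)\<close>, so it
  suffices to treat the exponent 2 and \<open>G\<close>. Choose on each circle of radius \<open>j / N\<close> a point where \<open>|f|\<close>
  is maximal. By duality and the semigroup property of the Poisson kernel, the Riemann sum of the
  squared Poisson integral of \<open>G\<close> at these points is controlled by the quadratic form with kernel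
  \<open>2 / (1 - r * s)\<close>, a Hilbert-type kernel with norm at most \<open>2 * pi\<close>; Fatou's lemma passes to the
  integral over the radius.

  That \<open>f\<close> is the Poisson integral of its radial limits follows from an \<open>L\<^sup>2\<close> maximal inequality for
  radial suprema of Poisson integrals: it makes \<open>f\<close> minus its dilation by a factor close to 1 uniformly
  small along almost every radius, and the dilations are continuous up to the boundary.
\<close>

subsection \<open>Harmonic functions on the disc\<close>

text \<open>The Hilbert part has to be exact. \<open>circle\<close> has total mass 1, so the
  right-hand side is \<open>2 * pi\<close> times a mean, and \<open>2 * pi\<close> is just what the
  quadratic form costs: 2 from the bound on the Poisson kernel, \<open>pi\<close> from Schur's test.
  The maximal inequality is needed only with some finite constant: its 256 multiplies a gap between
  quadratic means that tends to 0. The points of maximal modulus may jump arbitrarily with the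
  radius. The main estimate must therefore hold for every choice of arguments and should not ask for
  a measurable choice; hence finitely many radii come first and the limit afterwards. The bound
  \<open>p >= 2\<close> enters twice: the quadratic means of \<open>f\<close> are then bounded, and
  Jensen's inequality applies with exponent \<open>p / 2\<close>. Since the right-hand side is
  stated with pointwise radial limits, a boundary function obtained as a weak limit would not
  suffice. Almost everywhere convergence has to be proved, and this is what calls for a maximal
  inequality.\<close>

lemma mixed_difference:
  fixes u :: "complex \<Rightarrow> real"
  assumes u: "\<And>z. z \<in> ball w r \<Longrightarrow> (u has_derivative U z) (at z)"
    and U: "\<And>z. z \<in> ball w r \<Longrightarrow> ((\<lambda>z. U z d) has_derivative V z) (at z)"
    and d: "norm d = 1" and e: "norm e = 1" and h: "0 < h" "2 * h < r"
  obtains a where "dist w a \<le> 2 * h"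
    "u (w + h *\<^sub>R d + h *\<^sub>R e) - u (w + h *\<^sub>R d) - u (w + h *\<^sub>R e) + u w = h\<^sup>2 * V a e"
proof -
  have near: "dist w (w + x *\<^sub>R d + y *\<^sub>R e) \<le> 2 * h" if "0 \<le> x" "x \<le> h" "0 \<le> y" "y \<le> h" for x y
  proof -
    have "dist w (w + x *\<^sub>R d + y *\<^sub>R e) = norm (x *\<^sub>R d + y *\<^sub>R e)"
      by (metis add.assoc dist_add_cancel dist_0_norm add_0_right)
    also have "\<dots> \<le> norm (x *\<^sub>R d) + norm (y *\<^sub>R e)" by (rule norm_triangle_ineq)
    also have "\<dots> \<le> 2 * h" using d e that by simp
    finally show ?thesis .
  qed
  \<comment> \<open>The double difference is \<open>\<phi> h - \<phi> 0\<close>. The mean value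
    theorem in direction \<open>d\<close>, then in direction \<open>e\<close>, turns it into one
    value of the second derivative. The term \<open>0 *\<^sub>R e\<close> keeps both summands in the
    shape of \<open>du\<close>.\<close>
  define \<phi> where "\<phi> x = u (w + x *\<^sub>R d + h *\<^sub>R e) - u (w + x *\<^sub>R d + 0 *\<^sub>R e)" for x
  have du: "((\<lambda>x. u (w + x *\<^sub>R d + y *\<^sub>R e)) has_real_derivative U (w + x *\<^sub>R d + y *\<^sub>R e) d) (at x)"
    if "0 \<le> x" "x \<le> h" "0 \<le> y" "y \<le> h" for x y
  proof -
    have m: "w + x *\<^sub>R d + y *\<^sub>R e \<in> ball w r" using near[OF that] h by simp
    have lin: "linear (U (w + x *\<^sub>R d + y *\<^sub>R e))"
      using u[OF m] has_derivative_linear by blast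
    have "((\<lambda>x. u (w + x *\<^sub>R d + y *\<^sub>R e)) has_derivative
            (\<lambda>k. U (w + x *\<^sub>R d + y *\<^sub>R e) (k *\<^sub>R d))) (at x)"
      by (rule has_derivative_compose[where g = u and f = "\<lambda>x. w + x *\<^sub>R d + y *\<^sub>R e"])
         (auto intro!: derivative_eq_intros u[OF m])
    thus ?thesis unfolding has_field_derivative_def
      by (simp add: linear_cmul[OF lin] mult.commute[of _ "U _ d"] fun_eq_iff)
  qed
  have "\<exists>\<xi>. 0 < \<xi> \<and> \<xi> < h \<and> \<phi> h - \<phi> 0 = (h - 0) *
      (U (w + \<xi> *\<^sub>R d + h *\<^sub>R e) d - U (w + \<xi> *\<^sub>R d + 0 *\<^sub>R e) d)"
    unfolding \<phi>_def using h
    by (intro MVT2 DERIV_diff du) auto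
  then obtain \<xi> where \<xi>: "0 < \<xi>" "\<xi> < h" and 1: "\<phi> h - \<phi> 0 = h *
      (U (w + \<xi> *\<^sub>R d + h *\<^sub>R e) d - U (w + \<xi> *\<^sub>R d + 0 *\<^sub>R e) d)" by auto
  have dU: "((\<lambda>y. U (w + \<xi> *\<^sub>R d + y *\<^sub>R e) d) has_real_derivative V (w + \<xi> *\<^sub>R d + y *\<^sub>R e) e) (at y)"
    if "0 \<le> y" "y \<le> h" for y
  proof -
    have m: "w + \<xi> *\<^sub>R d + y *\<^sub>R e \<in> ball w r" using near[of \<xi> y] \<xi> that h by simp
    have lin: "linear (V (w + \<xi> *\<^sub>R d + y *\<^sub>R e))"
      using U[OF m] has_derivative_linear by blast
    have "((\<lambda>y. U (w + \<xi> *\<^sub>R d + y *\<^sub>R e) d) has_derivative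
            (\<lambda>k. V (w + \<xi> *\<^sub>R d + y *\<^sub>R e) (k *\<^sub>R e))) (at y)"
      by (rule has_derivative_compose[where g = "\<lambda>z. U z d" and f = "\<lambda>y. w + \<xi> *\<^sub>R d + y *\<^sub>R e"])
         (auto intro!: derivative_eq_intros U[OF m])
    thus ?thesis unfolding has_field_derivative_def
      by (simp add: linear_cmul[OF lin] mult.commute[of _ "V _ e"] fun_eq_iff)
  qed
  have "\<exists>\<eta>. 0 < \<eta> \<and> \<eta> < h \<and> U (w + \<xi> *\<^sub>R d + h *\<^sub>R e) d - U (w + \<xi> *\<^sub>R d + 0 *\<^sub>R e) d
      = (h - 0) * V (w + \<xi> *\<^sub>R d + \<eta> *\<^sub>R e) e"
    using h by (intro MVT2 dU) auto
  then obtain \<eta> where "0 < \<eta>" "\<eta> < h" and 2: "U (w + \<xi> *\<^sub>R d + h *\<^sub>R e) d - U (w + \<xi> *\<^sub>R d + 0 *\<^sub>R e) d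
      = h * V (w + \<xi> *\<^sub>R d + \<eta> *\<^sub>R e) e" by auto
  show thesis
  proof (rule that)
    show "dist w (w + \<xi> *\<^sub>R d + \<eta> *\<^sub>R e) \<le> 2 * h" using near \<xi> \<open>0 < \<eta>\<close> \<open>\<eta> < h\<close> by simp
    show "u (w + h *\<^sub>R d + h *\<^sub>R e) - u (w + h *\<^sub>R d) - u (w + h *\<^sub>R e) + u w
        = h\<^sup>2 * V (w + \<xi> *\<^sub>R d + \<eta> *\<^sub>R e) e"
      using 1[unfolded 2] by (simp add: \<phi>_def power2_eq_square algebra_simps)
  qed
qed

text \<open>Schwarz's theorem: the double difference with increments in directions 1 and
  \<open>\<i>\<close> does not depend on their order, so \<open>uxy\<close> and \<open>uyx\<close>
  take a common value at points arbitrarily close to \<open>w\<close>, and continuity does the rest.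
  \<open>real_harmonic_on\<close> does not include this symmetry, but the Cauchy-Riemann equations
  below rest on it.\<close>

lemma mixed_partials_eq:
  fixes u ux uy uxx uxy uyx uyy :: "complex \<Rightarrow> real"
  assumes S: "open S" "w \<in> S"
    and u: "\<And>z. z \<in> S \<Longrightarrow> (u has_derivative (\<lambda>h. ux z * Re h + uy z * Im h)) (at z)"
    and ux: "\<And>z. z \<in> S \<Longrightarrow> (ux has_derivative (\<lambda>h. uxx z * Re h + uxy z * Im h)) (at z)"
    and uy: "\<And>z. z \<in> S \<Longrightarrow> (uy has_derivative (\<lambda>h. uyx z * Re h + uyy z * Im h)) (at z)"
    and cont: "continuous_on S uxy" "continuous_on S uyx"
  shows "uxy w = uyx w"
proof (rule ccontr)
  assume "uxy w \<noteq> uyx w"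
  define \<epsilon> where "\<epsilon> = \<bar>uxy w - uyx w\<bar> / 2"
  have "\<epsilon> > 0" using \<open>uxy w \<noteq> uyx w\<close> by (simp add: \<epsilon>_def)
  obtain r where r: "r > 0" "ball w r \<subseteq> S" using S openE by blast
  have c: "isCont uxy w" "isCont uyx w" using cont S continuous_on_eq_continuous_at by blast+
  obtain s1 where s1: "s1 > 0" "\<And>a. dist a w < s1 \<Longrightarrow> dist (uxy a) (uxy w) < \<epsilon>"
    using c(1) \<open>\<epsilon> > 0\<close> unfolding continuous_at_eps_delta by metis
  obtain s2 where s2: "s2 > 0" "\<And>a. dist a w < s2 \<Longrightarrow> dist (uyx a) (uyx w) < \<epsilon>"
    using c(2) \<open>\<epsilon> > 0\<close> unfolding continuous_at_eps_delta by metis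
  define h where "h = min r (min s1 s2) / 3"
  have h: "0 < h" "2 * h < r" "2 * h < s1" "2 * h < s2" using r s1 s2 by (auto simp: h_def)
  obtain a where a: "dist w a \<le> 2 * h" "u (w + h *\<^sub>R 1 + h *\<^sub>R \<i>) - u (w + h *\<^sub>R 1) - u (w + h *\<^sub>R \<i>) + u w
      = h\<^sup>2 * (uxx a * Re \<i> + uxy a * Im \<i>)"
    by (rule mixed_difference[of w r u "\<lambda>z h. ux z * Re h + uy z * Im h" 1
          "\<lambda>z h. uxx z * Re h + uxy z * Im h" \<i> h]) (use r h u ux in \<open>auto simp: subset_iff\<close>)
  obtain b where b: "dist w b \<le> 2 * h" "u (w + h *\<^sub>R \<i> + h *\<^sub>R 1) - u (w + h *\<^sub>R \<i>) - u (w + h *\<^sub>R 1) + u w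
      = h\<^sup>2 * (uyx b * Re 1 + uyy b * Im 1)"
    by (rule mixed_difference[of w r u "\<lambda>z h. ux z * Re h + uy z * Im h" \<i>
          "\<lambda>z h. uyx z * Re h + uyy z * Im h" 1 h]) (use r h u uy in \<open>auto simp: subset_iff\<close>)
  have "h\<^sup>2 * uxy a = h\<^sup>2 * uyx b" using a(2) b(2) by (simp add: algebra_simps)
  hence "uxy a = uyx b" using h by simp
  moreover have "dist (uxy a) (uxy w) < \<epsilon>" "dist (uyx b) (uyx w) < \<epsilon>"
    using s1 s2 a b h by (auto simp: dist_commute)
  ultimately show False unfolding \<epsilon>_def dist_real_def by (smt (verit) field_sum_of_halves)
qed

text \<open>\<open>ux - \<i> * uy\<close> satisfies the Cauchy-Riemann equations, by the vanishing
  Laplacian and the symmetry of the mixed derivatives. The real part of its primitive on the convex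
  disc has the gradient of \<open>u\<close>, so a constant corrects the difference.\<close>

lemma real_harmonic_on_ball_imp_Re:
  assumes "real_harmonic_on u (ball 0 1)"
  obtains g where "g holomorphic_on ball 0 1" "\<And>z. z \<in> ball 0 1 \<Longrightarrow> u z = Re (g z)"
proof -
  let ?B = "ball 0 1 :: complex set"
  obtain ux uy uxx uxy uyx uyy where
    u: "\<And>z. z \<in> ?B \<Longrightarrow> (u has_derivative (\<lambda>h. ux z * Re h + uy z * Im h)) (at z)"
    and ux: "\<And>z. z \<in> ?B \<Longrightarrow> (ux has_derivative (\<lambda>h. uxx z * Re h + uxy z * Im h)) (at z)"
    and uy: "\<And>z. z \<in> ?B \<Longrightarrow> (uy has_derivative (\<lambda>h. uyx z * Re h + uyy z * Im h)) (at z)"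
    and cont: "continuous_on ?B uxy" "continuous_on ?B uyx"
    and lap: "\<And>z. z \<in> ?B \<Longrightarrow> uxx z + uyy z = 0"
    using assms unfolding real_harmonic_on_def by blast
  have sym: "uxy z = uyx z" if "z \<in> ?B" for z
    using mixed_partials_eq[OF open_ball that u ux uy cont] .
  define g where "g z = Complex (ux z) (- uy z)" for z
  have dg: "(g has_field_derivative Complex (uxx z) (- uyx z)) (at z)" if z: "z \<in> ?B" for z
  proof -
    have "((\<lambda>z. of_real (ux z) - \<i> * of_real (uy z)) has_derivative
       (\<lambda>h. of_real (uxx z * Re h + uxy z * Im h) - \<i> * of_real (uyx z * Re h + uyy z * Im h))) (at z)"
      by (intro has_derivative_diff has_derivative_mult_right has_derivative_of_real ux[OF z] uy[OF z])
    also have "(\<lambda>z. of_real (ux z) - \<i> * of_real (uy z)) = g"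
      by (auto simp: g_def complex_eq_iff)
    also have "(\<lambda>h. of_real (uxx z * Re h + uxy z * Im h) - \<i> * of_real (uyx z * Re h + uyy z * Im h))
        = (\<lambda>h. Complex (uxx z) (- uyx z) * h)"
      using lap[OF z] sym[OF z] by (auto simp: complex_eq_iff fun_eq_iff algebra_simps add_eq_0_iff)
    finally show ?thesis by (simp add: has_field_derivative_def)
  qed
  hence "g holomorphic_on ?B" using holomorphic_on_open by blast
  then obtain G where G: "\<And>z. z \<in> ?B \<Longrightarrow> (G has_field_derivative g z) (at z)"
    using holomorphic_convex_primitive'[of ?B g] by (auto simp: at_within_open[of _ ?B])
  have "\<exists>c. \<forall>z\<in>?B. u z - Re (G z) = c"
  proof (rule has_derivative_zero_constant)
    fix z assume z: "z \<in> ?B"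
    have "((\<lambda>z. Re (G z)) has_derivative (\<lambda>h. Re (g z * h))) (at z)"
      using G[OF z] unfolding has_field_derivative_def by (rule has_derivative_Re)
    from has_derivative_diff[OF u[OF z] this]
    have "((\<lambda>z. u z - Re (G z)) has_derivative (\<lambda>h. 0)) (at z)"
      by (simp add: g_def)
    thus "((\<lambda>z. u z - Re (G z)) has_derivative (\<lambda>h. 0)) (at z within ?B)"
      by (rule has_derivative_at_withinI)
  qed auto
  then obtain c where c: "\<And>z. z \<in> ?B \<Longrightarrow> u z - Re (G z) = c" by blast
  show thesis
  proof (rule that)
    show "(\<lambda>z. G z + of_real c) holomorphic_on ?B"
      using G holomorphic_on_open[of ?B G] open_ball by (intro holomorphic_intros) blast
    show "u z = Re (G z + of_real c)" if "z \<in> ?B" for z using c[OF that] by simp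
  qed
qed

text \<open>Add \<open>Re a = (a + cnj a) / 2\<close> and
  \<open>\<i> * Re b = (\<i> * b + cnj (- \<i> * b)) / 2\<close>. After this splitting Cauchy's
  formula is all that is needed for Poisson's formula.\<close>

lemma harmonic_on_ball_decomp:
  assumes "harmonic_on f (ball 0 1)"
  obtains g h where "g holomorphic_on ball 0 1" "h holomorphic_on ball 0 1"
    "\<And>z. z \<in> ball 0 1 \<Longrightarrow> f z = g z + cnj (h z)"
proof -
  obtain a where a: "a holomorphic_on ball 0 1" "\<And>z. z \<in> ball 0 1 \<Longrightarrow> Re (f z) = Re (a z)"
    using assms real_harmonic_on_ball_imp_Re[of "\<lambda>z. Re (f z)"] unfolding harmonic_on_def by blast
  obtain b where b: "b holomorphic_on ball 0 1" "\<And>z. z \<in> ball 0 1 \<Longrightarrow> Im (f z) = Re (b z)"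
    using assms real_harmonic_on_ball_imp_Re[of "\<lambda>z. Im (f z)"] unfolding harmonic_on_def by blast
  show thesis
  proof (rule that)
    show "(\<lambda>z. (a z + \<i> * b z) / 2) holomorphic_on ball 0 1"
      "(\<lambda>z. (a z - \<i> * b z) / 2) holomorphic_on ball 0 1"
      using a b by (auto intro!: holomorphic_intros)
    show "f z = (a z + \<i> * b z) / 2 + cnj ((a z - \<i> * b z) / 2)" if "z \<in> ball 0 1" for z
      using a(2)[OF that] b(2)[OF that] by (simp add: complex_eq_iff field_simps)
  qed
qed

subsection \<open>The Poisson kernel\<close>

text \<open>At \<open>w = z * cis (- t)\<close> this is the usual kernel (1 - |z|^2) / |e^(it) -
  z|^2. With a single argument, the semigroup identity becomes a product inside
  \<open>poisson\<close>.\<close>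

definition poisson :: "complex \<Rightarrow> real" where
  "poisson w = (1 - (cmod w)\<^sup>2) / (cmod (1 - w))\<^sup>2"

text \<open>Arc length in the angle, normalized to a probability measure so that the Poisson kernel
  has integral 1 and Jensen's inequality carries no factors. The doubled endpoint is a null
  set.\<close>

definition circle :: "real measure" where
  "circle = uniform_measure lborel {0..2 * pi}"

lemma sets_circle [measurable_cong, simp]: "sets circle = sets borel"
  and space_circle [simp]: "space circle = UNIV"
  by (simp_all add: circle_def)

lemma emeasure_two_pi: "emeasure lborel {0..2 * pi} = ennreal (2 * pi)"
  by simp

interpretation circle: prob_space circle
  unfolding circle_def by (rule prob_space_uniform_measure) (auto simp: emeasure_two_pi)

lemma measure_circle_UNIV [simp]: "measure circle UNIV = 1"
  using circle.prob_space by simp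

interpretation circle2: pair_sigma_finite circle circle ..

lemma cis_measurable [measurable]: "cis \<in> borel_measurable borel"
  by (intro borel_measurable_continuous_onI continuous_intros)

lemma integrable_circle_bounded:
  fixes g :: "real \<Rightarrow> 'a :: {banach, second_countable_topology}"
  assumes "g \<in> borel_measurable borel" "\<And>t. norm (g t) \<le> B"
  shows "integrable circle g"
  using assms by (intro circle.integrable_const_bound[where B = B]) auto

lemma integrable_circle2_bounded:
  fixes g :: "real \<times> real \<Rightarrow> 'a :: {banach, second_countable_topology}"
  assumes "g \<in> borel_measurable (circle \<Otimes>\<^sub>M circle)" "\<And>t. norm (g t) \<le> B"
  shows "integrable (circle \<Otimes>\<^sub>M circle) g"
proof -
  interpret P: prob_space "circle \<Otimes>\<^sub>M circle"
    by (rule prob_space_pair) (rule circle.prob_space_axioms)+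
  show ?thesis using assms by (intro P.integrable_const_bound[where B = B]) auto
qed

text \<open>Bridge from gauge integrals, in which contour integrals and \<open>integral_mean\<close>
  are expressed, to Bochner integrals against \<open>circle\<close>.\<close>

lemma integral_circle_has_integral:
  fixes g :: "real \<Rightarrow> 'a :: euclidean_space"
  assumes g: "continuous_on UNIV g" and I: "(g has_integral I) {0..2 * pi}"
  shows "integral\<^sup>L circle g = (1 / (2 * pi)) *\<^sub>R I"
proof -
  have [measurable]: "g \<in> borel_measurable borel" using g by (rule borel_measurable_continuous_onI)
  have c: "circle = density lborel (\<lambda>x. ennreal (indicator {0..2 * pi} x / (2 * pi)))"
    unfolding circle_def uniform_measure_def emeasure_two_pi
    by (intro density_cong) (auto simp: divide_ennreal[symmetric] ennreal_indicator split: split_indicator)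
  have s: "set_integrable lborel {0..2 * pi} g"
    unfolding set_integrable_def
    using g by (intro borel_integrable_compact) (auto intro: continuous_on_subset)
  have "integral\<^sup>L circle g = (\<integral>x. (indicator {0..2 * pi} x / (2 * pi)) *\<^sub>R g x \<partial>lborel)"
    unfolding c by (subst integral_density) auto
  also have "\<dots> = (\<integral>x. (1 / (2 * pi)) *\<^sub>R (indicator {0..2 * pi} x *\<^sub>R g x) \<partial>lborel)"
    by (intro Bochner_Integration.integral_cong) auto
  also have "\<dots> = (1 / (2 * pi)) *\<^sub>R (\<integral>x. indicator {0..2 * pi} x *\<^sub>R g x \<partial>lborel)"
    by (rule integral_scaleR_right)
  also have "(\<integral>x. indicator {0..2 * pi} x *\<^sub>R g x \<partial>lborel) = I"
    using set_borel_integral_eq_integral(2)[OF s] I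
    by (simp add: set_lebesgue_integral_def integral_unique)
  finally show ?thesis .
qed

section \<open>Elementary properties of the Poisson kernel\<close>

lemma borel_measurable_cnj [measurable]: "cnj \<in> borel_measurable borel"
  by (intro borel_measurable_continuous_onI continuous_intros)

lemma poisson_measurable [measurable]: "poisson \<in> borel_measurable borel"
  unfolding poisson_def by measurable

lemma poisson_cnj [simp]: "poisson (cnj w) = poisson w"
  unfolding poisson_def by (metis complex_cnj_diff complex_cnj_one complex_mod_cnj)

lemma poisson_nonneg: "cmod w \<le> 1 \<Longrightarrow> 0 \<le> poisson w"
  unfolding poisson_def by (simp add: power_le_one)

text \<open>Use \<open>1 - cmod w <= cmod (1 - w)\<close> and cancel one factor
  \<open>1 - cmod w\<close>. This is the origin of the Hilbert-type kernel: for points of moduli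
  \<open>r\<close> and \<open>s\<close> it yields \<open>2 / (1 - r * s)\<close>, independently of
  their arguments.\<close>

lemma poisson_le:
  assumes "cmod w < 1"
  shows "poisson w \<le> 2 / (1 - cmod w)"
proof -
  have "1 - cmod w \<le> cmod (1 - w)" by (metis norm_one norm_triangle_ineq2)
  hence "poisson w \<le> (1 - (cmod w)\<^sup>2) / (1 - cmod w)\<^sup>2"
    using assms unfolding poisson_def
    by (intro divide_left_mono power_mono mult_pos_pos) (auto simp: power_le_one)
  also have "\<dots> = (1 + cmod w) / (1 - cmod w)"
    using assms by (simp add: divide_simps power2_eq_square) (simp add: algebra_simps)
  also have "\<dots> \<le> 2 / (1 - cmod w)" using assms by (intro divide_right_mono) auto
  finally show ?thesis .
qed

lemma poisson_le_radius:
  assumes "cmod w \<le> R" "R < 1"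
  shows "poisson w \<le> 2 / (1 - R)"
proof -
  have "poisson w \<le> 2 / (1 - cmod w)" using assms by (intro poisson_le) auto
  also have "\<dots> \<le> 2 / (1 - R)" using assms by (intro divide_left_mono) auto
  finally show ?thesis .
qed

text \<open>The kernel as the real part of \<open>(1 + w) / (1 - w)\<close>, split into a
  holomorphic function and its conjugate, the form that \<open>poisson_formula_harmonic_sum\<close>
  accepts.\<close>

lemma poisson_eq_Re:
  assumes "cmod w < 1"
  shows "of_real (poisson w) = (1 + w) / (2 * (1 - w)) + cnj ((1 + w) / (2 * (1 - w)))"
proof -
  have w: "1 - w \<noteq> 0" using assms by auto
  have "(1 + w) / (2 * (1 - w)) + cnj ((1 + w) / (2 * (1 - w)))
      = ((1 + w) * (1 - cnj w) + (1 + cnj w) * (1 - w)) / (2 * ((1 - w) * cnj (1 - w)))"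
  proof -
    have "p / (2 * a) + q / (2 * b) = (p * b + q * a) / (2 * (a * b))" if "a \<noteq> 0" "b \<noteq> 0"
      for p q a b :: complex using that by (simp add: field_simps)
    from this[of "1 - w" "1 - cnj w" "1 + w" "1 + cnj w"] w show ?thesis by simp
  qed
  also have "(1 + w) * (1 - cnj w) + (1 + cnj w) * (1 - w) = 2 * (1 - w * cnj w)"
    by (simp add: algebra_simps)
  also have "2 * (1 - w * cnj w) = 2 * of_real (1 - (cmod w)\<^sup>2)"
    by (simp only: of_real_diff of_real_1 complex_norm_square)
  also have "(1 - w) * cnj (1 - w) = of_real ((cmod (1 - w))\<^sup>2)"
    by (simp only: complex_norm_square)
  also have "2 * complex_of_real (1 - (cmod w)\<^sup>2) / (2 * of_real ((cmod (1 - w))\<^sup>2))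
      = of_real (poisson w)"
    unfolding poisson_def of_real_divide by (rule mult_divide_mult_cancel_left) simp
  finally show ?thesis by simp
qed

text \<open>Cauchy's formula is applied to \<open>A1\<close> instead of \<open>A\<close>. The extra
  factor is 1 at \<open>z = w\<close>, is holomorphic because its pole lies outside the closed disc,
  and on the circle its denominator is the conjugate of \<open>1 - w * cis (- t)\<close>, which
  completes the Cauchy kernel to the Poisson kernel.\<close>

lemma poisson_formula_holomorphic:
  assumes hol: "A holomorphic_on ball 0 1" and cont: "continuous_on (cball 0 1) A" and w: "cmod w < 1"
  shows "A w = (\<integral>t. poisson (w * cis (- t)) *\<^sub>R A (cis t) \<partial>circle)"
proof -
  have nz: "1 - cnj w * z \<noteq> 0" if "cmod z \<le> 1" for z
  proof
    assume "1 - cnj w * z = 0"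
    hence "cmod (cnj w * z) = 1" by (metis eq_iff_diff_eq_0 norm_one)
    moreover have "cmod (cnj w * z) < 1"
      using w that mult_left_mono[of "cmod z" 1 "cmod w"] by (simp add: norm_mult)
    ultimately show False by simp
  qed
  define A1 where "A1 z = A z * of_real (1 - (cmod w)\<^sup>2) / (1 - cnj w * z)" for z
  have "((\<lambda>u. A1 u / (u - w)) has_contour_integral (2 * of_real pi * \<i> * A1 w)) (circlepath 0 1)"
    using w hol cont nz unfolding A1_def
    by (intro Cauchy_integral_circlepath) (auto intro!: continuous_intros holomorphic_intros)
  hence I: "((\<lambda>t. A1 (cis t) / (cis t - w) * \<i> * cis t) has_integral (2 * of_real pi * \<i> * A1 w)) {0..2 * pi}"
    unfolding circlepath_def by (subst (asm) has_contour_integral_part_circlepath_iff) auto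
  have "(1 - cnj w * w) = of_real (1 - (cmod w)\<^sup>2)"
    by (simp only: of_real_diff of_real_1 complex_norm_square mult.commute)
  hence A1w: "A1 w = A w" using nz[of w] w unfolding A1_def by simp
  have eq: "A1 (cis t) / (cis t - w) * \<i> * cis t = \<i> * (poisson (w * cis (- t)) *\<^sub>R A (cis t))" for t
  proof -
    have "cis t - w = cis t * (1 - w * cis (- t))" by (simp add: algebra_simps cis_mult)
    moreover have "1 - cnj w * cis t = cnj (1 - w * cis (- t))" by (simp flip: cis_cnj)
    ultimately have "A1 (cis t) / (cis t - w) * \<i> * cis t
       = \<i> * A (cis t) * of_real (1 - (cmod w)\<^sup>2) / ((1 - w * cis (- t)) * cnj (1 - w * cis (- t)))"
      unfolding A1_def by (simp only: divide_divide_eq_left) (simp add: mult_ac)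
    also have "(1 - w * cis (- t)) * cnj (1 - w * cis (- t)) = of_real ((cmod (1 - w * cis (- t)))\<^sup>2)"
      by (simp only: complex_norm_square)
    finally show ?thesis by (simp add: poisson_def scaleR_conv_of_real norm_mult)
  qed
  have c: "continuous_on UNIV (\<lambda>t. poisson (w * cis (- t)) *\<^sub>R A (cis t))"
  proof -
    have "1 - w * cis (- t) \<noteq> 0" for t
    proof -
      have "cmod (w * cis (- t)) < 1" using w by (simp add: norm_mult)
      hence "w * cis (- t) \<noteq> 1" by auto
      thus ?thesis by simp
    qed
    thus ?thesis unfolding poisson_def
      by (intro continuous_intros continuous_on_compose2[OF cont]) auto
  qed
  have c1: "(-\<i>) * (\<i> * a) = a" and c2: "(-\<i>) * (2 * of_real pi * \<i> * a) = 2 * of_real pi * a" for a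
    by (simp_all add: complex_eq_iff)
  have "((\<lambda>t. (-\<i>) * (\<i> * (poisson (w * cis (- t)) *\<^sub>R A (cis t)))) has_integral
      ((-\<i>) * (2 * of_real pi * \<i> * A w))) {0..2 * pi}"
    by (rule has_integral_mult_right[OF I[unfolded eq A1w]])
  hence "((\<lambda>t. poisson (w * cis (- t)) *\<^sub>R A (cis t)) has_integral (2 * of_real pi * A w)) {0..2 * pi}"
    by (simp only: c1 c2)
  from integral_circle_has_integral[OF c this] show ?thesis by (simp add: scaleR_conv_of_real)
qed

section \<open>Poisson's formula for harmonic functions\<close>

lemma poisson_kernel_measurable [measurable]: "(\<lambda>t. poisson (w * cis (- t))) \<in> borel_measurable borel"
  by measurable

lemma poisson_kernel_bound: "cmod w < 1 \<Longrightarrow> \<bar>poisson (w * cis (- t))\<bar> \<le> 2 / (1 - cmod w)"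
  using poisson_le[of "w * cis (- t)"] poisson_nonneg[of "w * cis (- t)"] by (simp add: norm_mult)

lemma poisson_kernel_nonneg: "cmod w < 1 \<Longrightarrow> 0 \<le> poisson (w * cis (- t))"
  by (intro poisson_nonneg) (simp add: norm_mult)

lemma integrable_poisson_bounded:
  fixes g :: "real \<Rightarrow> 'a :: {banach, second_countable_topology}"
  assumes "cmod w < 1" "g \<in> borel_measurable borel" "\<And>t. norm (g t) \<le> B"
  shows "integrable circle (\<lambda>t. poisson (w * cis (- t)) *\<^sub>R g t)"
proof (rule integrable_circle_bounded)
  show "norm (poisson (w * cis (- t)) *\<^sub>R g t) \<le> 2 / (1 - cmod w) * B" for t
    unfolding norm_scaleR real_norm_def
    using poisson_kernel_bound[OF assms(1), of t] assms(1,3)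
    by (intro mult_mono) auto
qed (intro borel_measurable_scaleR poisson_kernel_measurable assms)

lemma bounded_on_unit_circle:
  fixes A :: "complex \<Rightarrow> complex"
  assumes "continuous_on (cball 0 1) A"
  shows "(\<lambda>t. A (cis t)) \<in> borel_measurable borel" "\<exists>B. \<forall>t. norm (A (cis t)) \<le> B"
proof -
  show "(\<lambda>t. A (cis t)) \<in> borel_measurable borel"
    by (intro borel_measurable_continuous_onI continuous_on_compose2[OF assms] continuous_intros) auto
  have "bounded (A ` cball 0 1)" 
    by (intro compact_imp_bounded compact_continuous_image assms compact_cball)
  then obtain B where "\<forall>z\<in>cball 0 1. norm (A z) \<le> B" by (auto simp: bounded_iff)
  thus "\<exists>B. \<forall>t. norm (A (cis t)) \<le> B" by (intro exI[of _ B]) simp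
qed

lemma poisson_formula_harmonic_sum:
  assumes g: "g holomorphic_on ball 0 1" "continuous_on (cball 0 1) g"
    and h: "h holomorphic_on ball 0 1" "continuous_on (cball 0 1) h" and w: "cmod w < 1"
  shows "g w + cnj (h w) = (\<integral>t. poisson (w * cis (- t)) *\<^sub>R (g (cis t) + cnj (h (cis t))) \<partial>circle)"
proof -
  obtain Bg where Bg: "\<And>t. norm (g (cis t)) \<le> Bg" using bounded_on_unit_circle(2)[OF g(2)] by auto
  obtain Bh where Bh: "\<And>t. norm (h (cis t)) \<le> Bh" using bounded_on_unit_circle(2)[OF h(2)] by auto
  have int: "integrable circle (\<lambda>t. poisson (w * cis (- t)) *\<^sub>R g (cis t))"
    "integrable circle (\<lambda>t. poisson (w * cis (- t)) *\<^sub>R cnj (h (cis t)))"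
    using integrable_poisson_bounded[OF w bounded_on_unit_circle(1)[OF g(2)] Bg]
      integrable_poisson_bounded[OF w measurable_compose[OF bounded_on_unit_circle(1)[OF h(2)]
        borel_measurable_cnj], of Bh] Bh
    by simp_all
  have "cnj (h w) = (\<integral>t. cnj (poisson (w * cis (- t)) *\<^sub>R h (cis t)) \<partial>circle)"
    by (simp only: Bochner_Integration.integral_cnj poisson_formula_holomorphic[OF h w, symmetric])
  thus ?thesis
    using poisson_formula_holomorphic[OF g w] Bochner_Integration.integral_add[OF int]
    by (simp add: scaleR_add_right)
qed

text \<open>The dilation by \<open>s < 1\<close> is continuous up to the circle, so no boundary
  values of \<open>f\<close> are involved; \<open>bdry_representation\<close> later lets
  \<open>s\<close> tend to 1.\<close>

lemma poisson_formula:
  assumes f: "harmonic_on f (ball 0 1)" and s: "0 \<le> s" "s < 1" and w: "cmod w < 1"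
  shows "f (of_real s * w) = (\<integral>t. poisson (w * cis (- t)) *\<^sub>R f (of_real s * cis t) \<partial>circle)"
proof -
  obtain g h where gh: "g holomorphic_on ball 0 1" "h holomorphic_on ball 0 1"
    "\<And>z. z \<in> ball 0 1 \<Longrightarrow> f z = g z + cnj (h z)"
    using harmonic_on_ball_decomp[OF f] by blast
  have sub: "cmod (of_real s * z) < 1" if "cmod z \<le> 1" for z
    using s that mult_left_mono[of "cmod z" 1 s] by (simp add: norm_mult)
  have hol: "(\<lambda>z. a (of_real s * z)) holomorphic_on ball 0 1"
    and cont: "continuous_on (cball 0 1) (\<lambda>z. a (of_real s * z))"
    if a: "a holomorphic_on ball 0 1" for a
  proof -
    have "(\<lambda>z. of_real s * z :: complex) ` ball 0 1 \<subseteq> ball 0 1" using sub by auto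
    moreover have "(\<lambda>z. of_real s * z :: complex) holomorphic_on ball 0 1" by (intro holomorphic_intros)
    ultimately have "(a \<circ> (\<lambda>z. of_real s * z)) holomorphic_on ball 0 1"
      using holomorphic_on_compose_gen a by blast
    thus "(\<lambda>z. a (of_real s * z)) holomorphic_on ball 0 1" by (simp only: o_def)
    show "continuous_on (cball 0 1) (\<lambda>z. a (of_real s * z))"
    proof (rule continuous_on_compose2[OF holomorphic_on_imp_continuous_on[OF a]])
      show "continuous_on (cball 0 1) (\<lambda>z. of_real s * z :: complex)" by (intro continuous_intros)
      show "(\<lambda>z. of_real s * z :: complex) ` cball 0 1 \<subseteq> ball 0 1" using sub by auto
    qed
  qed
  have eq: "f (of_real s * z) = g (of_real s * z) + cnj (h (of_real s * z))" if "cmod z \<le> 1" for z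
    using gh(3)[of "of_real s * z"] sub[OF that] by simp
  show ?thesis
    using poisson_formula_harmonic_sum[OF hol[OF gh(1)] cont[OF gh(1)] hol[OF gh(2)] cont[OF gh(2)] w]
      w by (simp add: eq less_imp_le)
qed

lemma integral_poisson:
  assumes "cmod w < 1"
  shows "(\<integral>t. poisson (w * cis (- t)) \<partial>circle) = 1"
proof -
  have "of_real (\<integral>t. poisson (w * cis (- t)) \<partial>circle) = (1::complex)"
    using poisson_formula_holomorphic[of "\<lambda>_. 1" w] assms
    by (simp add: scaleR_conv_of_real)
  thus ?thesis by simp
qed

text \<open>\<open>poisson (cnj w * \<zeta>)\<close> is harmonic in \<open>\<zeta>\<close> and
  continuous up to the circle, so Poisson's formula reproduces it at \<open>z\<close>. Both duality
  arguments below rest on this identity.\<close>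

lemma poisson_semigroup:
  assumes z: "cmod z < 1" and w: "cmod w < 1"
  shows "(\<integral>t. poisson (z * cis (- t)) * poisson (w * cis (- t)) \<partial>circle) = poisson (z * cnj w)"
proof -
  define g where "g \<zeta> = (1 + cnj w * \<zeta>) / (2 * (1 - cnj w * \<zeta>))" for \<zeta>
  have lt: "cmod (cnj w * \<zeta>) < 1" if "cmod \<zeta> \<le> 1" for \<zeta>
    using w that mult_left_mono[of "cmod \<zeta>" 1 "cmod w"] by (simp add: norm_mult)
  have nz: "1 - cnj w * \<zeta> \<noteq> 0" if "cmod \<zeta> \<le> 1" for \<zeta>
    using lt[OF that] by (metis eq_iff_diff_eq_0 less_irrefl norm_one)
  have eq: "g \<zeta> + cnj (g \<zeta>) = of_real (poisson (cnj w * \<zeta>))" if "cmod \<zeta> \<le> 1" for \<zeta>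
    unfolding g_def by (rule poisson_eq_Re[OF lt[OF that], symmetric])
  have g: "g holomorphic_on ball 0 1" "continuous_on (cball 0 1) g"
    unfolding g_def using nz by (auto intro!: holomorphic_intros continuous_intros)
  have cj: "poisson (cnj w * cis t) = poisson (w * cis (- t))" for t
    using poisson_cnj[of "w * cis (- t)"] by (simp flip: cis_cnj)
  have "of_real (poisson (cnj w * z)) =
     (\<integral>t. complex_of_real (poisson (z * cis (- t)) * poisson (w * cis (- t))) \<partial>circle)"
    using poisson_formula_harmonic_sum[OF g g z] z by (simp add: eq scaleR_conv_of_real cj)
  thus ?thesis by (simp only: integral_complex_of_real of_real_eq_iff mult.commute)
qed

subsection \<open>A maximal inequality in the square mean\<close>

lemma circle_Fubini:
  fixes f :: "real \<Rightarrow> real \<Rightarrow> 'a :: {banach, second_countable_topology}"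
  assumes "case_prod f \<in> borel_measurable (circle \<Otimes>\<^sub>M circle)" "\<And>x y. norm (f x y) \<le> B"
  shows "(\<integral>x. \<integral>y. f x y \<partial>circle \<partial>circle) = (\<integral>y. \<integral>x. f x y \<partial>circle \<partial>circle)"
proof -
  have "integrable (circle \<Otimes>\<^sub>M circle) (case_prod f)"
    using assms by (intro integrable_circle2_bounded[of _ B]) (auto simp: split_beta)
  from circle2.Fubini_integral[OF this] show ?thesis by simp
qed

lemma norm_integral_circle_le:
  fixes g :: "real \<Rightarrow> 'a :: {banach, second_countable_topology}"
  assumes "g \<in> borel_measurable borel" "\<And>t. norm (g t) \<le> B"
  shows "norm (\<integral>t. g t \<partial>circle) \<le> B"
proof -
  have i: "integrable circle g" using assms by (rule integrable_circle_bounded)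
  have "norm (\<integral>t. g t \<partial>circle) \<le> (\<integral>t. norm (g t) \<partial>circle)" by (rule integral_norm_bound)
  also have "\<dots> \<le> (\<integral>t. B \<partial>circle)" using i assms by (intro integral_mono) auto
  finally show ?thesis by simp
qed

text \<open>Convexity is used on the open half-line; at \<open>x = 0\<close> the claim reduces to
  \<open>(1 - q) * m powr q <= 0\<close>.\<close>

lemma powr_above_tangent:
  fixes x m q :: real
  assumes "0 \<le> x" "0 < m" "1 \<le> q"
  shows "m powr q + q * m powr (q - 1) * (x - m) \<le> x powr q"
proof (cases "x = 0")
  case True
  have "m powr (q - 1) * m = m powr q"
    using assms by (simp add: powr_diff)
  hence "q * m powr (q - 1) * (0 - m) = - (q * m powr q)" by (simp add: mult.assoc)
  moreover have "1 * m powr q \<le> q * m powr q" using assms by (intro mult_right_mono) auto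
  moreover have "0 powr q = (0 :: real)" by simp
  ultimately show ?thesis unfolding True by linarith
next
  case False
  have "x powr q - m powr q \<ge> (q * m powr (q - 1)) * (x - m)"
  proof (rule convex_on_imp_above_tangent)
    show "convex_on {0<..} (\<lambda>x. x powr q)" using assms by (intro powr_convex)
    show "((\<lambda>x. x powr q) has_real_derivative q * m powr (q - 1)) (at m within {0<..})"
      using assms by (auto intro!: derivative_eq_intros)
  qed (use False assms in \<open>auto simp: interior_open\<close>)
  thus ?thesis by simp
qed

text \<open>Integrate the tangent inequality at the mean \<open>m\<close> against the kernel, which
  has mass 1: the linear term cancels. Integrability of \<open>g\<close> comes from
  \<open>g <= 1 + g powr q\<close> and the boundedness of the kernel.\<close>

lemma poisson_jensen:
  assumes w: "cmod w < 1" and q: "1 \<le> q" and [measurable]: "g \<in> borel_measurable borel"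
    and g: "\<And>t. 0 \<le> g t" and int: "integrable circle (\<lambda>t. g t powr q)"
  shows "integrable circle (\<lambda>t. poisson (w * cis (- t)) * g t)"
    "integrable circle (\<lambda>t. poisson (w * cis (- t)) * g t powr q)"
    "(\<integral>t. poisson (w * cis (- t)) * g t \<partial>circle) powr q
      \<le> (\<integral>t. poisson (w * cis (- t)) * g t powr q \<partial>circle)"
proof -
  let ?P = "\<lambda>t. poisson (w * cis (- t))"
  have pos: "0 \<le> ?P t" for t using w by (intro poisson_nonneg) (simp add: norm_mult)
  have bd: "?P t \<le> 2 / (1 - cmod w)" for t using poisson_kernel_bound[OF w, of t] by simp
  have intP: "integrable circle (\<lambda>t. ?P t * h t)" if "integrable circle h" for h
  proof (rule Bochner_Integration.integrable_bound)
    show "integrable circle (\<lambda>t. 2 / (1 - cmod w) * \<bar>h t\<bar>)" using that by simp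
    show "(\<lambda>t. ?P t * h t) \<in> borel_measurable circle" using that by measurable
    have "norm (?P t * h t) \<le> norm (2 / (1 - cmod w) * \<bar>h t\<bar>)" for t
    proof -
      have "norm (?P t * h t) \<le> 2 / (1 - cmod w) * \<bar>h t\<bar>"
        unfolding real_norm_def abs_mult by (intro mult_right_mono poisson_kernel_bound[OF w]) auto
      thus ?thesis using w by simp
    qed
    thus "AE t in circle. norm (?P t * h t) \<le> norm (2 / (1 - cmod w) * \<bar>h t\<bar>)" by simp
  qed
  have gle: "g t \<le> 1 + g t powr q" for t
  proof (cases "g t \<le> 1")
    case False
    hence "g t powr 1 \<le> g t powr q" using q by (intro powr_mono) auto
    thus ?thesis using False by simp
  qed (simp add: add_increasing2)
  have "integrable circle g"
    by (rule Bochner_Integration.integrable_bound[of _ "\<lambda>t. 1 + g t powr q"])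
       (use int g gle in \<open>auto intro!: AE_I2 Bochner_Integration.integrable_add simp: abs_of_nonneg\<close>)
  thus i1: "integrable circle (\<lambda>t. ?P t * g t)" by (rule intP)
  show i2: "integrable circle (\<lambda>t. ?P t * g t powr q)" using int by (rule intP)
  define m where "m = (\<integral>t. ?P t * g t \<partial>circle)"
  have "m \<ge> 0" unfolding m_def using pos g by (intro integral_nonneg_AE) auto
  have "m powr q \<le> (\<integral>t. ?P t * g t powr q \<partial>circle)"
  proof (cases "m = 0")
    case True
    thus ?thesis using pos by (auto intro!: integral_nonneg_AE)
  next
    case False
    hence m: "m > 0" using \<open>m \<ge> 0\<close> by simp
    have iP: "integrable circle ?P" using intP[of "\<lambda>_. 1"] by simp
    have e: "?P t * (m powr q + q * m powr (q - 1) * (g t - m))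
       = (m powr q - q * m powr (q - 1) * m) * ?P t + q * m powr (q - 1) * (?P t * g t)" for t
      by (simp add: algebra_simps)
    have ie: "integrable circle (\<lambda>t. ?P t * (m powr q + q * m powr (q - 1) * (g t - m)))"
      unfolding e using i1 iP by (intro Bochner_Integration.integrable_add integrable_mult_right)
    have "(\<integral>t. ?P t * (m powr q + q * m powr (q - 1) * (g t - m)) \<partial>circle)
      = (m powr q - q * m powr (q - 1) * m) * (\<integral>t. ?P t \<partial>circle)
        + q * m powr (q - 1) * (\<integral>t. ?P t * g t \<partial>circle)"
      unfolding e using i1 iP by (simp add: Bochner_Integration.integral_add)
    also have "\<dots> = m powr q" by (simp add: integral_poisson[OF w] m_def[symmetric])
    finally have "m powr q = (\<integral>t. ?P t * (m powr q + q * m powr (q - 1) * (g t - m)) \<partial>circle)" by simp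
    also have "\<dots> \<le> (\<integral>t. ?P t * g t powr q \<partial>circle)"
      using ie i2 pos powr_above_tangent[OF g m q]
      by (intro integral_mono mult_left_mono) auto
    finally show ?thesis .
  qed
  thus "(\<integral>t. ?P t * g t \<partial>circle) powr q \<le> (\<integral>t. ?P t * g t powr q \<partial>circle)"
    by (simp add: m_def)
qed

text \<open>Since \<open>r * (1 - s) <= 1 - r * s\<close>, the distance to 1 at most doubles when
  passing from radius \<open>r * s\<close> to \<open>r\<close>, which costs 4 after squaring. Since
  \<open>r <= s\<close>, the numerator satisfies
  \<open>1 - (r * s)^2 <= 1 - r^4 <= 2 * (1 - r^2)\<close>, which costs 2.\<close>

lemma poisson_mult_radius_le:
  assumes "0 \<le> r" "r \<le> s" "s < 1" and a: "cmod a = 1"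
  shows "poisson (of_real (r * s) * a) \<le> 8 * poisson (of_real r * a)"
proof -
  have rs: "r * s \<le> r" "r * s \<le> s"
    using assms mult_left_mono[of s 1 r] mult_right_mono[of r 1 s] by auto
  have n: "cmod (of_real x * a) = x" if "0 \<le> x" for x using that a by (simp add: norm_mult)
  have nrs: "cmod (of_real (r * s) * a) = r * s" using assms by (intro n) simp
  have "r - r * s \<le> 1 - r * s" using assms by simp
  have low: "1 - r * s \<le> cmod (1 - of_real (r * s) * a)"
    using norm_triangle_ineq2[of 1 "of_real (r * s) * a"] nrs by simp
  have "cmod (1 - of_real r * a) = cmod ((1 - of_real (r * s) * a) - of_real (r - r * s) * a)"
    by (simp add: algebra_simps)
  also have "\<dots> \<le> cmod (1 - of_real (r * s) * a) + cmod (of_real (r - r * s) * a)"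
    by (rule norm_triangle_ineq4)
  also have "cmod (of_real (r - r * s) * a) = r - r * s" using rs by (intro n) simp
  finally have le: "cmod (1 - of_real r * a) \<le> 2 * cmod (1 - of_real (r * s) * a)"
    using low assms by linarith
  have num: "1 - (r * s)\<^sup>2 \<le> 2 * (1 - r\<^sup>2)"
  proof -
    have "r\<^sup>2 \<le> r * s" using assms by (simp add: power2_eq_square mult_left_mono)
    hence "(r\<^sup>2)\<^sup>2 \<le> (r * s)\<^sup>2" by (intro power_mono) auto
    moreover have "1 - (r\<^sup>2)\<^sup>2 = (1 + r\<^sup>2) * (1 - r\<^sup>2)" by (simp add: algebra_simps power2_eq_square)
    moreover have "(1 + r\<^sup>2) * (1 - r\<^sup>2) \<le> 2 * (1 - r\<^sup>2)"
      using assms by (intro mult_right_mono) (auto simp: power_le_one)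
    ultimately show ?thesis by linarith
  qed
  have pos: "0 < cmod (1 - of_real r * a)"
  proof -
    have "cmod (of_real r * a) < 1" using assms n by simp
    thus ?thesis by auto
  qed
  have "poisson (of_real (r * s) * a) = (1 - (r * s)\<^sup>2) / (cmod (1 - of_real (r * s) * a))\<^sup>2"
    unfolding poisson_def nrs ..
  also have "\<dots> \<le> (2 * (1 - r\<^sup>2)) / ((cmod (1 - of_real r * a))\<^sup>2 / 4)"
  proof (rule frac_le)
    show "(cmod (1 - of_real r * a))\<^sup>2 / 4 \<le> (cmod (1 - of_real (r * s) * a))\<^sup>2"
      using power_mono[OF le, of 2] by (simp add: power_mult_distrib)
    show "0 \<le> 2 * (1 - r\<^sup>2)" using assms by (simp add: power_le_one)
  qed (use num pos in auto)
  also have "\<dots> = 8 * poisson (of_real r * a)"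
    unfolding poisson_def n[OF assms(1)] by simp
  finally show ?thesis .
qed

text \<open>The smaller radius decides; the sum covers both cases and is symmetric, so that one term
  can serve as the kernel of an operator and the other as that of its adjoint.\<close>

lemma poisson_mult_le:
  assumes "0 \<le> r" "r < 1" "0 \<le> s" "s < 1" and a: "cmod a = 1"
  shows "poisson (of_real r * of_real s * a) \<le> 8 * (poisson (of_real r * a) + poisson (of_real s * a))"
proof -
  have "0 \<le> poisson (of_real r * a)" "0 \<le> poisson (of_real s * a)"
    using assms by (auto intro!: poisson_nonneg simp: norm_mult)
  moreover have "poisson (of_real r * of_real s * a) \<le> 8 * poisson (of_real r * a)
      \<or> poisson (of_real r * of_real s * a) \<le> 8 * poisson (of_real s * a)"
    using poisson_mult_radius_le[of r s a] poisson_mult_radius_le[of s r a] assms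
    by (cases "r \<le> s") (auto simp: mult.commute)
  ultimately show ?thesis by argo
qed

text \<open>The Poisson integral of \<open>g\<close> on the ray of angle \<open>\<theta>\<close>, at
  a distance \<open>k \<theta>\<close> that may vary with the angle. Bounds uniform in
  \<open>k\<close> amount to bounds for the radial maximal function.\<close>

definition poisson_along :: "(real \<Rightarrow> real) \<Rightarrow> (real \<Rightarrow> real) \<Rightarrow> real \<Rightarrow> real" where
  "poisson_along k g \<theta> = (\<integral>t. poisson (of_real (k \<theta>) * cis \<theta> * cis (- t)) * g t \<partial>circle)"

section \<open>The maximal inequality at a variable radius\<close>

context
  fixes k :: "real \<Rightarrow> real" and R :: real
  assumes k_measurable [measurable]: "k \<in> borel_measurable borel"
    and k_bounds: "\<And>\<theta>. 0 \<le> k \<theta>" "\<And>\<theta>. k \<theta> \<le> R" and R: "R < 1"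
begin

private definition K :: "real \<Rightarrow> real \<Rightarrow> real" where
  "K \<theta> t = poisson (of_real (k \<theta>) * cis \<theta> * cis (- t))"

private lemma K_measurable [measurable]: "case_prod K \<in> borel_measurable (circle \<Otimes>\<^sub>M circle)"
  unfolding K_def split_beta by measurable

private lemma norm_point: "cmod (of_real (k \<theta>) * cis \<theta>) = k \<theta>"
  using k_bounds by (simp add: norm_mult)

private lemma norm_point_less: "cmod (of_real (k \<theta>) * cis \<theta>) < 1"
  using k_bounds(2)[of \<theta>] R by (simp add: norm_point)

private lemma K_nonneg: "0 \<le> K \<theta> t"
  unfolding K_def using norm_point_less[of \<theta>] by (intro poisson_nonneg) (simp add: norm_mult)

private lemma K_le: "K \<theta> t \<le> 2 / (1 - R)"
  unfolding K_def using norm_point[of \<theta>] k_bounds(2)[of \<theta>] R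
  by (intro poisson_le_radius) (auto simp: norm_mult)

private lemma U_eq: "poisson_along k g \<theta> = (\<integral>t. K \<theta> t * g t \<partial>circle)"
  by (simp add: poisson_along_def K_def)

private lemma U_measurable [measurable (raw)]:
  assumes [measurable]: "g \<in> borel_measurable borel"
  shows "poisson_along k g \<in> borel_measurable borel"
  unfolding U_eq[abs_def] by measurable

private lemma K_section [measurable]: "K \<theta> \<in> borel_measurable borel" "(\<lambda>\<theta>. K \<theta> t) \<in> borel_measurable borel"
  unfolding K_def[abs_def] by measurable

private lemma R_pos: "0 \<le> 2 / (1 - R)" using R by simp

private lemma int_K_nonneg: "(\<And>t. 0 \<le> g t) \<Longrightarrow> 0 \<le> (\<integral>t. K \<theta> t * g t \<partial>circle)"
  by (intro integral_nonneg_AE) (auto simp: K_nonneg)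

private lemma K_mult_le: "0 \<le> g \<Longrightarrow> g \<le> B \<Longrightarrow> \<bar>K \<theta> t * g\<bar> \<le> 2 / (1 - R) * B"
  unfolding abs_mult using K_nonneg[of \<theta> t] K_le[of \<theta> t] R_pos by (intro mult_mono) auto

private lemma U_bounds:
  assumes [measurable]: "g \<in> borel_measurable borel" and g: "\<And>t. 0 \<le> g t" "\<And>t. g t \<le> B"
  shows "0 \<le> poisson_along k g \<theta>" "poisson_along k g \<theta> \<le> 2 / (1 - R) * B"
proof -
  show "0 \<le> poisson_along k g \<theta>" using int_K_nonneg[of g] g by (simp add: U_eq)
  have "norm (\<integral>t. K \<theta> t * g t \<partial>circle) \<le> 2 / (1 - R) * B"
    by (rule norm_integral_circle_le) (simp_all only: real_norm_def K_mult_le g, measurable)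
  thus "poisson_along k g \<theta> \<le> 2 / (1 - R) * B" by (simp add: U_eq)
qed

text \<open>Only \<open>\<theta> - \<phi>\<close> enters the left side, and \<open>poisson\<close>
  is even in the angle; this turns the second summand into the transposed kernel
  \<open>K \<phi> \<theta>\<close>.\<close>

private lemma kernel_le:
  "poisson (of_real (k \<theta>) * cis \<theta> * cnj (of_real (k \<phi>) * cis \<phi>)) \<le> 8 * (K \<theta> \<phi> + K \<phi> \<theta>)"
proof -
  have "poisson (of_real (k \<theta>) * cis \<theta> * cnj (of_real (k \<phi>) * cis \<phi>))
     = poisson (of_real (k \<theta>) * of_real (k \<phi>) * (cis \<theta> * cis (- \<phi>)))"
    by (simp add: cis_cnj mult_ac)
  also have "cis \<theta> * cis (- \<phi>) = cis (\<theta> - \<phi>)" by (simp add: cis_mult)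
  also have "poisson (of_real (k \<theta>) * of_real (k \<phi>) * cis (\<theta> - \<phi>))
      \<le> 8 * (poisson (of_real (k \<theta>) * cis (\<theta> - \<phi>)) + poisson (of_real (k \<phi>) * cis (\<theta> - \<phi>)))"
    using k_bounds[of \<theta>] k_bounds[of \<phi>] R by (intro poisson_mult_le) auto
  also have "poisson (of_real (k \<phi>) * cis (\<theta> - \<phi>)) = poisson (of_real (k \<phi>) * cis (\<phi> - \<theta>))"
    using poisson_cnj[of "of_real (k \<phi>) * cis (\<theta> - \<phi>)"] by (simp add: cis_cnj)
  finally show ?thesis by (simp add: K_def mult.assoc cis_mult)
qed

text \<open>
  The \<open>TT\<^sup>*\<close> argument. With \<open>T g = poisson_along k g\<close>, the semigroup identity turns the kernel of
  \<open>TT\<^sup>*\<close> into a Poisson kernel of radius \<open>k \<theta> * k \<phi>\<close>, which \<open>poisson_mult_le\<close> bounds by the kernels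
  of \<open>T\<close> and \<open>T\<^sup>*\<close>. Hence the square of the norm of \<open>T\<close> is at most 16 times the norm itself, and the
  bound \<open>x\<close> on the squared norm improves to \<open>16 * sqrt x\<close>, whose fixed point is 256.
\<close>

private lemma maximal_step:
  assumes x: "0 < x" and bound: "\<And>g B. g \<in> borel_measurable borel \<Longrightarrow> (\<And>t. 0 \<le> g t) \<Longrightarrow> (\<And>t. g t \<le> B) \<Longrightarrow>
      (\<integral>\<theta>. (poisson_along k g \<theta>)\<^sup>2 \<partial>circle) \<le> x * (\<integral>t. (g t)\<^sup>2 \<partial>circle)"
    and g [measurable]: "g \<in> borel_measurable borel" and g0: "\<And>t. 0 \<le> g t" and gB: "\<And>t. g t \<le> B"
  shows "(\<integral>\<theta>. (poisson_along k g \<theta>)\<^sup>2 \<partial>circle) \<le> 16 * sqrt x * (\<integral>t. (g t)\<^sup>2 \<partial>circle)"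
proof -
  define h where "h = poisson_along k g"
  define C where "C = 2 / (1 - R)"
  have C: "0 \<le> C" using R_pos by (simp add: C_def)
  have KC: "\<bar>K \<theta> t * a\<bar> \<le> C * D" if "0 \<le> a" "a \<le> D" for \<theta> t a D
    unfolding C_def using that by (rule K_mult_le)
  have h0: "0 \<le> h \<theta>" and hB: "h \<theta> \<le> C * B" for \<theta>
    unfolding h_def C_def using U_bounds[OF g g0 gB] by auto
  have [measurable]: "h \<in> borel_measurable borel" unfolding h_def by measurable
  \<comment> \<open>\<open>H = T\<^sup>* h = T\<^sup>* (T g)\<close>: the adjoint integrates over
    the first argument of \<open>K\<close>. Hence the square integral of \<open>h\<close> is the
    pairing of \<open>g\<close> with \<open>H\<close>.\<close>
  define H where "H t = (\<integral>\<theta>. K \<theta> t * h \<theta> \<partial>circle)" for t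
  have [measurable]: "H \<in> borel_measurable borel" unfolding H_def[abs_def] by measurable
  have H0: "0 \<le> H t" for t unfolding H_def by (intro integral_nonneg_AE) (auto simp: K_nonneg h0)
  have HB: "H t \<le> C * (C * B)" for t
  proof -
    have "norm (H t) \<le> C * (C * B)" unfolding H_def
      by (rule norm_integral_circle_le) (simp_all only: real_norm_def KC h0 hB, measurable)
    thus ?thesis by simp
  qed
  have sq_int: "integrable circle (\<lambda>t. (a t)\<^sup>2)" if "a \<in> borel_measurable borel" "\<And>t. 0 \<le> a t" "\<And>t. a t \<le> D"
    for a :: "real \<Rightarrow> real" and D
    using that by (intro integrable_circle_bounded[of _ "D\<^sup>2"]) (auto intro!: power_mono)
  have mult_int: "integrable circle (\<lambda>t. a t * b t)"
    if "a \<in> borel_measurable borel" "\<And>t. 0 \<le> a t" "\<And>t. a t \<le> D"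
      "b \<in> borel_measurable borel" "\<And>t. 0 \<le> b t" "\<And>t. b t \<le> E"
    for a b :: "real \<Rightarrow> real" and D E
  proof (rule integrable_circle_bounded[of _ "D * E"])
    show "norm (a t * b t) \<le> D * E" for t
      using that(2,3,5,6)[of t] by (auto simp: abs_mult intro!: mult_mono)
  qed (use that in measurable)
  have amgm: "(\<integral>t. a t * b t \<partial>circle) \<le> (l / 2) * (\<integral>t. (a t)\<^sup>2 \<partial>circle) + (1 / (2 * l)) * (\<integral>t. (b t)\<^sup>2 \<partial>circle)"
    if l: "0 < l" and ab: "a \<in> borel_measurable borel" "\<And>t. 0 \<le> a t" "\<And>t. a t \<le> D"
      "b \<in> borel_measurable borel" "\<And>t. 0 \<le> b t" "\<And>t. b t \<le> E"
    for a b :: "real \<Rightarrow> real" and D E l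
  proof -
    have p: "u * v \<le> (l / 2) * u\<^sup>2 + (1 / (2 * l)) * v\<^sup>2" for u v :: real
    proof -
      have "0 \<le> (l * u - v)\<^sup>2 / (2 * l)" using l by simp
      also have "\<dots> = (l / 2) * u\<^sup>2 + (1 / (2 * l)) * v\<^sup>2 - u * v"
        using l by (simp add: field_simps power2_eq_square)
      finally show ?thesis by simp
    qed
    have "(\<integral>t. a t * b t \<partial>circle) \<le> (\<integral>t. (l / 2) * (a t)\<^sup>2 + (1 / (2 * l)) * (b t)\<^sup>2 \<partial>circle)"
      using mult_int[OF ab] sq_int[OF ab(1-3)] sq_int[OF ab(4-6)] p
      by (intro integral_mono Bochner_Integration.integrable_add integrable_mult_right)
    also have "\<dots> = (l / 2) * (\<integral>t. (a t)\<^sup>2 \<partial>circle) + (1 / (2 * l)) * (\<integral>t. (b t)\<^sup>2 \<partial>circle)"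
      using sq_int[OF ab(1-3)] sq_int[OF ab(4-6)]
      by (subst Bochner_Integration.integral_add) auto
    finally show ?thesis .
  qed
  have hg: "(\<integral>\<theta>. (h \<theta>)\<^sup>2 \<partial>circle) = (\<integral>t. g t * H t \<partial>circle)"
  proof -
    have "(\<integral>\<theta>. (h \<theta>)\<^sup>2 \<partial>circle) = (\<integral>\<theta>. \<integral>t. h \<theta> * (K \<theta> t * g t) \<partial>circle \<partial>circle)"
      by (simp add: h_def U_eq power2_eq_square)
    also have "\<dots> = (\<integral>t. \<integral>\<theta>. h \<theta> * (K \<theta> t * g t) \<partial>circle \<partial>circle)"
    proof (rule circle_Fubini[where B = "(C * B) * (C * B)"])
      show "norm (h \<theta> * (K \<theta> t * g t)) \<le> C * B * (C * B)" for \<theta> t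
        unfolding real_norm_def abs_mult[of "h \<theta>"]
        using KC[OF g0 gB] h0[of \<theta>] hB[of \<theta>] by (intro mult_mono) auto
    qed measurable
    also have "\<dots> = (\<integral>t. g t * H t \<partial>circle)"
      by (simp add: H_def mult_ac flip: integral_mult_right_zero)
    finally show ?thesis .
  qed
  \<comment> \<open>Pointwise \<open>T (T\<^sup>* h) <= 8 * (T h + T\<^sup>* h)\<close>; the kernel
    bound passes to the integrals because \<open>h\<close> is nonnegative.\<close>
  have inner: "(\<integral>t. K \<theta> t * H t \<partial>circle) \<le> (\<integral>\<phi>. 8 * (K \<theta> \<phi> + K \<phi> \<theta>) * h \<phi> \<partial>circle)" for \<theta>
  proof -
    have "(\<integral>t. K \<theta> t * H t \<partial>circle) = (\<integral>t. \<integral>\<phi>. K \<theta> t * (K \<phi> t * h \<phi>) \<partial>circle \<partial>circle)"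
      by (simp add: H_def)
    also have "\<dots> = (\<integral>\<phi>. \<integral>t. K \<theta> t * (K \<phi> t * h \<phi>) \<partial>circle \<partial>circle)"
    proof (rule circle_Fubini[where B = "C * (C * (C * B))"])
      show "norm (K \<theta> t * (K \<phi> t * h \<phi>)) \<le> C * (C * (C * B))" for t \<phi>
        using KC[of "K \<phi> t * h \<phi>" "C * (C * B)" \<theta> t] KC[OF h0 hB, of \<phi> t \<phi>]
          K_nonneg[of \<phi> t] h0[of \<phi>] by simp
    qed measurable
    also have "\<dots> = (\<integral>\<phi>. (\<integral>t. K \<theta> t * K \<phi> t \<partial>circle) * h \<phi> \<partial>circle)"
      by (simp add: mult_ac flip: integral_mult_right_zero integral_mult_left_zero)
    also have "\<dots> = (\<integral>\<phi>. poisson (of_real (k \<theta>) * cis \<theta> * cnj (of_real (k \<phi>) * cis \<phi>)) * h \<phi> \<partial>circle)"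
      unfolding K_def by (simp only: poisson_semigroup[OF norm_point_less norm_point_less])
    also have "\<dots> \<le> (\<integral>\<phi>. 8 * (K \<theta> \<phi> + K \<phi> \<theta>) * h \<phi> \<partial>circle)"
    proof (rule integral_mono)
      have lt: "cmod (of_real (k \<theta>) * cis \<theta> * cnj (of_real (k \<phi>) * cis \<phi>)) < 1" for \<phi>
        using norm_point_less[of \<theta>] norm_point_less[of \<phi>] mult_strict_mono'[of "k \<theta>" 1 "k \<phi>" 1] k_bounds
        by (simp add: norm_mult)
      have nn: "0 \<le> poisson (of_real (k \<theta>) * cis \<theta> * cnj (of_real (k \<phi>) * cis \<phi>))" for \<phi>
        using lt by (intro poisson_nonneg less_imp_le)
      have le: "8 * (K \<theta> \<phi> + K \<phi> \<theta>) \<le> 8 * (C + C)" for \<phi>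
        unfolding C_def by (intro mult_left_mono add_mono K_le) auto
      show "integrable circle (\<lambda>\<phi>. 8 * (K \<theta> \<phi> + K \<phi> \<theta>) * h \<phi>)"
        by (rule mult_int) (use le K_nonneg h0 hB in auto)
      show "integrable circle (\<lambda>\<phi>. poisson (of_real (k \<theta>) * cis \<theta> * cnj (of_real (k \<phi>) * cis \<phi>)) * h \<phi>)"
        by (rule mult_int[OF _ nn order.trans[OF kernel_le le] _ h0 hB]; measurable)
      show "poisson (of_real (k \<theta>) * cis \<theta> * cnj (of_real (k \<phi>) * cis \<phi>)) * h \<phi>
          \<le> 8 * (K \<theta> \<phi> + K \<phi> \<theta>) * h \<phi>" for \<phi>
        by (intro mult_right_mono kernel_le h0)
    qed
    finally show ?thesis .
  qed
  have fac: "norm (h \<theta> * (K \<phi> \<psi> * h \<phi>')) \<le> C * B * (C * (C * B))" for \<theta> \<phi> \<psi> \<phi>'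
  proof -
    have "\<bar>h \<theta>\<bar> * \<bar>K \<phi> \<psi> * h \<phi>'\<bar> \<le> (C * B) * (C * (C * B))"
      using h0[of \<theta>] hB[of \<theta>] KC[OF h0 hB, of \<phi> \<psi> \<phi>'] by (intro mult_mono) auto
    thus ?thesis by (simp add: abs_mult)
  qed
  have "(\<integral>t. (H t)\<^sup>2 \<partial>circle) = (\<integral>t. \<integral>\<theta>. H t * (K \<theta> t * h \<theta>) \<partial>circle \<partial>circle)"
    by (simp add: H_def power2_eq_square)
  also have "\<dots> = (\<integral>\<theta>. \<integral>t. H t * (K \<theta> t * h \<theta>) \<partial>circle \<partial>circle)"
  proof (rule circle_Fubini[where B = "C * (C * B) * (C * (C * B))"])
    fix t \<theta>
    have "\<bar>H t\<bar> * \<bar>K \<theta> t * h \<theta>\<bar> \<le> C * (C * B) * (C * (C * B))"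
      using H0[of t] HB[of t] KC[OF h0 hB, of \<theta> t \<theta>] by (intro mult_mono) auto
    thus "norm (H t * (K \<theta> t * h \<theta>)) \<le> C * (C * B) * (C * (C * B))" by (simp add: abs_mult)
  qed measurable
  also have "\<dots> = (\<integral>\<theta>. h \<theta> * (\<integral>t. K \<theta> t * H t \<partial>circle) \<partial>circle)"
    by (simp add: mult_ac flip: integral_mult_right_zero)
  also have "\<dots> \<le> (\<integral>\<theta>. h \<theta> * (\<integral>\<phi>. 8 * (K \<theta> \<phi> + K \<phi> \<theta>) * h \<phi> \<partial>circle) \<partial>circle)"
  proof (rule integral_mono[OF _ _ mult_left_mono[OF inner h0]])
    have KH: "0 \<le> (\<integral>t. K \<theta> t * H t \<partial>circle)" "(\<integral>t. K \<theta> t * H t \<partial>circle) \<le> C * (C * (C * B))" for \<theta>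
      using U_bounds[of H "C * (C * B)" \<theta>] H0 HB by (simp_all add: U_eq C_def)
    show "integrable circle (\<lambda>\<theta>. h \<theta> * (\<integral>t. K \<theta> t * H t \<partial>circle))"
      by (rule mult_int[OF _ h0 hB _ KH]) measurable
    have b: "\<bar>8 * (K \<theta> \<phi> + K \<phi> \<theta>) * h \<phi>\<bar> \<le> 8 * (C + C) * (C * B)" for \<theta> \<phi>
    proof -
      have "\<bar>8 * (K \<theta> \<phi> + K \<phi> \<theta>)\<bar> \<le> 8 * (C + C)"
        using K_nonneg[of \<theta> \<phi>] K_nonneg[of \<phi> \<theta>]
          add_mono[OF K_le[of \<theta> \<phi>] K_le[of \<phi> \<theta>], folded C_def]
        by (subst abs_of_nonneg) (auto intro!: mult_left_mono)
      moreover have "\<bar>h \<phi>\<bar> \<le> C * B" using h0[of \<phi>] hB[of \<phi>] by simp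
      ultimately show ?thesis
        unfolding abs_mult[of "8 * (K \<theta> \<phi> + K \<phi> \<theta>)"] using C by (intro mult_mono) auto
    qed
    have b2: "norm (\<integral>\<phi>. 8 * (K \<theta> \<phi> + K \<phi> \<theta>) * h \<phi> \<partial>circle) \<le> 8 * (C + C) * (C * B)" for \<theta>
      by (rule norm_integral_circle_le) (use b in auto)
    show "integrable circle (\<lambda>\<theta>. h \<theta> * (\<integral>\<phi>. 8 * (K \<theta> \<phi> + K \<phi> \<theta>) * h \<phi> \<partial>circle))"
    proof (rule mult_int[OF _ h0 hB])
      show "0 \<le> (\<integral>\<phi>. 8 * (K \<theta> \<phi> + K \<phi> \<theta>) * h \<phi> \<partial>circle)" for \<theta>
        using KH(1) inner by (rule order.trans)
      show "(\<integral>\<phi>. 8 * (K \<theta> \<phi> + K \<phi> \<theta>) * h \<phi> \<partial>circle) \<le> 8 * (C + C) * (C * B)" for \<theta>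
        using b2[of \<theta>] unfolding real_norm_def by (rule abs_le_D1)
    qed measurable
  qed
  \<comment> \<open>Paired with \<open>h\<close> itself, \<open>T\<close> and
    \<open>T\<^sup>*\<close> give the same value, so 8 becomes 16.\<close>
  also have "\<dots> = 16 * (\<integral>\<theta>. h \<theta> * poisson_along k h \<theta> \<partial>circle)"
  proof -
    have i: "integrable circle (\<lambda>\<phi>. h \<theta> * (K \<theta> \<phi> * h \<phi>))" "integrable circle (\<lambda>\<phi>. h \<theta> * (K \<phi> \<theta> * h \<phi>))" for \<theta>
      by (rule integrable_circle_bounded[OF _ fac], measurable)+
    have o: "integrable circle (\<lambda>\<theta>. \<integral>\<phi>. h \<theta> * (K \<theta> \<phi> * h \<phi>) \<partial>circle)"
      "integrable circle (\<lambda>\<theta>. \<integral>\<phi>. h \<theta> * (K \<phi> \<theta> * h \<phi>) \<partial>circle)"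
      by (rule integrable_circle_bounded[OF _ norm_integral_circle_le[OF _ fac]], measurable)+
    have eq: "h \<theta> * (\<integral>\<phi>. 8 * (K \<theta> \<phi> + K \<phi> \<theta>) * h \<phi> \<partial>circle)
        = 8 * ((\<integral>\<phi>. h \<theta> * (K \<theta> \<phi> * h \<phi>) \<partial>circle) + (\<integral>\<phi>. h \<theta> * (K \<phi> \<theta> * h \<phi>) \<partial>circle))" for \<theta>
    proof -
      have "h \<theta> * (\<integral>\<phi>. 8 * (K \<theta> \<phi> + K \<phi> \<theta>) * h \<phi> \<partial>circle)
          = (\<integral>\<phi>. h \<theta> * (8 * (K \<theta> \<phi> + K \<phi> \<theta>) * h \<phi>) \<partial>circle)" by simp
      also have "\<dots> = (\<integral>\<phi>. 8 * (h \<theta> * (K \<theta> \<phi> * h \<phi>) + h \<theta> * (K \<phi> \<theta> * h \<phi>)) \<partial>circle)"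
        by (simp add: algebra_simps)
      also have "\<dots> = 8 * (\<integral>\<phi>. h \<theta> * (K \<theta> \<phi> * h \<phi>) + h \<theta> * (K \<phi> \<theta> * h \<phi>) \<partial>circle)"
        by (rule integral_mult_right_zero)
      finally show ?thesis by (simp only: Bochner_Integration.integral_add[OF i])
    qed
    have "(\<integral>\<theta>. h \<theta> * (\<integral>\<phi>. 8 * (K \<theta> \<phi> + K \<phi> \<theta>) * h \<phi> \<partial>circle) \<partial>circle)
      = 8 * ((\<integral>\<theta>. \<integral>\<phi>. h \<theta> * (K \<theta> \<phi> * h \<phi>) \<partial>circle \<partial>circle)
          + (\<integral>\<theta>. \<integral>\<phi>. h \<theta> * (K \<phi> \<theta> * h \<phi>) \<partial>circle \<partial>circle))"
      unfolding eq
      by (subst integral_mult_right_zero, subst Bochner_Integration.integral_add[OF o], rule refl)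
    also have "(\<integral>\<theta>. \<integral>\<phi>. h \<theta> * (K \<phi> \<theta> * h \<phi>) \<partial>circle \<partial>circle)
        = (\<integral>\<phi>. \<integral>\<theta>. h \<theta> * (K \<phi> \<theta> * h \<phi>) \<partial>circle \<partial>circle)"
      by (rule circle_Fubini[OF _ fac]) measurable
    also have "\<dots> = (\<integral>\<theta>. \<integral>\<phi>. h \<theta> * (K \<theta> \<phi> * h \<phi>) \<partial>circle \<partial>circle)"
      by (simp add: mult_ac)
    finally show ?thesis by (simp add: U_eq)
  qed
  \<comment> \<open>The weight \<open>sqrt x\<close> balances the terms: by \<open>bound\<close>,
    applied to \<open>h\<close>, each is at most \<open>sqrt x / 2\<close> times the square integral
    of \<open>h\<close>.\<close>
  also have "(\<integral>\<theta>. h \<theta> * poisson_along k h \<theta> \<partial>circle) \<le> (sqrt x / 2) * (\<integral>\<theta>. (h \<theta>)\<^sup>2 \<partial>circle)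
      + (1 / (2 * sqrt x)) * (\<integral>\<theta>. (poisson_along k h \<theta>)\<^sup>2 \<partial>circle)"
    using U_bounds[of h, OF _ h0 hB] x by (intro amgm[where D = "C * B" and E = "2 / (1 - R) * (C * B)"]) (auto simp: h0 hB)
  also have "\<dots> \<le> (sqrt x / 2) * (\<integral>\<theta>. (h \<theta>)\<^sup>2 \<partial>circle) + (1 / (2 * sqrt x)) * (x * (\<integral>\<theta>. (h \<theta>)\<^sup>2 \<partial>circle))"
    using x by (intro add_left_mono mult_left_mono bound[of h "C * B"]) (auto simp: h0 hB)
  also have "\<dots> = sqrt x * (\<integral>\<theta>. (h \<theta>)\<^sup>2 \<partial>circle)"
  proof -
    have "x = sqrt x * sqrt x" using x by simp
    thus ?thesis using x by (simp add: field_simps)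
  qed
  finally have HH: "(\<integral>t. (H t)\<^sup>2 \<partial>circle) \<le> 16 * sqrt x * (\<integral>\<theta>. (h \<theta>)\<^sup>2 \<partial>circle)" by simp
  have l: "0 < 16 * sqrt x" using x by simp
  \<comment> \<open>With weight \<open>16 * sqrt x\<close>, the bound \<open>HH\<close> returns
    exactly half of the square integral of \<open>h\<close>, which is absorbed on the left; this
    doubles 8 to 16.\<close>
  have "(\<integral>\<theta>. (h \<theta>)\<^sup>2 \<partial>circle) \<le> (16 * sqrt x / 2) * (\<integral>t. (g t)\<^sup>2 \<partial>circle)
      + (1 / (2 * (16 * sqrt x))) * (\<integral>t. (H t)\<^sup>2 \<partial>circle)"
    unfolding hg by (rule amgm[OF l g g0 gB _ H0 HB]) measurable
  also have "\<dots> \<le> (16 * sqrt x / 2) * (\<integral>t. (g t)\<^sup>2 \<partial>circle)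
      + (1 / (2 * (16 * sqrt x))) * (16 * sqrt x * (\<integral>\<theta>. (h \<theta>)\<^sup>2 \<partial>circle))"
    using HH l by (intro add_left_mono mult_left_mono) auto
  also have "\<dots> = 8 * sqrt x * (\<integral>t. (g t)\<^sup>2 \<partial>circle) + (\<integral>\<theta>. (h \<theta>)\<^sup>2 \<partial>circle) / 2"
    using l by simp
  finally show ?thesis by (simp add: h_def)
qed

text \<open>\<open>X\<close> collects the admissible constants for the squared norm. It contains a
  crude constant that blows up as \<open>R\<close> tends to 1, and it is stable under
  \<open>x\<close> to \<open>16 * sqrt x\<close>, so its infimum cannot exceed the fixed point 256.
  The bound is thereby uniform in \<open>k\<close> and \<open>R\<close>, as the passage to a
  supremum over countably many radii requires.\<close>

lemma maximal_inequality:
  assumes g: "g \<in> borel_measurable borel" and g0: "\<And>t. 0 \<le> g t" and gB: "\<And>t. g t \<le> B"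
  shows "(\<integral>\<theta>. (poisson_along k g \<theta>)\<^sup>2 \<partial>circle) \<le> 256 * (\<integral>t. (g t)\<^sup>2 \<partial>circle)"
proof -
  define X where "X = {x. 0 < x \<and> (\<forall>g B. g \<in> borel_measurable borel \<longrightarrow> (\<forall>t. 0 \<le> g t) \<longrightarrow> (\<forall>t. g t \<le> B) \<longrightarrow>
      (\<integral>\<theta>. (poisson_along k g \<theta>)\<^sup>2 \<partial>circle) \<le> x * (\<integral>t. (g t)\<^sup>2 \<partial>circle))}"
  have X_le: "(\<integral>\<theta>. (poisson_along k g \<theta>)\<^sup>2 \<partial>circle) \<le> x * (\<integral>t. (g t)\<^sup>2 \<partial>circle)" if "x \<in> X" for x
    using that g g0 gB unfolding X_def by blast
  have X_pos: "0 < x" if "x \<in> X" for x using that by (simp add: X_def)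
  have step: "16 * sqrt x \<in> X" if "x \<in> X" for x
  proof -
    have bound: "(\<integral>\<theta>. (poisson_along k g \<theta>)\<^sup>2 \<partial>circle) \<le> x * (\<integral>t. (g t)\<^sup>2 \<partial>circle)"
      if "g \<in> borel_measurable borel" "\<And>t. 0 \<le> g t" "\<And>t. g t \<le> B" for g B
      using that \<open>x \<in> X\<close> unfolding X_def by blast
    have "(\<integral>\<theta>. (poisson_along k g \<theta>)\<^sup>2 \<partial>circle) \<le> 16 * sqrt x * (\<integral>t. (g t)\<^sup>2 \<partial>circle)"
      if "g \<in> borel_measurable borel" "\<And>t. 0 \<le> g t" "\<And>t. g t \<le> B" for g B
      by (rule maximal_step[OF X_pos[OF \<open>x \<in> X\<close>] _ that]) (rule bound)
    moreover have "0 < 16 * sqrt x" using X_pos[OF \<open>x \<in> X\<close>] by simp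
    ultimately show ?thesis unfolding X_def by blast
  qed
  have C: "0 < 2 / (1 - R)" using R by simp
  \<comment> \<open>The starting constant: Jensen's inequality with exponent 2 and the bound
    \<open>K_le\<close>, for each \<open>\<theta>\<close> separately.\<close>
  have "2 / (1 - R) \<in> X"
  proof -
    have "(\<integral>\<theta>. (poisson_along k g \<theta>)\<^sup>2 \<partial>circle) \<le> 2 / (1 - R) * (\<integral>t. (g t)\<^sup>2 \<partial>circle)"
      if [measurable]: "g \<in> borel_measurable borel" and g: "\<And>t. 0 \<le> g t" "\<And>t. g t \<le> B" for g B
    proof -
      have i: "integrable circle (\<lambda>t. (g t)\<^sup>2)"
        using g by (intro integrable_circle_bounded[of _ "B\<^sup>2"]) (auto intro!: power_mono)
      have "(poisson_along k g \<theta>)\<^sup>2 \<le> 2 / (1 - R) * (\<integral>t. (g t)\<^sup>2 \<partial>circle)" for \<theta>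
      proof -
        have nn: "0 \<le> (\<integral>t. K \<theta> t * g t \<partial>circle)" using g(1) by (rule int_K_nonneg)
        have j: "(\<integral>t. K \<theta> t * g t \<partial>circle) powr 2 \<le> (\<integral>t. K \<theta> t * g t powr 2 \<partial>circle)"
          unfolding K_def using i g
          by (intro poisson_jensen(3)[OF norm_point_less]) (auto simp: powr_numeral)
        have "(poisson_along k g \<theta>)\<^sup>2 \<le> (\<integral>t. K \<theta> t * (g t)\<^sup>2 \<partial>circle)"
          using j nn g by (simp add: U_eq powr_numeral)
        also have "\<dots> \<le> (\<integral>t. 2 / (1 - R) * (g t)\<^sup>2 \<partial>circle)"
        proof (intro integral_mono mult_right_mono K_le)
          show "integrable circle (\<lambda>t. K \<theta> t * (g t)\<^sup>2)"
            by (rule integrable_circle_bounded[of _ "2 / (1 - R) * B\<^sup>2"])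
               (use g in \<open>auto intro!: K_mult_le[simplified] power_mono simp: K_mult_le\<close>)
        qed (use i in auto)
        finally show ?thesis by simp
      qed
      hence "(\<integral>\<theta>. (poisson_along k g \<theta>)\<^sup>2 \<partial>circle) \<le> (\<integral>\<theta>. 2 / (1 - R) * (\<integral>t. (g t)\<^sup>2 \<partial>circle) \<partial>circle)"
        by (intro integral_mono integrable_circle_bounded[of _ "2 / (1 - R) * (\<integral>t. (g t)\<^sup>2 \<partial>circle)"])
           (use R in auto)
      thus ?thesis by simp
    qed
    thus ?thesis using C unfolding X_def by auto
  qed
  hence ne: "X \<noteq> {}" by auto
  define x0 where "x0 = Inf X"
  have bb: "bdd_below X" using X_pos by (intro bdd_belowI[of _ 0]) (auto intro: less_imp_le)
  have x0: "0 \<le> x0" unfolding x0_def using ne X_pos by (intro cInf_greatest) (auto intro: less_imp_le)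
  \<comment> \<open>Stability gives \<open>x0 <= 16 * sqrt x\<close> for every \<open>x\<close> in
    \<open>X\<close>; after squaring, the infimum over \<open>x\<close> yields
    \<open>x0^2 / 256 <= x0\<close>.\<close>
  have "x0\<^sup>2 / 256 \<le> x" if "x \<in> X" for x
  proof -
    have "x0 \<le> 16 * sqrt x" unfolding x0_def using step[OF that] bb by (intro cInf_lower)
    hence "x0\<^sup>2 \<le> (16 * sqrt x)\<^sup>2" using x0 by (intro power_mono)
    thus ?thesis using X_pos[OF that] by (simp add: power_mult_distrib)
  qed
  hence "x0\<^sup>2 / 256 \<le> x0" unfolding x0_def[of ] using ne by (intro cInf_greatest) (auto simp: x0_def)
  hence "x0 \<le> 256"
    using x0 by (cases "x0 = 0") (auto simp: power2_eq_square field_simps)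
  let ?J = "\<integral>t. (g t)\<^sup>2 \<partial>circle"
  have J: "0 \<le> ?J" by simp
  show ?thesis
  proof (cases "?J = 0")
    case True
    thus ?thesis using X_le[OF \<open>2 / (1 - R) \<in> X\<close>] by simp
  next
    case False
    hence "(\<integral>\<theta>. (poisson_along k g \<theta>)\<^sup>2 \<partial>circle) / ?J \<le> x0"
      unfolding x0_def
    proof (intro cInf_greatest ne)
      fix x assume "x \<in> X"
      moreover have "0 < ?J" using False J by linarith
      ultimately show "(\<integral>\<theta>. (poisson_along k g \<theta>)\<^sup>2 \<partial>circle) / ?J \<le> x"
        using X_le by (simp only: pos_divide_le_eq)
    qed
    hence "(\<integral>\<theta>. (poisson_along k g \<theta>)\<^sup>2 \<partial>circle) / ?J \<le> 256" using \<open>x0 \<le> 256\<close> by linarith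
    moreover have "0 < ?J" using False J by linarith
    ultimately show ?thesis by (simp only: pos_divide_le_eq)
  qed
qed

end

subsection \<open>A discrete Hilbert inequality\<close>

text \<open>Jordan's inequality: a concave function lies above its chord.\<close>

lemma sin_ge_linear:
  fixes y :: real
  assumes "0 \<le> y" "y \<le> pi / 2"
  shows "2 * y / pi \<le> sin y"
proof -
  have "concave_on {0..pi / 2} (sin :: real \<Rightarrow> real)"
    by (rule f''_le0_imp_concave[where f' = cos and f'' = "\<lambda>x. - sin x"])
       (auto intro!: derivative_eq_intros sin_ge_zero)
  from concave_onD[OF this, of "2 * y / pi" 0 "pi / 2"] assms
  show ?thesis by (simp add: field_simps)
qed

text \<open>The angle on the left has sine \<open>sqrt r\<close>, so Jordan's inequality bounds
  it.\<close>

lemma arctan_sqrt_le: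
  fixes r :: real
  assumes "0 < r" "r < 1"
  shows "arctan (sqrt (r / (1 - r))) \<le> pi / 2 * sqrt r"
proof -
  define y where "y = arctan (sqrt (r / (1 - r)))"
  have "0 \<le> y" "y \<le> pi / 2" unfolding y_def
    using assms arctan_ubound[of "sqrt (r / (1 - r))"] by (auto simp: zero_le_arctan_iff)
  moreover have "sin y = sqrt r"
  proof -
    have "1 + r / (1 - r) = 1 / (1 - r)" using assms by (simp add: field_simps)
    moreover have "(sqrt (r / (1 - r)))\<^sup>2 = r / (1 - r)" using assms by simp
    ultimately have "sin y = sqrt (r / (1 - r)) / sqrt (1 / (1 - r))"
      by (simp only: y_def sin_arctan)
    also have "\<dots> = sqrt r" using assms by (simp add: real_sqrt_divide)
    finally show ?thesis .
  qed
  ultimately show ?thesis using sin_ge_linear[of y] by (simp add: y_def field_simps)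
qed

text \<open>On each cell the increment of \<open>F\<close> is \<open>1 / N\<close> times a value of
  \<open>h\<close> to the right of the left endpoint. At 1 only continuity of \<open>F\<close> is
  asked, because the weights used below are singular there.\<close>

lemma left_riemann_sum_le:
  fixes F h :: "real \<Rightarrow> real"
  assumes cont: "continuous_on {0..1} F"
    and der: "\<And>s. 0 < s \<Longrightarrow> s < 1 \<Longrightarrow> (F has_real_derivative h s) (at s)"
    and mono: "\<And>a b. 0 \<le> a \<Longrightarrow> a \<le> b \<Longrightarrow> b < 1 \<Longrightarrow> h a \<le> h b" and N: "0 < N"
  shows "(\<Sum>k<N. h (real k / N) / N) \<le> F 1 - F 0"
proof -
  have step: "h (real k / N) / N \<le> F (real (Suc k) / N) - F (real k / N)" if k: "k < N" for k
  proof -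
    have lt: "real k / N < real (Suc k) / N" using N by (simp add: divide_strict_right_mono)
    have le1: "real (Suc k) / N \<le> 1" using k by simp
    have "\<exists>l z. real k / N < z \<and> z < real (Suc k) / N \<and> (F has_real_derivative l) (at z) \<and>
        F (real (Suc k) / N) - F (real k / N) = (real (Suc k) / N - real k / N) * l"
    proof (rule MVT[OF lt])
      show "continuous_on {real k / N..real (Suc k) / N} F"
        by (rule continuous_on_subset[OF cont]) (use le1 in auto)
      show "F differentiable (at x)" if "real k / N < x" "x < real (Suc k) / N" for x
      proof -
        have "0 < x" using that(1) by (rule le_less_trans[rotated]) simp
        thus ?thesis using der[of x] that(2) le1 real_differentiable_def by fastforce
      qed
    qed
    then obtain l z where z: "real k / N < z" "z < real (Suc k) / N" "(F has_real_derivative l) (at z)"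
      and e: "F (real (Suc k) / N) - F (real k / N) = (real (Suc k) / N - real k / N) * l" by blast
    have "0 < z" using z(1) by (rule le_less_trans[rotated]) simp
    hence "l = h z" using DERIV_unique[OF z(3)] der z(2) le1 by force
    moreover have "h (real k / N) \<le> h z" using z le1 by (intro mono) auto
    moreover have "real (Suc k) / N - real k / N = 1 / N" by (simp add: diff_divide_distrib[symmetric])
    ultimately show ?thesis using e N by (simp add: divide_right_mono)
  qed
  have "(\<Sum>k<N. h (real k / N) / N) \<le> (\<Sum>k<N. F (real (Suc k) / N) - F (real k / N))"
    by (intro sum_mono step) auto
  also have "\<dots> = F (real N / N) - F (real 0 / N)" by (rule sum_lessThan_telescope)
  finally show ?thesis using N by simp
qed

text \<open>
  Schur's test for the kernel \<open>1 / (1 - r * s)\<close> on the unit interval with the weight \<open>1 / sqrt (1 - s)\<close>.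
  The integrand increases with \<open>s\<close>, so left Riemann sums do not exceed the integral.
\<close>

lemma schur_row_sum_le:
  fixes r :: real
  assumes r: "0 \<le> r" "r < 1" and N: "0 < N"
  shows "(\<Sum>k<N. 1 / ((1 - r * (real k / N)) * sqrt (1 - real k / N)) / N) \<le> pi / sqrt (1 - r)"
proof -
  define h where "h s = 1 / ((1 - r * s) * sqrt (1 - s))" for s
  have rs: "r * s < 1" if "s \<le> 1" for s
    using r that mult_left_mono[of s 1 r] by simp
  have mono: "h a \<le> h b" if "0 \<le> a" "a \<le> b" "b < 1" for a b
    unfolding h_def using that r rs[of a] rs[of b]
    by (intro divide_left_mono mult_mono mult_pos_pos) (auto intro: mult_left_mono)
  show ?thesis
  proof (cases "r = 0")
    \<comment> \<open>The antiderivative used for \<open>r > 0\<close> divides by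
      \<open>sqrt r\<close>; for \<open>r = 0\<close> it is \<open>- 2 * sqrt (1 - s)\<close>, and
      the total 2 is below \<open>pi\<close>.\<close>
    case True
    have "(\<Sum>k<N. h (real k / N) / N) \<le> (\<lambda>s. - 2 * sqrt (1 - s)) 1 - (\<lambda>s. - 2 * sqrt (1 - s)) 0"
    proof (rule left_riemann_sum_le[OF _ _ mono N])
      show "continuous_on {0..1} (\<lambda>s. - 2 * sqrt (1 - s :: real))" by (intro continuous_intros)
      show "((\<lambda>s. - 2 * sqrt (1 - s)) has_real_derivative h s) (at s)" if "0 < s" "s < 1" for s
        using that True by (auto intro!: derivative_eq_intros simp: h_def field_simps)
    qed auto
    also have "\<dots> \<le> pi" using pi_ge_two by simp
    finally show ?thesis using True by (simp add: h_def)
  next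
    case False
    hence r0: "0 < r" using r by simp
    \<comment> \<open>Substituting \<open>v = sqrt (1 - s)\<close> turns the integrand into
      \<open>2 / ((1 - r) + r * v^2)\<close>, up to orientation.\<close>
    define F where "F s = - (2 / sqrt (r * (1 - r))) * arctan (sqrt (r / (1 - r)) * sqrt (1 - s))" for s
    have "(\<Sum>k<N. h (real k / N) / N) \<le> F 1 - F 0"
    proof (rule left_riemann_sum_le[OF _ _ mono N])
      show "continuous_on {0..1} F" unfolding F_def by (intro continuous_intros)
      show "(F has_real_derivative h s) (at s)" if s: "0 < s" "s < 1" for s
      proof -
        define c where "c = sqrt (r / (1 - r))"
        have c: "0 < c" "c\<^sup>2 = r / (1 - r)" using r0 r by (auto simp: c_def)
        have rt: "sqrt (r * (1 - r)) = c * (1 - r)"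
        proof -
          have "r * (1 - r) = (c * (1 - r))\<^sup>2" 
            unfolding power_mult_distrib c(2) using r by (simp add: power2_eq_square)
          thus ?thesis using c r by (simp only: real_sqrt_abs) simp
        qed
        have one: "1 + (c * sqrt (1 - s))\<^sup>2 = (1 - r * s) / (1 - r)"
          using s r by (simp add: power_mult_distrib c field_simps)
        have "((\<lambda>s. arctan (c * sqrt (1 - s))) has_real_derivative
            inverse (1 + (c * sqrt (1 - s))\<^sup>2) * (c * (- (inverse (sqrt (1 - s)) / 2)))) (at s)"
          using s by (auto intro!: derivative_eq_intros)
        hence "(F has_real_derivative - (2 / (c * (1 - r))) *
           (inverse (1 + (c * sqrt (1 - s))\<^sup>2) * (c * (- (inverse (sqrt (1 - s)) / 2))))) (at s)"
          unfolding F_def rt c_def[symmetric] by (rule DERIV_cmult)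
        also have "- (2 / (c * (1 - r))) *
           (inverse (1 + (c * sqrt (1 - s))\<^sup>2) * (c * (- (inverse (sqrt (1 - s)) / 2)))) = h s"
        proof -
          have "- (2 / (c * d)) * (inverse (e / d) * (c * (- (inverse v / 2)))) = 1 / (e * v)"
            if "d \<noteq> 0" "e \<noteq> 0" "v \<noteq> 0" for d e v
            using that c(1) by (simp add: field_simps)
          from this[of "1 - r" "1 - r * s" "sqrt (1 - s)"] show ?thesis
            unfolding one h_def using r s rs[of s] by simp
        qed
        finally show ?thesis .
      qed
    qed auto
    also have "F 1 - F 0 = 2 / sqrt (r * (1 - r)) * arctan (sqrt (r / (1 - r)))"
      by (simp add: F_def)
    \<comment> \<open>The factor \<open>sqrt r\<close> compensates
      \<open>1 / sqrt (r * (1 - r))\<close> at small \<open>r\<close>; the plain bound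
      \<open>pi / 2\<close> for the arctangent would not.\<close>
    also have "\<dots> \<le> 2 / sqrt (r * (1 - r)) * (pi / 2 * sqrt r)"
      using r0 r by (intro mult_left_mono arctan_sqrt_le) auto
    also have "\<dots> = pi / sqrt (1 - r)" using r0 by (simp add: real_sqrt_mult)
    finally show ?thesis by (simp add: h_def)
  qed
qed

text \<open>Schur's test. A weighted arithmetic-geometric mean inequality splits each product
  \<open>a j * a k\<close>; by symmetry of the kernel both halves have the same sum, and the row
  bound \<open>pi * w j\<close> cancels the weight.\<close>

lemma hilbert_form_le:
  fixes a :: "nat \<Rightarrow> real"
  assumes N: "0 < N" and a: "\<And>j. 0 \<le> a j"
  shows "(\<Sum>j<N. \<Sum>k<N. a j * a k / (1 - (real j / N) * (real k / N)) / N) \<le> pi * (\<Sum>j<N. (a j)\<^sup>2)"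
proof -
  define r where "r j = real j / real N" for j
  define w where "w j = 1 / sqrt (1 - r j)" for j
  define \<kappa> where "\<kappa> j k = 1 / (1 - r j * r k) / N" for j k
  have r: "0 \<le> r j" "r j < 1" if "j < N" for j using that by (auto simp: r_def)
  have w: "0 < w j" if "j < N" for j using r[OF that] by (simp add: w_def)
  have \<kappa>: "0 \<le> \<kappa> j k" if "j < N" "k < N" for j k
    using mult_left_le[of "r k" "r j"] r[OF that(1)] r[OF that(2)] by (simp add: \<kappa>_def)
  have sym: "\<kappa> j k = \<kappa> k j" for j k by (simp add: \<kappa>_def mult.commute)
  have row: "(\<Sum>k<N. \<kappa> j k * w k) \<le> pi * w j" if "j < N" for j
    using schur_row_sum_le[OF r[OF that] N] by (simp add: \<kappa>_def w_def r_def mult_ac)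
  have pt: "\<kappa> j k * (a j * a k) \<le> \<kappa> j k * ((a j)\<^sup>2 * w k / w j) / 2 + \<kappa> k j * ((a k)\<^sup>2 * w j / w k) / 2"
    if jk: "j < N" "k < N" for j k
  proof -
    have "0 \<le> (a j * w k - a k * w j)\<^sup>2 / (2 * (w j * w k))"
      using w[OF jk(1)] w[OF jk(2)] by simp
    also have "\<dots> = ((a j)\<^sup>2 * w k / w j) / 2 + ((a k)\<^sup>2 * w j / w k) / 2 - a j * a k"
      using w[OF jk(1)] w[OF jk(2)] by (simp add: field_simps power2_eq_square)
    finally have "a j * a k \<le> ((a j)\<^sup>2 * w k / w j) / 2 + ((a k)\<^sup>2 * w j / w k) / 2" by simp
    from mult_left_mono[OF this \<kappa>[OF jk]] show ?thesis
      by (simp add: sym[of k j] distrib_left)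
  qed
  have "(\<Sum>j<N. \<Sum>k<N. \<kappa> j k * (a j * a k))
      \<le> (\<Sum>j<N. \<Sum>k<N. \<kappa> j k * ((a j)\<^sup>2 * w k / w j) / 2 + \<kappa> k j * ((a k)\<^sup>2 * w j / w k) / 2)"
    by (intro sum_mono pt) auto
  also have "\<dots> = (\<Sum>j<N. \<Sum>k<N. \<kappa> j k * ((a j)\<^sup>2 * w k / w j) / 2)
      + (\<Sum>j<N. \<Sum>k<N. \<kappa> k j * ((a k)\<^sup>2 * w j / w k) / 2)"
    by (simp add: sum.distrib)
  also have "(\<Sum>j<N. \<Sum>k<N. \<kappa> k j * ((a k)\<^sup>2 * w j / w k) / 2)
      = (\<Sum>j<N. \<Sum>k<N. \<kappa> j k * ((a j)\<^sup>2 * w k / w j) / 2)"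
    by (rule sum.swap)
  also have "(\<Sum>j<N. \<Sum>k<N. \<kappa> j k * ((a j)\<^sup>2 * w k / w j) / 2) + \<dots>
      = (\<Sum>j<N. (a j)\<^sup>2 / w j * (\<Sum>k<N. \<kappa> j k * w k))"
  proof -
    have "(\<Sum>k<N. \<kappa> j k * ((a j)\<^sup>2 * w k / w j) / 2) = ((a j)\<^sup>2 / w j * (\<Sum>k<N. \<kappa> j k * w k)) / 2" for j
      unfolding sum_distrib_left sum_divide_distrib by (intro sum.cong refl) (simp add: mult_ac)
    thus ?thesis by (simp only: sum.distrib[symmetric] field_sum_of_halves)
  qed
  also have "\<dots> \<le> (\<Sum>j<N. (a j)\<^sup>2 / w j * (pi * w j))"
    using w by (intro sum_mono mult_left_mono row) (auto intro!: divide_nonneg_pos)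
  also have "\<dots> = (\<Sum>j<N. pi * (a j)\<^sup>2)"
    using w by (intro sum.cong) (auto simp: less_imp_neq[symmetric])
  finally show ?thesis by (simp add: \<kappa>_def r_def sum_distrib_left mult.commute)
qed

text \<open>
  By duality: \<open>V\<close> is the adjoint of the evaluation map \<open>G \<mapsto> (j \<mapsto> (P[G]) (z j))\<close> applied to \<open>a\<close>, and
  the semigroup identity reduces its square integral to the Hilbert form, whatever the arguments
  of the points \<open>z j\<close> are.
\<close>

lemma discrete_radial_bound:
  fixes G :: "real \<Rightarrow> real"
  assumes N: "0 < N" and z: "\<And>j. j < N \<Longrightarrow> cmod (z j) = real j / N"
    and [measurable]: "G \<in> borel_measurable borel" and G: "\<And>t. 0 \<le> G t"
    and G2: "integrable circle (\<lambda>t. (G t)\<^sup>2)"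
    and a: "\<And>j. 0 \<le> a j" "\<And>j. j < N \<Longrightarrow> a j \<le> (\<integral>t. poisson (z j * cis (- t)) * G t \<partial>circle)"
  shows "(\<Sum>j<N. (a j)\<^sup>2 / N) \<le> 2 * pi * (\<integral>t. (G t)\<^sup>2 \<partial>circle)"
proof -
  have z1: "cmod (z j) < 1" if "j < N" for j using z[OF that] that by simp
  define P where "P j t = poisson (z j * cis (- t))" for j t
  define S where "S = (\<Sum>j<N. (a j)\<^sup>2 / N)"
  define V where "V t = (\<Sum>j<N. a j / N * P j t)" for t
  have [measurable]: "P j \<in> borel_measurable borel" for j unfolding P_def[abs_def] by measurable
  have iPG: "integrable circle (\<lambda>t. P j t * G t)" if "j < N" for j
    unfolding P_def using G2 G z1[OF that]
    by (intro poisson_jensen(1)[where q = 2]) (auto simp: powr_numeral)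
  have Pb: "\<bar>P j t\<bar> \<le> 2 / (1 - cmod (z j))" if "j < N" for j t
    unfolding P_def by (rule poisson_kernel_bound[OF z1[OF that]])
  have iPP: "integrable circle (\<lambda>t. P j t * P k t)" if "j < N" "k < N" for j k
  proof (rule integrable_circle_bounded)
    show "norm (P j t * P k t) \<le> 2 / (1 - cmod (z j)) * (2 / (1 - cmod (z k)))" for t
      unfolding real_norm_def abs_mult using z1 that
      by (intro mult_mono Pb) (auto intro: less_imp_le)
  qed measurable
  have VV: "(V t)\<^sup>2 = (\<Sum>j<N. \<Sum>k<N. (a j / N * (a k / N)) * (P j t * P k t))" for t
    unfolding V_def power2_eq_square sum_product by (simp add: mult_ac)
  have iVV: "integrable circle (\<lambda>t. (V t)\<^sup>2)"
    unfolding VV by (intro Bochner_Integration.integrable_sum integrable_mult_right iPP) auto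
  have GV: "G t * V t = (\<Sum>j<N. a j / N * (P j t * G t))" for t
    by (simp add: V_def sum_distrib_left mult_ac)
  have iGV: "integrable circle (\<lambda>t. G t * V t)"
    unfolding GV by (intro Bochner_Integration.integrable_sum integrable_mult_right iPG) auto
  have "S \<le> (\<Sum>j<N. a j / N * (\<integral>t. P j t * G t \<partial>circle))"
    unfolding S_def
  proof (rule sum_mono)
    fix j assume "j \<in> {..<N}"
    hence "a j / N * a j \<le> a j / N * (\<integral>t. P j t * G t \<partial>circle)"
      unfolding P_def by (intro mult_left_mono a) (auto simp: a(1))
    thus "(a j)\<^sup>2 / N \<le> a j / N * (\<integral>t. P j t * G t \<partial>circle)" by (simp add: power2_eq_square)
  qed
  also have "\<dots> = (\<integral>t. G t * V t \<partial>circle)"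
    unfolding GV using iPG by (subst Bochner_Integration.integral_sum) auto
  \<comment> \<open>The weight \<open>2 * pi\<close> is chosen so that the Hilbert inequality
    returns \<open>1 / (4 * pi) * (2 * pi * S) = S / 2\<close> for the second term, which is
    absorbed on the left with no loss in the constant.\<close>
  also have "\<dots> \<le> (\<integral>t. pi * (G t)\<^sup>2 + 1 / (4 * pi) * (V t)\<^sup>2 \<partial>circle)"
  proof (intro integral_mono iGV Bochner_Integration.integrable_add integrable_mult_right G2 iVV)
    fix t
    have "0 \<le> (2 * pi * G t - V t)\<^sup>2 / (4 * pi)" by simp
    also have "\<dots> = pi * (G t)\<^sup>2 + 1 / (4 * pi) * (V t)\<^sup>2 - G t * V t"
      by (simp add: power2_diff power_mult_distrib add_divide_distrib diff_divide_distrib) (simp add: power2_eq_square)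
    finally show "G t * V t \<le> pi * (G t)\<^sup>2 + 1 / (4 * pi) * (V t)\<^sup>2" by simp
  qed
  also have "\<dots> = pi * (\<integral>t. (G t)\<^sup>2 \<partial>circle) + 1 / (4 * pi) * (\<integral>t. (V t)\<^sup>2 \<partial>circle)"
    using G2 iVV by (subst Bochner_Integration.integral_add) auto
  also have "(\<integral>t. (V t)\<^sup>2 \<partial>circle) = (\<Sum>j<N. \<Sum>k<N. (a j / N * (a k / N)) * poisson (z j * cnj (z k)))"
  proof -
    have "(\<integral>t. (V t)\<^sup>2 \<partial>circle) = (\<Sum>j<N. \<Sum>k<N. \<integral>t. (a j / N * (a k / N)) * (P j t * P k t) \<partial>circle)"
      unfolding VV using iPP
      by (subst Bochner_Integration.integral_sum, force, intro sum.cong refl)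
         (subst Bochner_Integration.integral_sum, auto)
    also have "\<dots> = (\<Sum>j<N. \<Sum>k<N. (a j / N * (a k / N)) * poisson (z j * cnj (z k)))"
      using poisson_semigroup[OF z1 z1] by (intro sum.cong refl) (simp add: P_def)
    finally show ?thesis .
  qed
  also have "\<dots> \<le> (\<Sum>j<N. \<Sum>k<N. 2 / N * (a j * a k / (1 - (real j / N) * (real k / N)) / N))"
  proof (intro sum_mono)
    fix j k assume jk: "j \<in> {..<N}" "k \<in> {..<N}"
    hence n: "cmod (z j * cnj (z k)) = (real j / N) * (real k / N)" using z by (simp add: norm_mult)
    have "(real j / N) * (real k / N) < 1"
      using jk mult_strict_mono'[of "real j / N" 1 "real k / N" 1] by simp
    hence "poisson (z j * cnj (z k)) \<le> 2 / (1 - (real j / N) * (real k / N))"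
      using poisson_le[of "z j * cnj (z k)"] unfolding n by simp
    hence "(a j / N * (a k / N)) * poisson (z j * cnj (z k))
        \<le> (a j / N * (a k / N)) * (2 / (1 - (real j / N) * (real k / N)))"
      by (intro mult_left_mono) (auto simp: a(1))
    thus "(a j / N * (a k / N)) * poisson (z j * cnj (z k))
        \<le> 2 / N * (a j * a k / (1 - (real j / N) * (real k / N)) / N)" by (simp add: mult_ac)
  qed
  also have "\<dots> = 2 / N * (\<Sum>j<N. \<Sum>k<N. a j * a k / (1 - (real j / N) * (real k / N)) / N)"
    by (simp only: sum_distrib_left)
  also have "\<dots> \<le> 2 / N * (pi * (\<Sum>j<N. (a j)\<^sup>2))"
    by (intro mult_left_mono hilbert_form_le N a(1)) auto
  also have "\<dots> = 2 * pi * S" by (simp add: S_def flip: sum_divide_distrib)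
  finally have "S \<le> pi * (\<integral>t. (G t)\<^sup>2 \<partial>circle) + 1 / (4 * pi) * (2 * pi * S)"
    by (simp add: divide_right_mono)
  thus ?thesis by (simp add: S_def[symmetric])
qed

subsection \<open>Radial limits in the square mean\<close>

text \<open>On the diagonal this is the square of the quadratic mean of \<open>f\<close> on a
  circle; off it, the real inner product of the values of \<open>f\<close> on two circles.\<close>

definition circle_inner :: "(complex \<Rightarrow> complex) \<Rightarrow> real \<Rightarrow> real \<Rightarrow> real" where
  "circle_inner f r s = (\<integral>t. f (of_real r * cis t) \<bullet> f (of_real s * cis t) \<partial>circle)"

text \<open>Serves twice: the grid points are rational radii approaching \<open>r\<close>, and they
  are the left endpoints of the cells containing \<open>r\<close> in the radial Riemann
  sums.\<close>

lemma floor_grid_tendsto: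
  fixes r :: real
  shows "(\<lambda>n. of_int \<lfloor>real (Suc n) * r\<rfloor> / real (Suc n)) \<longlonglongrightarrow> r"
proof (rule real_tendsto_sandwich)
  have b: "r - 1 / real (Suc n) \<le> of_int \<lfloor>real (Suc n) * r\<rfloor> / real (Suc n)"
    "of_int \<lfloor>real (Suc n) * r\<rfloor> / real (Suc n) \<le> r" for n
  proof -
    have "real (Suc n) * r - 1 \<le> of_int \<lfloor>real (Suc n) * r\<rfloor>" by linarith
    hence "(real (Suc n) * r - 1) / real (Suc n) \<le> of_int \<lfloor>real (Suc n) * r\<rfloor> / real (Suc n)"
      by (rule divide_right_mono) simp
    thus "r - 1 / real (Suc n) \<le> of_int \<lfloor>real (Suc n) * r\<rfloor> / real (Suc n)"
      by (simp add: diff_divide_distrib del: of_nat_Suc)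
    have "of_int \<lfloor>real (Suc n) * r\<rfloor> \<le> real (Suc n) * r" by (rule of_int_floor_le)
    hence "of_int \<lfloor>real (Suc n) * r\<rfloor> / real (Suc n) \<le> real (Suc n) * r / real (Suc n)"
      by (rule divide_right_mono) simp
    thus "of_int \<lfloor>real (Suc n) * r\<rfloor> / real (Suc n) \<le> r" by (simp del: of_nat_Suc)
  qed
  show "\<forall>\<^sub>F n in sequentially. r - 1 / real (Suc n) \<le> of_int \<lfloor>real (Suc n) * r\<rfloor> / real (Suc n)"
    "\<forall>\<^sub>F n in sequentially. of_int \<lfloor>real (Suc n) * r\<rfloor> / real (Suc n) \<le> r" using b by simp_all
  have "(\<lambda>n. r - 1 / real (Suc n)) \<longlonglongrightarrow> r - 0"
    by (intro tendsto_diff tendsto_const LIMSEQ_Suc[OF lim_1_over_n])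
  thus "(\<lambda>n. r - 1 / real (Suc n)) \<longlonglongrightarrow> r" by simp
qed simp

lemma tendsto_at_left_Cauchy:
  fixes g :: "real \<Rightarrow> 'a :: complete_space"
  assumes "\<And>e. 0 < e \<Longrightarrow> \<exists>d<a. \<forall>r s. d < r \<longrightarrow> r < a \<longrightarrow> d < s \<longrightarrow> s < a \<longrightarrow> dist (g r) (g s) < e"
  obtains l where "(g \<longlongrightarrow> l) (at_left a)"
proof -
  define x where "x n = a - 1 / real (Suc n)" for n
  have xa: "x n < a" for n by (simp add: x_def)
  have "(\<lambda>n. a - 1 / real (Suc n)) \<longlonglongrightarrow> a - 0"
    by (intro tendsto_diff tendsto_const LIMSEQ_Suc[OF lim_1_over_n])
  hence xlim: "x \<longlonglongrightarrow> a" by (simp add: x_def[abs_def])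
  have ev: "\<exists>M. \<forall>n\<ge>M. d < x n" if "d < a" for d
    using order_tendstoD(1)[OF xlim that] by (simp add: eventually_sequentially)
  have "Cauchy (\<lambda>n. g (x n))"
  proof (rule metric_CauchyI)
    fix e :: real assume "0 < e"
    from assms[OF this] obtain d where d: "d < a"
      "\<And>r s. d < r \<Longrightarrow> r < a \<Longrightarrow> d < s \<Longrightarrow> s < a \<Longrightarrow> dist (g r) (g s) < e" by blast
    from ev[OF d(1)] obtain M where "\<And>n. n \<ge> M \<Longrightarrow> d < x n" by blast
    thus "\<exists>M. \<forall>m\<ge>M. \<forall>n\<ge>M. dist (g (x m)) (g (x n)) < e" using d(2) xa by blast
  qed
  then obtain l where l: "(\<lambda>n. g (x n)) \<longlonglongrightarrow> l" using Cauchy_convergent convergentD by blast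
  have "(g \<longlongrightarrow> l) (at_left a)"
  proof (rule tendstoI)
    fix e :: real assume "0 < e"
    hence e2: "0 < e / 2" by simp
    from assms[OF this] obtain d where d: "d < a"
      "\<And>r s. d < r \<Longrightarrow> r < a \<Longrightarrow> d < s \<Longrightarrow> s < a \<Longrightarrow> dist (g r) (g s) < e / 2" by blast
    from ev[OF d(1)] obtain M where M: "\<And>n. n \<ge> M \<Longrightarrow> d < x n" by blast
    from metric_LIMSEQ_D[OF l e2] obtain M' where M': "\<And>n. n \<ge> M' \<Longrightarrow> dist (g (x n)) l < e / 2" by blast
    define n where "n = max M M'"
    have "dist (g r) l < e" if "d < r" "r < a" for r
    proof -
      have "dist (g r) (g (x n)) < e / 2" using that M[of n] xa by (intro d(2)) (auto simp: n_def)
      moreover have "dist (g (x n)) l < e / 2" by (rule M') (simp add: n_def)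
      ultimately show ?thesis using dist_triangle[of "g r" l "g (x n)"] by linarith
    qed
    thus "\<forall>\<^sub>F r in at_left a. dist (g r) l < e"
      using d(1) unfolding eventually_at_left_field by blast
  qed
  thus thesis by (rule that)
qed

text \<open>The chosen \<open>k\<close> linearizes the maximal function over finitely many radii.\<close>

lemma measurable_argmax:
  fixes v :: "real \<Rightarrow> real \<Rightarrow> real" and e :: "nat \<Rightarrow> real"
  assumes "\<And>i. v (e i) \<in> borel_measurable borel"
  obtains k where "k \<in> borel_measurable borel" "\<And>\<theta>. k \<theta> \<in> e ` {..n}"
    "\<And>\<theta> i. i \<le> n \<Longrightarrow> v (e i) \<theta> \<le> v (k \<theta>) \<theta>"
proof -
  \<comment> \<open>Measurability of \<open>v (k \<theta>) \<theta>\<close> in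
    \<open>\<theta>\<close> is carried along: the next selection compares with it, and it does not
    follow from measurability of \<open>k\<close> alone.\<close>
  have "\<exists>k. k \<in> borel_measurable borel \<and> (\<lambda>\<theta>. v (k \<theta>) \<theta>) \<in> borel_measurable borel \<and>
      (\<forall>\<theta>. k \<theta> \<in> e ` {..n} \<and> (\<forall>i\<le>n. v (e i) \<theta> \<le> v (k \<theta>) \<theta>))"
  proof (induction n)
    case 0
    show ?case using assms[of 0] by (intro exI[of _ "\<lambda>_. e 0"]) auto
  next
    case (Suc n)
    then obtain k where k [measurable]: "k \<in> borel_measurable borel" "(\<lambda>\<theta>. v (k \<theta>) \<theta>) \<in> borel_measurable borel"
      and k': "\<And>\<theta>. k \<theta> \<in> e ` {..n}" "\<And>\<theta> i. i \<le> n \<Longrightarrow> v (e i) \<theta> \<le> v (k \<theta>) \<theta>" by blast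
    note assms [measurable]
    define k2 where "k2 \<theta> = (if v (k \<theta>) \<theta> \<le> v (e (Suc n)) \<theta> then e (Suc n) else k \<theta>)" for \<theta>
    have "k2 \<in> borel_measurable borel" unfolding k2_def[abs_def] by measurable
    moreover have "(\<lambda>\<theta>. v (k2 \<theta>) \<theta>) \<in> borel_measurable borel"
    proof -
      have "(\<lambda>\<theta>. v (k2 \<theta>) \<theta>) = (\<lambda>\<theta>. max (v (k \<theta>) \<theta>) (v (e (Suc n)) \<theta>))"
        by (auto simp: k2_def max_def)
      thus ?thesis by simp
    qed
    moreover have "k2 \<theta> \<in> e ` {..Suc n}" for \<theta>
      using k'(1)[of \<theta>] by (auto simp: k2_def)
    moreover have "v (e i) \<theta> \<le> v (k2 \<theta>) \<theta>" if "i \<le> Suc n" for i \<theta>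
      using that k'(2)[of i \<theta>] by (cases "i = Suc n") (auto simp: k2_def)
    ultimately show ?case by blast
  qed
  thus thesis using that by blast
qed

section \<open>Quadratic means of a harmonic function on concentric circles\<close>

context
  fixes f :: "complex \<Rightarrow> complex"
  assumes f: "harmonic_on f (ball 0 1)"
begin

lemma continuous_on_harmonic: "continuous_on (ball 0 1) f"
proof -
  obtain g h where gh: "g holomorphic_on ball 0 1" "h holomorphic_on ball 0 1"
    "\<And>z. z \<in> ball 0 1 \<Longrightarrow> f z = g z + cnj (h z)"
    using harmonic_on_ball_decomp[OF f] by blast
  have "continuous_on (ball 0 1) (\<lambda>z. g z + cnj (h z))"
    using gh(1,2) by (intro continuous_intros holomorphic_on_imp_continuous_on)
  thus ?thesis using gh(3) continuous_on_cong by (metis (no_types, lifting))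
qed

private lemma in_disc: "0 \<le> r \<Longrightarrow> r < 1 \<Longrightarrow> of_real r * cis t \<in> ball 0 1"
  by (simp add: norm_mult)

private lemma norm_pt: "0 \<le> c \<Longrightarrow> c < 1 \<Longrightarrow> cmod (of_real c * cis t) < 1"
  by (simp add: norm_mult)

lemma continuous_on_harmonic_circle: "0 \<le> r \<Longrightarrow> r < 1 \<Longrightarrow> continuous_on UNIV (\<lambda>t. f (of_real r * cis t))"
  by (intro continuous_on_compose2[OF continuous_on_harmonic] continuous_intros) (auto simp: norm_mult)

private lemma circ_measurable [measurable]:
  "0 \<le> r \<Longrightarrow> r < 1 \<Longrightarrow> (\<lambda>t. f (of_real r * cis t)) \<in> borel_measurable borel"
  by (intro borel_measurable_continuous_onI continuous_on_harmonic_circle)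

private lemma circ_bounded:
  assumes "0 \<le> r" "r < 1"
  obtains B where "\<And>t. cmod (f (of_real r * cis t)) \<le> B"
proof -
  have "continuous_on (cball 0 r) f"
    by (rule continuous_on_subset[OF continuous_on_harmonic]) (use assms in auto)
  hence "bounded (f ` cball 0 r)" by (intro compact_imp_bounded compact_continuous_image compact_cball)
  then obtain B where "\<forall>z\<in>cball 0 r. cmod (f z) \<le> B" by (auto simp: bounded_iff)
  thus thesis using assms by (intro that[of B]) (simp add: norm_mult)
qed

lemma integrable_harmonic_inner:
  assumes "0 \<le> r" "r < 1" "0 \<le> s" "s < 1"
  shows "integrable circle (\<lambda>t. f (of_real r * cis t) \<bullet> f (of_real s * cis t))"
proof -
  obtain B where B: "\<And>t. cmod (f (of_real r * cis t)) \<le> B" using circ_bounded assms by blast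
  obtain B' where B': "\<And>t. cmod (f (of_real s * cis t)) \<le> B'" using circ_bounded assms by blast
  note [measurable] = circ_measurable[OF assms(1,2)] circ_measurable[OF assms(3,4)]
  show ?thesis
  proof (rule integrable_circle_bounded)
    show "norm (f (of_real r * cis t) \<bullet> f (of_real s * cis t)) \<le> B * B'" for t
    proof -
      have "norm (f (of_real r * cis t) \<bullet> f (of_real s * cis t))
          \<le> cmod (f (of_real r * cis t)) * cmod (f (of_real s * cis t))"
        using Cauchy_Schwarz_ineq2 by simp
      also have "\<dots> \<le> B * B'" using B B' order.trans[OF norm_ge_zero B] by (intro mult_mono) auto
      finally show ?thesis .
    qed
  qed measurable
qed

private lemma poisson_swap:
  "poisson (of_real c * cis \<theta> * cis (- t)) = poisson (of_real c * cis t * cis (- \<theta>))"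
  using poisson_cnj[of "of_real c * cis \<theta> * cis (- t)"] by (simp add: cis_cnj mult_ac)

private lemma poisson_formula_scaled:
  assumes "0 \<le> r" "r < q" "q < 1"
  shows "f (of_real r * cis \<theta>) =
    (\<integral>t. poisson (of_real (r / q) * cis \<theta> * cis (- t)) *\<^sub>R f (of_real q * cis t) \<partial>circle)"
proof -
  have "cmod (of_real (r / q) * cis \<theta>) < 1" using assms by (intro norm_pt) auto
  from poisson_formula[OF f _ assms(3) this] assms show ?thesis by simp
qed

text \<open>Write \<open>f\<close> on radius \<open>r\<close> as the Poisson integral, with kernel
  radius \<open>r / q\<close>, of \<open>f\<close> on radius \<open>q\<close>. This operator is
  symmetric; moved to the other factor it shrinks the radius \<open>s\<close> by the same
  ratio.\<close>

private lemma circle_inner_shift: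
  assumes r: "0 \<le> r" "r < q" and q: "q < 1" and s: "0 \<le> s" "s < 1"
  shows "circle_inner f r s = circle_inner f q (s * (r / q))"
proof -
  have q0: "0 < q" using r by simp
  define c where "c = r / q"
  have c: "0 \<le> c" "c < 1" using r q0 by (auto simp: c_def)
  have lt: "cmod (of_real c * cis \<theta>) < 1" for \<theta> using c by (simp add: norm_mult)
  obtain B where B: "\<And>t. cmod (f (of_real q * cis t)) \<le> B" using circ_bounded[of q] q q0 by auto
  obtain B' where B': "\<And>t. cmod (f (of_real s * cis t)) \<le> B'" using circ_bounded s by blast
  have [measurable]: "(\<lambda>t. f (of_real q * cis t)) \<in> borel_measurable borel"
    "(\<lambda>t. f (of_real s * cis t)) \<in> borel_measurable borel"
    using circ_measurable q q0 s by auto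
  let ?P = "\<lambda>\<theta> t. poisson (of_real c * cis \<theta> * cis (- t))"
  have iq: "integrable circle (\<lambda>t. ?P \<theta> t *\<^sub>R f (of_real q * cis t))" for \<theta>
    by (rule integrable_poisson_bounded[OF lt _ B]) measurable
  have ints: "integrable circle (\<lambda>\<theta>. ?P \<theta> t *\<^sub>R f (of_real s * cis \<theta>))" for t
    unfolding poisson_swap[of c _ t] by (rule integrable_poisson_bounded[OF lt _ B']) measurable
  have "circle_inner f r s = (\<integral>\<theta>. \<integral>t. (?P \<theta> t *\<^sub>R f (of_real q * cis t)) \<bullet> f (of_real s * cis \<theta>) \<partial>circle \<partial>circle)"
    unfolding circle_inner_def poisson_formula_scaled[OF r q] c_def[symmetric]
    using iq by (simp only: integral_inner_left)
  also have "\<dots> = (\<integral>t. \<integral>\<theta>. (?P \<theta> t *\<^sub>R f (of_real q * cis t)) \<bullet> f (of_real s * cis \<theta>) \<partial>circle \<partial>circle)"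
  proof (rule circle_Fubini)
    show "norm ((?P \<theta> t *\<^sub>R f (of_real q * cis t)) \<bullet> f (of_real s * cis \<theta>)) \<le> 2 / (1 - c) * B * B'" for \<theta> t
    proof -
      have "norm ((?P \<theta> t *\<^sub>R f (of_real q * cis t)) \<bullet> f (of_real s * cis \<theta>))
          \<le> norm (?P \<theta> t *\<^sub>R f (of_real q * cis t)) * norm (f (of_real s * cis \<theta>))"
        unfolding real_norm_def by (rule Cauchy_Schwarz_ineq2)
      also have "\<dots> = \<bar>?P \<theta> t\<bar> * norm (f (of_real q * cis t)) * norm (f (of_real s * cis \<theta>))" by simp
      also have "\<dots> \<le> 2 / (1 - c) * B * B'"
        using poisson_kernel_bound[OF lt, of \<theta> t] B[of t] B'[of \<theta>] c
          order.trans[OF norm_ge_zero B] by (intro mult_mono mult_nonneg_nonneg) (auto simp: norm_mult)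
      finally show ?thesis .
    qed
  qed measurable
  also have "\<dots> = (\<integral>t. f (of_real q * cis t) \<bullet> (\<integral>\<theta>. ?P \<theta> t *\<^sub>R f (of_real s * cis \<theta>) \<partial>circle) \<partial>circle)"
    using ints by (simp flip: integral_inner_right)
  also have "\<dots> = (\<integral>t. f (of_real q * cis t) \<bullet> f (of_real (s * c) * cis t) \<partial>circle)"
    using poisson_formula[OF f s lt] by (simp only: poisson_swap[of c _ t for t]) (simp add: mult.assoc)
  finally show ?thesis by (simp add: circle_inner_def c_def)
qed

text \<open>
  \<open>circle_inner f r s\<close> depends only on \<open>r * s\<close>; this replaces Parseval's identity for the Fourier series.
\<close>

private lemma circle_inner_eq:
  assumes "0 < r" "r < s" "s < 1"
  shows "circle_inner f r s = circle_inner f (sqrt (r * s)) (sqrt (r * s))"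
proof -
  \<comment> \<open>The geometric mean is the radius at which the shift leaves two equal circles:
    \<open>s * (r / q) = q\<close>.\<close>
  let ?q = "sqrt (r * s)"
  have q: "r < ?q" "?q < s" using assms by (auto intro!: real_less_rsqrt real_less_lsqrt simp: power2_eq_square)
  have "s * (r / ?q) = r * s / ?q" by (simp add: mult.commute)
  also have "\<dots> = ?q" using assms by (intro real_div_sqrt) simp
  finally have "s * (r / ?q) = ?q" .
  thus ?thesis using circle_inner_shift[of r ?q s] q assms by (simp only:)
qed

private lemma norm_sq_le:
  assumes "0 \<le> r" "r < s" "s < 1"
  shows "(cmod (f (of_real r * cis \<theta>)))\<^sup>2 \<le>
    (\<integral>t. poisson (of_real (r / s) * cis \<theta> * cis (- t)) * (cmod (f (of_real s * cis t)))\<^sup>2 \<partial>circle)"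
proof -
  let ?P = "\<lambda>t. poisson (of_real (r / s) * cis \<theta> * cis (- t))"
  have lt: "cmod (of_real (r / s) * cis \<theta>) < 1" using assms by (intro norm_pt) auto
  have nn: "0 \<le> ?P t" for t by (rule poisson_kernel_nonneg[OF lt])
  have [measurable]: "(\<lambda>t. f (of_real s * cis t)) \<in> borel_measurable borel"
    using circ_measurable assms by auto
  have i2: "integrable circle (\<lambda>t. cmod (f (of_real s * cis t)) powr 2)"
    using integrable_harmonic_inner[of s s] assms by (simp add: powr_numeral power2_norm_eq_inner)
  note J = poisson_jensen[OF lt, of 2 "\<lambda>t. cmod (f (of_real s * cis t))", OF _ _ _ i2]
  have "cmod (f (of_real r * cis \<theta>)) \<le> (\<integral>t. norm (?P t *\<^sub>R f (of_real s * cis t)) \<partial>circle)"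
    unfolding poisson_formula_scaled[OF assms] by (rule integral_norm_bound)
  also have "\<dots> = (\<integral>t. ?P t * cmod (f (of_real s * cis t)) \<partial>circle)" using nn by simp
  finally have "(cmod (f (of_real r * cis \<theta>)))\<^sup>2 \<le> (\<integral>t. ?P t * cmod (f (of_real s * cis t)) \<partial>circle)\<^sup>2"
    by (intro power_mono) auto
  also have "\<dots> \<le> (\<integral>t. ?P t * (cmod (f (of_real s * cis t)))\<^sup>2 \<partial>circle)"
  proof -
    have "0 \<le> (\<integral>t. ?P t * cmod (f (of_real s * cis t)) \<partial>circle)"
      using nn by (intro integral_nonneg_AE) auto
    thus ?thesis using J(3) by (simp add: powr_numeral)
  qed
  finally show ?thesis .
qed

text \<open>Integrate \<open>norm_sq_le\<close> over \<open>\<theta>\<close>; by symmetry the kernel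
  also has mass 1 in that variable.\<close>

private lemma circle_inner_mono:
  assumes "0 \<le> r" "r < s" "s < 1"
  shows "circle_inner f r r \<le> circle_inner f s s"
proof -
  define c where "c = r / s"
  have c: "0 \<le> c" "c < 1" using assms by (auto simp: c_def)
  have lt: "cmod (of_real c * cis \<theta>) < 1" for \<theta> using c by (simp add: norm_mult)
  let ?P = "\<lambda>\<theta> t. poisson (of_real c * cis \<theta> * cis (- t))"
  have [measurable]: "(\<lambda>t. f (of_real s * cis t)) \<in> borel_measurable borel"
    using circ_measurable assms by auto
  obtain B where B: "\<And>t. cmod (f (of_real s * cis t)) \<le> B" using circ_bounded[of s] assms by auto
  have bd: "norm (?P \<theta> t * (cmod (f (of_real s * cis t)))\<^sup>2) \<le> 2 / (1 - c) * B\<^sup>2" for \<theta> t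
    unfolding real_norm_def abs_mult using poisson_kernel_bound[OF lt, of \<theta> t] c B[of t]
    by (intro mult_mono) (auto simp: norm_mult power_mono)
  have "circle_inner f r r \<le> (\<integral>\<theta>. \<integral>t. ?P \<theta> t * (cmod (f (of_real s * cis t)))\<^sup>2 \<partial>circle \<partial>circle)"
    unfolding circle_inner_def
  proof (rule integral_mono)
    show "integrable circle (\<lambda>\<theta>. \<integral>t. ?P \<theta> t * (cmod (f (of_real s * cis t)))\<^sup>2 \<partial>circle)"
    proof (rule integrable_circle_bounded)
      show "norm (\<integral>t. ?P \<theta> t * (cmod (f (of_real s * cis t)))\<^sup>2 \<partial>circle) \<le> 2 / (1 - c) * B\<^sup>2" for \<theta>
        by (rule norm_integral_circle_le[OF _ bd]) measurable
    qed measurable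
    show "f (of_real r * cis \<theta>) \<bullet> f (of_real r * cis \<theta>)
        \<le> (\<integral>t. ?P \<theta> t * (cmod (f (of_real s * cis t)))\<^sup>2 \<partial>circle)" for \<theta>
      unfolding power2_norm_eq_inner[of "f (of_real r * cis \<theta>)", symmetric] c_def
      by (rule norm_sq_le[OF assms])
    show "integrable circle (\<lambda>\<theta>. f (of_real r * cis \<theta>) \<bullet> f (of_real r * cis \<theta>))"
      using assms by (intro integrable_harmonic_inner) auto
  qed
  also have "\<dots> = (\<integral>t. \<integral>\<theta>. ?P \<theta> t * (cmod (f (of_real s * cis t)))\<^sup>2 \<partial>circle \<partial>circle)"
    by (rule circle_Fubini[OF _ bd]) measurable
  also have "\<dots> = (\<integral>t. (cmod (f (of_real s * cis t)))\<^sup>2 \<partial>circle)"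
  proof -
    have "(\<integral>\<theta>. ?P \<theta> t \<partial>circle) = 1" for t
      by (subst Bochner_Integration.integral_cong[OF refl poisson_swap]) (rule integral_poisson[OF lt])
    thus ?thesis by simp
  qed
  finally show ?thesis by (simp add: circle_inner_def power2_norm_eq_inner)
qed

text \<open>Expand the square: the cross term is the mean at radius \<open>sqrt (r * s)\<close>,
  which is at least the mean at \<open>r\<close>. Bounded means thus make the circles of
  \<open>f\<close> Cauchy in the square mean.\<close>

private lemma circle_diff_le:
  assumes "0 < r" "r < s" "s < 1"
  shows "integrable circle (\<lambda>t. (cmod (f (of_real s * cis t) - f (of_real r * cis t)))\<^sup>2)"
    "(\<integral>t. (cmod (f (of_real s * cis t) - f (of_real r * cis t)))\<^sup>2 \<partial>circle)
      \<le> circle_inner f s s - circle_inner f r r"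
proof -
  have e: "(cmod (f (of_real s * cis t) - f (of_real r * cis t)))\<^sup>2 =
      f (of_real s * cis t) \<bullet> f (of_real s * cis t) + f (of_real r * cis t) \<bullet> f (of_real r * cis t)
      - 2 * (f (of_real r * cis t) \<bullet> f (of_real s * cis t))" for t
    by (simp add: power2_norm_eq_inner inner_diff inner_commute algebra_simps)
  have i: "integrable circle (\<lambda>t. f (of_real s * cis t) \<bullet> f (of_real s * cis t))"
    "integrable circle (\<lambda>t. f (of_real r * cis t) \<bullet> f (of_real r * cis t))"
    "integrable circle (\<lambda>t. f (of_real r * cis t) \<bullet> f (of_real s * cis t))"
    using assms by (auto intro!: integrable_harmonic_inner)
  show "integrable circle (\<lambda>t. (cmod (f (of_real s * cis t) - f (of_real r * cis t)))\<^sup>2)"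
    unfolding e using i by auto
  have "(\<integral>t. (cmod (f (of_real s * cis t) - f (of_real r * cis t)))\<^sup>2 \<partial>circle)
      = circle_inner f s s + circle_inner f r r - 2 * circle_inner f r s"
    unfolding e circle_inner_def using i by simp
  also have "circle_inner f r s = circle_inner f (sqrt (r * s)) (sqrt (r * s))"
    by (rule circle_inner_eq[OF assms])
  also have "circle_inner f s s + circle_inner f r r - 2 * \<dots> \<le> circle_inner f s s - circle_inner f r r"
  proof -
    have "r < sqrt (r * s)" "sqrt (r * s) < s"
      using assms by (auto intro!: real_less_rsqrt real_less_lsqrt simp: power2_eq_square)
    hence "circle_inner f r r \<le> circle_inner f (sqrt (r * s)) (sqrt (r * s))"
      using assms by (intro circle_inner_mono) linarith+
    thus ?thesis by simp
  qed
  finally show "(\<integral>t. (cmod (f (of_real s * cis t) - f (of_real r * cis t)))\<^sup>2 \<partial>circle)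
      \<le> circle_inner f s s - circle_inner f r r" .
qed

text \<open>The difference of \<open>f\<close> and its dilation at radius \<open>k \<theta>\<close>
  is the Poisson integral, at radius \<open>k \<theta> / \<sigma>\<close>, of the same difference on
  the circle of radius \<open>\<sigma>\<close>. The maximal inequality and
  \<open>circle_diff_le\<close> leave only a gap between means.\<close>

private lemma maximal_along:
  assumes \<rho>: "0 < \<rho>" "\<rho> < 1" and [measurable]: "k \<in> borel_measurable borel"
    and k: "\<And>\<theta>. 0 \<le> k \<theta>" "\<And>\<theta>. k \<theta> \<le> R" and R: "R < 1"
    and L: "\<And>r. 0 < r \<Longrightarrow> r < 1 \<Longrightarrow> circle_inner f r r \<le> L"
  shows "(\<integral>\<^sup>+\<theta>. ennreal ((cmod (f (of_real (k \<theta>) * cis \<theta>) - f (of_real (\<rho> * k \<theta>) * cis \<theta>)))\<^sup>2) \<partial>circle)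
    \<le> ennreal (256 * (L - circle_inner f (\<rho>\<^sup>2) (\<rho>\<^sup>2)))"
proof -
  have R0: "0 \<le> R" using k[of 0] by linarith
  \<comment> \<open>Above \<open>R\<close>, so that \<open>k \<theta> / \<sigma>\<close> stays away
    from 1; at least \<open>\<rho>\<close>, so that
    \<open>\<rho>\<^sup>2 <= \<rho> * \<sigma>\<close> and the final bound no longer depends on
    \<open>R\<close>.\<close>
  define \<sigma> where "\<sigma> = max \<rho> ((1 + R) / 2)"
  have \<sigma>: "\<rho> \<le> \<sigma>" "R < \<sigma>" "\<sigma> < 1" "0 < \<sigma>" using R \<rho> by (auto simp: \<sigma>_def max_def)
  have "\<rho> * \<sigma> < \<sigma>" using \<rho> \<sigma> mult_strict_right_mono[of \<rho> 1 \<sigma>] by simp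
  moreover from this have "\<rho> * \<sigma> < 1" using \<sigma> by linarith
  ultimately have \<rho>\<sigma>: "0 < \<rho> * \<sigma>" "\<rho> * \<sigma> < \<sigma>" "\<rho> * \<sigma> < 1" "\<rho>\<^sup>2 \<le> \<rho> * \<sigma>"
    using \<rho> \<sigma> by (auto simp: power2_eq_square)
  define g where "g t = cmod (f (of_real \<sigma> * cis t) - f (of_real (\<rho> * \<sigma>) * cis t))" for t
  have [measurable]: "(\<lambda>t. f (of_real \<sigma> * cis t)) \<in> borel_measurable borel"
    "(\<lambda>t. f (of_real (\<rho> * \<sigma>) * cis t)) \<in> borel_measurable borel"
    using circ_measurable[of \<sigma>] circ_measurable[of "\<rho> * \<sigma>"] \<sigma> \<rho>\<sigma> by auto
  have [measurable]: "g \<in> borel_measurable borel" unfolding g_def[abs_def] by measurable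
  obtain B1 where B1: "\<And>t. cmod (f (of_real \<sigma> * cis t)) \<le> B1" using circ_bounded[of \<sigma>] \<sigma> by auto
  obtain B2 where B2: "\<And>t. cmod (f (of_real (\<rho> * \<sigma>) * cis t)) \<le> B2"
    using circ_bounded[of "\<rho> * \<sigma>"] \<rho>\<sigma> by auto
  have gB: "g t \<le> B1 + B2" for t
    unfolding g_def using norm_triangle_ineq4[of "f (of_real \<sigma> * cis t)" "f (of_real (\<rho> * \<sigma>) * cis t)"] B1[of t] B2[of t]
    by linarith
  define k' where "k' \<theta> = k \<theta> / \<sigma>" for \<theta>
  have k': "0 \<le> k' \<theta>" "k' \<theta> \<le> R / \<sigma>" for \<theta>
    using k[of \<theta>] \<sigma> by (auto simp: k'_def divide_right_mono)
  have R': "R / \<sigma> < 1" using \<sigma> by simp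
  have [measurable]: "k' \<in> borel_measurable borel" unfolding k'_def[abs_def] by measurable
  have pt: "cmod (f (of_real (k \<theta>) * cis \<theta>) - f (of_real (\<rho> * k \<theta>) * cis \<theta>)) \<le> poisson_along k' g \<theta>" for \<theta>
  proof -
    let ?w = "of_real (k' \<theta>) * cis \<theta>"
    let ?P = "\<lambda>t. poisson (?w * cis (- t))"
    have w: "cmod ?w < 1" using k'[of \<theta>] R' by (simp add: norm_mult)
    have nn: "0 \<le> ?P t" for t by (rule poisson_kernel_nonneg[OF w])
    have "f (of_real (k \<theta>) * cis \<theta>) = f (of_real \<sigma> * ?w)" using \<sigma> by (simp add: k'_def)
    also have "\<dots> = (\<integral>t. ?P t *\<^sub>R f (of_real \<sigma> * cis t) \<partial>circle)"
      using \<sigma> by (intro poisson_formula f w) auto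
    finally have e1: "f (of_real (k \<theta>) * cis \<theta>) = \<dots>" .
    have "f (of_real (\<rho> * k \<theta>) * cis \<theta>) = f (of_real (\<rho> * \<sigma>) * ?w)"
      using \<sigma> by (simp add: k'_def mult.assoc)
    also have "\<dots> = (\<integral>t. ?P t *\<^sub>R f (of_real (\<rho> * \<sigma>) * cis t) \<partial>circle)"
      using \<rho>\<sigma> by (intro poisson_formula f w) auto
    finally have e2: "f (of_real (\<rho> * k \<theta>) * cis \<theta>) = \<dots>" .
    have i: "integrable circle (\<lambda>t. ?P t *\<^sub>R f (of_real \<sigma> * cis t))"
      "integrable circle (\<lambda>t. ?P t *\<^sub>R f (of_real (\<rho> * \<sigma>) * cis t))"
      by (rule integrable_poisson_bounded[OF w _ B1], measurable)
         (rule integrable_poisson_bounded[OF w _ B2], measurable)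
    have "f (of_real (k \<theta>) * cis \<theta>) - f (of_real (\<rho> * k \<theta>) * cis \<theta>)
        = (\<integral>t. ?P t *\<^sub>R (f (of_real \<sigma> * cis t) - f (of_real (\<rho> * \<sigma>) * cis t)) \<partial>circle)"
      unfolding e1 e2 scaleR_diff_right by (rule Bochner_Integration.integral_diff[OF i, symmetric])
    also have "cmod \<dots> \<le> (\<integral>t. norm (?P t *\<^sub>R (f (of_real \<sigma> * cis t) - f (of_real (\<rho> * \<sigma>) * cis t))) \<partial>circle)"
      by (rule integral_norm_bound)
    also have "\<dots> = poisson_along k' g \<theta>"
      using nn by (simp add: poisson_along_def g_def)
    finally show ?thesis .
  qed
  have meas: "poisson_along k' g \<in> borel_measurable borel"
    unfolding poisson_along_def[abs_def] by measurable
  have bnd: "\<bar>poisson_along k' g \<theta>\<bar> \<le> 2 / (1 - R / \<sigma>) * (B1 + B2)" for \<theta>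
  proof -
    have w: "cmod (of_real (k' \<theta>) * cis \<theta> * cis (- t)) \<le> R / \<sigma>" for t
      using k'[of \<theta>] by (simp add: norm_mult)
    have "norm (poisson (of_real (k' \<theta>) * cis \<theta> * cis (- t)) * g t) \<le> 2 / (1 - R / \<sigma>) * (B1 + B2)" for t
      unfolding real_norm_def abs_mult
      using poisson_le_radius[OF w R'] poisson_nonneg[OF order.trans[OF w]] R' gB[of t]
      by (intro mult_mono) (auto simp: g_def)
    hence "norm (poisson_along k' g \<theta>) \<le> 2 / (1 - R / \<sigma>) * (B1 + B2)"
      unfolding poisson_along_def by (intro norm_integral_circle_le) auto
    thus ?thesis by simp
  qed
  have int: "integrable circle (\<lambda>\<theta>. (poisson_along k' g \<theta>)\<^sup>2)"
  proof (rule integrable_circle_bounded)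
    show "norm ((poisson_along k' g \<theta>)\<^sup>2) \<le> (2 / (1 - R / \<sigma>) * (B1 + B2))\<^sup>2" for \<theta>
      using power_mono[OF bnd[of \<theta>], of 2] by simp
  qed (use meas in measurable)
  have "(\<integral>\<^sup>+\<theta>. ennreal ((cmod (f (of_real (k \<theta>) * cis \<theta>) - f (of_real (\<rho> * k \<theta>) * cis \<theta>)))\<^sup>2) \<partial>circle)
      \<le> (\<integral>\<^sup>+\<theta>. ennreal ((poisson_along k' g \<theta>)\<^sup>2) \<partial>circle)"
    using pt by (intro nn_integral_mono ennreal_leI power_mono) auto
  also have "\<dots> = ennreal (\<integral>\<theta>. (poisson_along k' g \<theta>)\<^sup>2 \<partial>circle)"
    using int by (intro nn_integral_eq_integral) auto
  also have "\<dots> \<le> ennreal (256 * (\<integral>t. (g t)\<^sup>2 \<partial>circle))"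
    using k' R' gB by (intro ennreal_leI maximal_inequality[where R = "R / \<sigma>" and B = "B1 + B2"]) (auto simp: g_def)
  also have "\<dots> \<le> ennreal (256 * (L - circle_inner f (\<rho>\<^sup>2) (\<rho>\<^sup>2)))"
  proof (intro ennreal_leI mult_left_mono)
    have "(\<integral>t. (g t)\<^sup>2 \<partial>circle) \<le> circle_inner f \<sigma> \<sigma> - circle_inner f (\<rho> * \<sigma>) (\<rho> * \<sigma>)"
      unfolding g_def using \<rho>\<sigma> \<sigma> by (intro circle_diff_le) auto
    also have "\<dots> \<le> L - circle_inner f (\<rho>\<^sup>2) (\<rho>\<^sup>2)"
      using L[of \<sigma>] \<sigma> circle_inner_mono[of "\<rho>\<^sup>2" "\<rho> * \<sigma>"] \<rho>\<sigma>
      by (cases "\<rho>\<^sup>2 = \<rho> * \<sigma>") auto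
    finally show "(\<integral>t. (g t)\<^sup>2 \<partial>circle) \<le> L - circle_inner f (\<rho>\<^sup>2) (\<rho>\<^sup>2)" .
  qed auto
  finally show ?thesis .
qed

section \<open>Radial limits and the boundary function\<close>

context
  assumes bdd: "bdd_above ((\<lambda>r. circle_inner f r r) ` {0<..<1})"
begin

private definition L :: real where "L = (SUP r\<in>{0<..<1}. circle_inner f r r)"

private lemma L_upper: "0 < r \<Longrightarrow> r < 1 \<Longrightarrow> circle_inner f r r \<le> L"
  unfolding L_def by (intro cSUP_upper bdd) auto

private lemma gap_tendsto:
  assumes x: "\<And>n :: nat. 0 < x n" "\<And>n. x n < 1" "x \<longlonglongrightarrow> 1"
  shows "(\<lambda>n. L - circle_inner f (x n) (x n)) \<longlonglongrightarrow> 0"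
proof (rule LIMSEQ_I)
  fix e :: real assume "0 < e"
  hence "L - e < L" by simp
  then obtain r where r: "0 < r" "r < 1" "L - e < circle_inner f r r"
    unfolding L_def using less_cSUP_iff[OF _ bdd] by (auto simp: L_def)
  from order_tendstoD(1)[OF x(3) r(2)] obtain M where M: "\<And>n. n \<ge> M \<Longrightarrow> r < x n"
    by (auto simp: eventually_sequentially)
  have "norm (L - circle_inner f (x n) (x n) - 0) < e" if "n \<ge> M" for n
    using circle_inner_mono[of r "x n"] r M[OF that] x(1,2)[of n] L_upper[of "x n"] by simp
  thus "\<exists>M. \<forall>n\<ge>M. norm (L - circle_inner f (x n) (x n) - 0) < e" by blast
qed

text \<open>One sequence increasing to 1, used both as dilation factors and as the radii that define
  the boundary function; the shift by 2 keeps \<open>rad 0\<close> positive.\<close>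

private definition rad :: "nat \<Rightarrow> real" where "rad n = 1 - 1 / (real n + 2)"

private lemma rad_bounds: "0 < rad n" "rad n < 1" and rad_mono: "m < n \<Longrightarrow> rad m < rad n"
  by (auto simp: rad_def field_simps)

private lemma rad_tendsto: "rad \<longlonglongrightarrow> 1"
  unfolding rad_def[abs_def] by real_asymp

private lemma rad_at_left: "filterlim rad (at_left 1) sequentially"
  unfolding filterlim_at using rad_tendsto rad_bounds(2) less_imp_neq[OF rad_bounds(2)]
  by (auto intro!: always_eventually)

text \<open>The squared distance between \<open>f\<close> and its dilation by \<open>\<rho>\<close>,
  maximized along a ray over a sequence of radii. Countability keeps it measurable; later
  \<open>e\<close> enumerates the rationals in [0, 1).\<close>

private definition osc :: "(nat \<Rightarrow> real) \<Rightarrow> real \<Rightarrow> real \<Rightarrow> ennreal" where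
  "osc e \<rho> \<theta> = (SUP i. ennreal ((cmod (f (of_real (e i) * cis \<theta>) - f (of_real (\<rho> * e i) * cis \<theta>)))\<^sup>2))"

private lemma diff_measurable:
  assumes "0 \<le> r" "r < 1" "0 \<le> \<rho>" "\<rho> < 1"
  shows "(\<lambda>\<theta>. cmod (f (of_real r * cis \<theta>) - f (of_real (\<rho> * r) * cis \<theta>))) \<in> borel_measurable borel"
proof -
  have "\<rho> * r \<le> r" using assms mult_right_mono[of \<rho> 1 r] by simp
  hence "0 \<le> \<rho> * r" "\<rho> * r < 1" using assms by auto
  note [measurable] = circ_measurable[OF assms(1,2)] circ_measurable[OF this]
  show ?thesis by measurable
qed

text \<open>Over finitely many radii the maximum is attained by a measurable selection, to which
  \<open>maximal_along\<close> applies with a bound independent of their number; monotone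
  convergence does the rest.\<close>

private lemma nn_integral_osc_le:
  assumes e: "\<And>i. 0 \<le> e i" "\<And>i. e i < 1" and \<rho>: "0 < \<rho>" "\<rho> < 1"
  shows "(\<integral>\<^sup>+\<theta>. osc e \<rho> \<theta> \<partial>circle) \<le> ennreal (256 * (L - circle_inner f (\<rho>\<^sup>2) (\<rho>\<^sup>2)))"
proof -
  define v where "v r \<theta> = cmod (f (of_real r * cis \<theta>) - f (of_real (\<rho> * r) * cis \<theta>))" for r \<theta>
  have v [measurable]: "v (e i) \<in> borel_measurable borel" for i
    unfolding v_def[abs_def] using e \<rho> by (intro diff_measurable) auto
  define F where "F n \<theta> = (SUP i\<in>{..n}. ennreal ((v (e i) \<theta>)\<^sup>2))" for n \<theta>
  have "osc e \<rho> \<theta> = (SUP n. F n \<theta>)" for \<theta>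
  proof (rule antisym)
    show "osc e \<rho> \<theta> \<le> (SUP n. F n \<theta>)"
      unfolding osc_def F_def v_def[symmetric]
    proof (rule SUP_least)
      fix i
      have "ennreal ((v (e i) \<theta>)\<^sup>2) \<le> (SUP i\<in>{..i}. ennreal ((v (e i) \<theta>)\<^sup>2))"
        by (rule SUP_upper) simp
      also have "\<dots> \<le> (SUP n. SUP i\<in>{..n}. ennreal ((v (e i) \<theta>)\<^sup>2))"
        by (rule SUP_upper) simp
      finally show "ennreal ((v (e i) \<theta>)\<^sup>2) \<le> (SUP n. SUP i\<in>{..n}. ennreal ((v (e i) \<theta>)\<^sup>2))" .
    qed
    show "(SUP n. F n \<theta>) \<le> osc e \<rho> \<theta>"
      unfolding osc_def F_def v_def[symmetric] by (intro SUP_least) (auto intro: SUP_upper)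
  qed
  hence "(\<integral>\<^sup>+\<theta>. osc e \<rho> \<theta> \<partial>circle) = (\<integral>\<^sup>+\<theta>. (SUP n. F n \<theta>) \<partial>circle)" by simp
  also have "\<dots> = (SUP n. \<integral>\<^sup>+\<theta>. F n \<theta> \<partial>circle)"
  proof (rule nn_integral_monotone_convergence_SUP)
    show "incseq F" unfolding incseq_def le_fun_def F_def by (auto intro!: SUP_subset_mono)
    show "F n \<in> borel_measurable circle" for n
      unfolding F_def by measurable
  qed
  also have "\<dots> \<le> ennreal (256 * (L - circle_inner f (\<rho>\<^sup>2) (\<rho>\<^sup>2)))"
  proof (rule SUP_least)
    fix n
    obtain k where k: "k \<in> borel_measurable borel" "\<And>\<theta>. k \<theta> \<in> e ` {..n}"
      "\<And>\<theta> i. i \<le> n \<Longrightarrow> v (e i) \<theta> \<le> v (k \<theta>) \<theta>"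
      using measurable_argmax[of v e n] v by blast
    have "(\<integral>\<^sup>+\<theta>. F n \<theta> \<partial>circle) \<le> (\<integral>\<^sup>+\<theta>. ennreal ((v (k \<theta>) \<theta>)\<^sup>2) \<partial>circle)"
      unfolding F_def using k(3)
      by (intro nn_integral_mono SUP_least ennreal_leI power_mono) (auto simp: v_def)
    also have "\<dots> \<le> ennreal (256 * (L - circle_inner f (\<rho>\<^sup>2) (\<rho>\<^sup>2)))"
      unfolding v_def
    proof (rule maximal_along[OF \<rho> k(1) _ _ _ L_upper])
      show "0 \<le> k \<theta>" for \<theta> using k(2)[of \<theta>] e by auto
      show "k \<theta> \<le> Max (e ` {..n})" for \<theta> using k(2)[of \<theta>] by (intro Max_ge) auto
      show "Max (e ` {..n}) < 1" using e by (subst Max_less_iff) auto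
    qed
    finally show "(\<integral>\<^sup>+\<theta>. F n \<theta> \<partial>circle) \<le> ennreal (256 * (L - circle_inner f (\<rho>\<^sup>2) (\<rho>\<^sup>2)))" .
  qed
  finally show ?thesis .
qed

text \<open>The integral of the infimum is at most 256 times each gap, and the gaps tend to 0. An
  infimum is enough: for a given tolerance one good dilation factor suffices.\<close>

private lemma AE_osc:
  assumes e: "\<And>i. 0 \<le> e i" "\<And>i. e i < 1"
  shows "AE \<theta> in circle. (INF n. osc e (rad n) \<theta>) = 0"
proof -
  have [measurable]: "(\<lambda>\<theta>. osc e (rad n) \<theta>) \<in> borel_measurable circle" for n
  proof -
    have "(\<lambda>\<theta>. ennreal ((cmod (f (of_real (e i) * cis \<theta>) - f (of_real (rad n * e i) * cis \<theta>)))\<^sup>2))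
        \<in> borel_measurable circle" for i
    proof -
      have [measurable]: "(\<lambda>\<theta>. cmod (f (of_real (e i) * cis \<theta>) - f (of_real (rad n * e i) * cis \<theta>)))
          \<in> borel_measurable borel"
        using e rad_bounds[of n] by (intro diff_measurable) auto
      show ?thesis by measurable
    qed
    thus ?thesis unfolding osc_def by (intro borel_measurable_SUP) auto
  qed
  have "(\<integral>\<^sup>+\<theta>. (INF n. osc e (rad n) \<theta>) \<partial>circle) \<le> 0"
  proof (rule LIMSEQ_le_const)
    show "(\<lambda>n. ennreal (256 * (L - circle_inner f ((rad n)\<^sup>2) ((rad n)\<^sup>2)))) \<longlonglongrightarrow> 0"
    proof -
      have "(\<lambda>n. 256 * (L - circle_inner f ((rad n)\<^sup>2) ((rad n)\<^sup>2))) \<longlonglongrightarrow> 256 * 0"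
      proof (intro tendsto_mult tendsto_const gap_tendsto)
        show "(\<lambda>n. (rad n)\<^sup>2) \<longlonglongrightarrow> 1" using tendsto_power[OF rad_tendsto, of 2] by simp
        show "0 < (rad n)\<^sup>2" "(rad n)\<^sup>2 < 1" for n
          using rad_bounds[of n] by (auto simp: power_less_one_iff)
      qed
      from tendsto_ennrealI[OF this] show ?thesis by simp
    qed
    have "(\<integral>\<^sup>+\<theta>. (INF n. osc e (rad n) \<theta>) \<partial>circle)
        \<le> ennreal (256 * (L - circle_inner f ((rad n)\<^sup>2) ((rad n)\<^sup>2)))" for n
      by (rule order.trans[OF nn_integral_mono nn_integral_osc_le[OF e rad_bounds]]) (auto intro: INF_lower)
    thus "\<exists>N. \<forall>n\<ge>N. (\<integral>\<^sup>+\<theta>. (INF n. osc e (rad n) \<theta>) \<partial>circle)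
        \<le> ennreal (256 * (L - circle_inner f ((rad n)\<^sup>2) ((rad n)\<^sup>2)))" by blast
  qed
  hence "(\<integral>\<^sup>+\<theta>. (INF n. osc e (rad n) \<theta>) \<partial>circle) = 0" by simp
  thus ?thesis by (subst (asm) nn_integral_0_iff_AE) auto
qed

private lemma radius_continuous:
  assumes "0 \<le> \<rho>" "\<rho> \<le> 1"
  shows "continuous_on {0..<1} (\<lambda>r. f (of_real (\<rho> * r) * cis \<theta>))"
proof (rule continuous_on_compose2[OF continuous_on_harmonic])
  show "(\<lambda>r. of_real (\<rho> * r) * cis \<theta>) ` {0..<1} \<subseteq> ball 0 1"
  proof clarify
    fix r :: real assume "r \<in> {0..<1}"
    moreover from this have "\<rho> * r \<le> r" using assms mult_right_mono[of \<rho> 1 r] by simp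
    ultimately show "of_real (\<rho> * r) * cis \<theta> \<in> ball 0 1" using assms by (intro in_disc) auto
  qed
qed (intro continuous_intros)

private lemma radial_limit_exists:
  assumes e: "range e = \<rat> \<inter> {0..<1}" and \<theta>: "(INF n. osc e (rad n) \<theta>) = 0"
  obtains l where "((\<lambda>r. f (of_real r * cis \<theta>)) \<longlongrightarrow> l) (at_left 1)"
proof (rule tendsto_at_left_Cauchy[of 1 "\<lambda>r. f (of_real r * cis \<theta>)"])
  fix \<epsilon> :: real assume \<epsilon>: "0 < \<epsilon>"
  hence "(INF n. osc e (rad n) \<theta>) < ennreal ((\<epsilon> / 3)\<^sup>2)" unfolding \<theta> by simp
  then obtain n where n: "osc e (rad n) \<theta> < ennreal ((\<epsilon> / 3)\<^sup>2)" by (auto simp: INF_less_iff)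
  define \<rho> where "\<rho> = rad n"
  have \<rho>: "0 < \<rho>" "\<rho> < 1" using rad_bounds by (auto simp: \<rho>_def)
  define \<phi> where "\<phi> r = cmod (f (of_real r * cis \<theta>) - f (of_real (\<rho> * r) * cis \<theta>))" for r
  have rat: "\<phi> r \<le> \<epsilon> / 3" if "r \<in> \<rat>" "0 \<le> r" "r < 1" for r
  proof -
    have "r \<in> range e" using that e by auto
    then obtain i where i: "r = e i" by blast
    have "ennreal ((\<phi> r)\<^sup>2) \<le> osc e \<rho> \<theta>"
      unfolding osc_def \<phi>_def i by (rule SUP_upper) simp
    also have "\<dots> \<le> ennreal ((\<epsilon> / 3)\<^sup>2)" using n by (simp add: \<rho>_def)
    finally have "(\<phi> r)\<^sup>2 \<le> (\<epsilon> / 3)\<^sup>2" by (subst (asm) ennreal_le_iff) auto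
    thus ?thesis using \<epsilon> by (simp add: power2_le_iff_abs_le)
  qed
  have \<phi>_cont: "continuous_on {0..<1} \<phi>"
    unfolding \<phi>_def using radius_continuous[of 1 \<theta>] radius_continuous[of \<rho> \<theta>] \<rho>
    by (intro continuous_on_norm continuous_on_diff) auto
  \<comment> \<open>\<open>osc\<close> sees rational radii only; continuity along the ray extends
    the bound to all radii.\<close>
  have \<phi>: "\<phi> r \<le> \<epsilon> / 3" if r: "0 \<le> r" "r < 1" for r
  proof -
    define q where "q m = of_int \<lfloor>real (Suc m) * r\<rfloor> / real (Suc m)" for m
    have q: "q m \<in> \<rat>" "0 \<le> q m" "q m < 1" for m
    proof -
      show "q m \<in> \<rat>" by (simp add: q_def del: of_nat_Suc)
      show "0 \<le> q m" using r by (simp add: q_def del: of_nat_Suc)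
      have "of_int \<lfloor>real (Suc m) * r\<rfloor> \<le> real (Suc m) * r" by (rule of_int_floor_le)
      also have "\<dots> < real (Suc m)" using r by (simp del: of_nat_Suc)
      finally show "q m < 1" by (simp add: q_def del: of_nat_Suc)
    qed
    have "(\<lambda>m. \<phi> (q m)) \<longlonglongrightarrow> \<phi> r"
      by (rule continuous_on_tendsto_compose[OF \<phi>_cont floor_grid_tendsto[of r, folded q_def]])
         (use r q in auto)
    thus ?thesis by (rule LIMSEQ_le_const2) (use rat[OF q] in blast)
  qed
  have "continuous_on {0..1} (\<lambda>r. f (of_real (\<rho> * r) * cis \<theta>))"
  proof (rule continuous_on_compose2[OF continuous_on_harmonic])
    show "(\<lambda>r. of_real (\<rho> * r) * cis \<theta>) ` {0..1} \<subseteq> ball 0 1"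
    proof clarify
      fix r :: real assume r: "r \<in> {0..1}"
      hence "\<rho> * r \<le> \<rho>" using \<rho> by (simp add: mult_left_le)
      hence "\<rho> * r < 1" using \<rho> by linarith
      thus "of_real (\<rho> * r) * cis \<theta> \<in> ball 0 1" using \<rho> r by (intro in_disc) auto
    qed
  qed (intro continuous_intros)
  then obtain d where d: "0 < d" "\<And>r. r \<in> {0..1} \<Longrightarrow> dist r 1 < d \<Longrightarrow>
      dist (f (of_real (\<rho> * r) * cis \<theta>)) (f (of_real (\<rho> * 1) * cis \<theta>)) < \<epsilon> / 6"
    using \<epsilon> unfolding continuous_on_iff by (metis atLeastAtMost_iff divide_pos_pos order_refl zero_less_numeral zero_le_one)
  show "\<exists>d<1. \<forall>r s. d < r \<longrightarrow> r < 1 \<longrightarrow> d < s \<longrightarrow> s < 1 \<longrightarrow>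
      dist (f (of_real r * cis \<theta>)) (f (of_real s * cis \<theta>)) < \<epsilon>"
  proof (intro exI[of _ "max 0 (1 - d)"] conjI allI impI)
    fix r s :: real
    assume rs: "max 0 (1 - d) < r" "r < 1" "max 0 (1 - d) < s" "s < 1"
    let ?h = "\<lambda>r. f (of_real (\<rho> * r) * cis \<theta>)"
    have "dist (f (of_real r * cis \<theta>)) (?h r) \<le> \<epsilon> / 3" "dist (f (of_real s * cis \<theta>)) (?h s) \<le> \<epsilon> / 3"
      using \<phi>[of r] \<phi>[of s] rs by (auto simp: \<phi>_def dist_norm)
    moreover have "dist (?h x) (?h 1) < \<epsilon> / 6" if "max 0 (1 - d) < x" "x < 1" for x
      using that by (intro d(2)) (auto simp: dist_real_def)
    from this[OF rs(1,2)] this[OF rs(3,4)]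
    have "dist (?h r) (?h 1) < \<epsilon> / 6" "dist (?h s) (?h 1) < \<epsilon> / 6" by simp_all
    ultimately show "dist (f (of_real r * cis \<theta>)) (f (of_real s * cis \<theta>)) < \<epsilon>"
      using dist_triangle[of "f (of_real r * cis \<theta>)" "f (of_real s * cis \<theta>)" "?h r"]
        dist_triangle[of "?h r" "f (of_real s * cis \<theta>)" "?h s"]
        dist_triangle[of "?h r" "?h s" "?h 1"] dist_commute[of "?h s" "?h 1"]
        dist_commute[of "f (of_real s * cis \<theta>)" "?h s"]
      by linarith
  qed (use d(1) in auto)
qed (rule that)

text \<open>A limit along a fixed sequence is Borel measurable by construction; it agrees with
  \<open>radial_limit\<close> wherever the full radial limit exists.\<close>

private definition bdry :: "real \<Rightarrow> complex" where
  "bdry \<theta> = lim (\<lambda>n. f (of_real (rad n) * cis \<theta>))"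

private lemma rad_circ_measurable [measurable]: "(\<lambda>t. f (of_real (rad n) * cis t)) \<in> borel_measurable borel"
  using rad_bounds[of n] by (intro circ_measurable) auto

private lemma bdry_measurable [measurable]: "bdry \<in> borel_measurable borel"
  unfolding bdry_def[abs_def] by (rule borel_measurable_lim_metric) measurable

private lemma AE_bdry:
  "AE \<theta> in circle. (\<lambda>n. f (of_real (rad n) * cis \<theta>)) \<longlonglongrightarrow> bdry \<theta> \<and> radial_limit f (cis \<theta>) = bdry \<theta>"
proof -
  define e where "e = from_nat_into (\<rat> \<inter> {0..<1::real})"
  have "countable (\<rat> \<inter> {0..<1::real})" by (rule countable_Int1[OF countable_rat])
  moreover have "0 \<in> \<rat> \<inter> {0..<1::real}" by simp
  ultimately have e: "range e = \<rat> \<inter> {0..<1}" unfolding e_def by (intro range_from_nat_into) auto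
  hence "e i \<in> {0..<1}" for i by blast
  hence "AE \<theta> in circle. (INF n. osc e (rad n) \<theta>) = 0" by (intro AE_osc) auto
  thus ?thesis
  proof (rule AE_mp, intro AE_I2 impI)
    fix \<theta> assume "(INF n. osc e (rad n) \<theta>) = 0"
    then obtain l where l: "((\<lambda>r. f (of_real r * cis \<theta>)) \<longlongrightarrow> l) (at_left 1)"
      by (rule radial_limit_exists[OF e])
    have "(\<lambda>n. f (of_real (rad n) * cis \<theta>)) \<longlonglongrightarrow> l"
      by (rule filterlim_compose[OF l rad_at_left])
    moreover from this have "bdry \<theta> = l" unfolding bdry_def by (rule limI)
    moreover have "radial_limit f (cis \<theta>) = l"
      unfolding radial_limit_def using l by (intro tendsto_Lim) auto
    ultimately show "(\<lambda>n. f (of_real (rad n) * cis \<theta>)) \<longlonglongrightarrow> bdry \<theta> \<and> radial_limit f (cis \<theta>) = bdry \<theta>"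
      by simp
  qed
qed

text \<open>Fatou's lemma in \<open>m\<close>, applied to \<open>circle_diff_le\<close> for the
  radii \<open>rad n < rad m\<close>.\<close>

private lemma bdry_L2:
  "integrable circle (\<lambda>t. (cmod (bdry t - f (of_real (rad n) * cis t)))\<^sup>2)"
  "(\<integral>t. (cmod (bdry t - f (of_real (rad n) * cis t)))\<^sup>2 \<partial>circle) \<le> L - circle_inner f (rad n) (rad n)"
proof -
  let ?u = "\<lambda>m t. ennreal ((cmod (f (of_real (rad m) * cis t) - f (of_real (rad n) * cis t)))\<^sup>2)"
  let ?v = "\<lambda>t. (cmod (bdry t - f (of_real (rad n) * cis t)))\<^sup>2"
  have gap: "0 \<le> L - circle_inner f (rad n) (rad n)" using L_upper rad_bounds by simp
  have "(\<integral>\<^sup>+t. ennreal (?v t) \<partial>circle) = (\<integral>\<^sup>+t. liminf (\<lambda>m. ?u m t) \<partial>circle)"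
  proof (rule nn_integral_cong_AE, rule AE_mp[OF AE_bdry], intro AE_I2 impI)
    fix t assume "(\<lambda>n. f (of_real (rad n) * cis t)) \<longlonglongrightarrow> bdry t \<and> radial_limit f (cis t) = bdry t"
    hence "(\<lambda>m. ?u m t) \<longlonglongrightarrow> ennreal (?v t)"
      by (intro tendsto_ennrealI tendsto_power tendsto_norm tendsto_diff tendsto_const) auto
    thus "ennreal (?v t) = liminf (\<lambda>m. ?u m t)" using lim_imp_Liminf[OF trivial_limit_sequentially] by metis
  qed
  also have "\<dots> \<le> liminf (\<lambda>m. \<integral>\<^sup>+t. ?u m t \<partial>circle)"
    by (intro nn_integral_liminf) measurable
  also have "\<dots> \<le> limsup (\<lambda>m. \<integral>\<^sup>+t. ?u m t \<partial>circle)"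
    by (intro Liminf_le_Limsup) simp
  also have "\<dots> \<le> ennreal (L - circle_inner f (rad n) (rad n))"
  proof (rule Limsup_bounded)
    have "(\<integral>\<^sup>+t. ?u m t \<partial>circle) \<le> ennreal (L - circle_inner f (rad n) (rad n))" if "n < m" for m
    proof -
      note d = circle_diff_le[OF rad_bounds(1) rad_mono[OF that] rad_bounds(2)]
      have "(\<integral>\<^sup>+t. ?u m t \<partial>circle)
          = ennreal (\<integral>t. (cmod (f (of_real (rad m) * cis t) - f (of_real (rad n) * cis t)))\<^sup>2 \<partial>circle)"
        using d(1) by (intro nn_integral_eq_integral) auto
      also have "\<dots> \<le> ennreal (L - circle_inner f (rad n) (rad n))"
        using d(2) L_upper[OF rad_bounds, of m] by (intro ennreal_leI) linarith
      finally show ?thesis .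
    qed
    thus "\<forall>\<^sub>F m in sequentially. (\<integral>\<^sup>+t. ?u m t \<partial>circle) \<le> ennreal (L - circle_inner f (rad n) (rad n))"
      using eventually_gt_at_top[of n] by (rule eventually_mono[rotated])
  qed
  finally have le: "(\<integral>\<^sup>+t. ennreal (?v t) \<partial>circle) \<le> ennreal (L - circle_inner f (rad n) (rad n))" .
  also have "\<dots> < \<infinity>" by simp
  finally show int: "integrable circle ?v"
    by (intro integrableI_nonneg) (auto simp: less_top)
  have "ennreal (\<integral>t. ?v t \<partial>circle) = (\<integral>\<^sup>+t. ennreal (?v t) \<partial>circle)"
    using int by (intro nn_integral_eq_integral[symmetric]) auto
  with le have "ennreal (\<integral>t. ?v t \<partial>circle) \<le> ennreal (L - circle_inner f (rad n) (rad n))" by (simp only:)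
  thus "(\<integral>t. ?v t \<partial>circle) \<le> L - circle_inner f (rad n) (rad n)"
    using ennreal_le_iff[OF gap] by blast
qed

private lemma bdry_sq_integrable: "integrable circle (\<lambda>t. (cmod (bdry t))\<^sup>2)"
proof (rule Bochner_Integration.integrable_bound)
  let ?g = "\<lambda>t. 2 * (cmod (bdry t - f (of_real (rad 0) * cis t)))\<^sup>2 + 2 * (cmod (f (of_real (rad 0) * cis t)))\<^sup>2"
  show "integrable circle ?g"
    using bdry_L2(1)[of 0] integrable_harmonic_inner[of "rad 0" "rad 0"] rad_bounds[of 0]
    by (intro Bochner_Integration.integrable_add integrable_mult_right) (auto simp: power2_norm_eq_inner)
  have "(cmod (bdry t))\<^sup>2 \<le> ?g t" for t
  proof -
    let ?a = "cmod (bdry t - f (of_real (rad 0) * cis t))" and ?b = "cmod (f (of_real (rad 0) * cis t))"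
    have "cmod (bdry t) \<le> ?a + ?b" using norm_triangle_ineq[of "bdry t - f (of_real (rad 0) * cis t)" "f (of_real (rad 0) * cis t)"] by simp
    hence "(cmod (bdry t))\<^sup>2 \<le> (?a + ?b)\<^sup>2" by (intro power_mono) auto
    also have "\<dots> \<le> 2 * ?a\<^sup>2 + 2 * ?b\<^sup>2" using sum_squares_bound[of ?a ?b] by (simp add: power2_sum)
    finally show ?thesis .
  qed
  thus "AE t in circle. norm ((cmod (bdry t))\<^sup>2) \<le> norm (?g t)" by simp
qed measurable

text \<open>Poisson's formula holds for each dilation by \<open>rad n\<close>. Jensen's inequality
  bounds its squared distance to the Poisson integral of \<open>bdry\<close> by a multiple of the
  gap, while \<open>f (rad n * w)\<close> tends to \<open>f w\<close> by continuity.\<close>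

private lemma bdry_representation:
  assumes w: "cmod w < 1"
  shows "f w = (\<integral>t. poisson (w * cis (- t)) *\<^sub>R bdry t \<partial>circle)"
proof -
  let ?P = "\<lambda>t. poisson (w * cis (- t))"
  have nn: "0 \<le> ?P t" for t by (rule poisson_kernel_nonneg[OF w])
  have "integrable circle (\<lambda>t. ?P t * cmod (bdry t))"
    using bdry_sq_integrable by (intro poisson_jensen(1)[OF w, where q = 2]) (auto simp: powr_numeral)
  hence iF: "integrable circle (\<lambda>t. ?P t *\<^sub>R bdry t)"
    by (rule Bochner_Integration.integrable_bound) (auto simp: nn)
  define J where "J = (\<integral>t. ?P t *\<^sub>R bdry t \<partial>circle)"
  define C where "C = 2 / (1 - cmod w)"
  have C: "?P t \<le> C" for t using poisson_kernel_bound[OF w, of t] by (simp add: C_def)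
  have bound: "(cmod (f (of_real (rad n) * w) - J))\<^sup>2 \<le> C * (L - circle_inner f (rad n) (rad n))" for n
  proof -
    let ?d = "\<lambda>t. cmod (bdry t - f (of_real (rad n) * cis t))"
    have i2: "integrable circle (\<lambda>t. ?d t powr 2)" using bdry_L2(1)[of n] by (simp add: powr_numeral)
    have m: "?d \<in> borel_measurable borel" by measurable
    obtain B where B: "\<And>t. cmod (f (of_real (rad n) * cis t)) \<le> B"
      using circ_bounded[of "rad n"] rad_bounds[of n] by auto
    have ifn: "integrable circle (\<lambda>t. ?P t *\<^sub>R f (of_real (rad n) * cis t))"
      by (rule integrable_poisson_bounded[OF w _ B]) measurable
    have "f (of_real (rad n) * w) = (\<integral>t. ?P t *\<^sub>R f (of_real (rad n) * cis t) \<partial>circle)"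
      using rad_bounds[of n] by (intro poisson_formula f w) auto
    hence "J - f (of_real (rad n) * w) = (\<integral>t. ?P t *\<^sub>R (bdry t - f (of_real (rad n) * cis t)) \<partial>circle)"
      unfolding J_def scaleR_diff_right by (simp only: Bochner_Integration.integral_diff[OF iF ifn])
    also have "cmod \<dots> \<le> (\<integral>t. norm (?P t *\<^sub>R (bdry t - f (of_real (rad n) * cis t))) \<partial>circle)"
      by (rule integral_norm_bound)
    also have "\<dots> = (\<integral>t. ?P t * ?d t \<partial>circle)" using nn by simp
    finally have le: "cmod (f (of_real (rad n) * w) - J) \<le> (\<integral>t. ?P t * ?d t \<partial>circle)"
      by (simp add: norm_minus_commute)
    hence "(cmod (f (of_real (rad n) * w) - J))\<^sup>2 \<le> (\<integral>t. ?P t * ?d t \<partial>circle)\<^sup>2"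
      by (intro power_mono) auto
    also have "\<dots> = (\<integral>t. ?P t * ?d t \<partial>circle) powr 2"
      using order.trans[OF norm_ge_zero le] by (simp add: powr_numeral)
    also have "\<dots> \<le> (\<integral>t. ?P t * ?d t powr 2 \<partial>circle)"
      by (rule poisson_jensen(3)[OF w _ m norm_ge_zero i2]) simp
    also have "\<dots> \<le> (\<integral>t. C * ?d t powr 2 \<partial>circle)"
    proof (rule integral_mono)
      show "integrable circle (\<lambda>t. ?P t * ?d t powr 2)"
        by (rule poisson_jensen(2)[OF w _ m norm_ge_zero i2]) simp
    qed (use i2 C in \<open>auto intro!: mult_right_mono\<close>)
    also have "\<dots> = C * (\<integral>t. (?d t)\<^sup>2 \<partial>circle)" by (simp add: powr_numeral)
    also have "\<dots> \<le> C * (L - circle_inner f (rad n) (rad n))"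
      using bdry_L2(2)[of n] w by (intro mult_left_mono) (auto simp: C_def)
    finally show ?thesis .
  qed
  have "(\<lambda>n. (cmod (f (of_real (rad n) * w) - J))\<^sup>2) \<longlonglongrightarrow> 0"
  proof (rule real_tendsto_sandwich[OF _ _ tendsto_const])
    have "(\<lambda>n. C * (L - circle_inner f (rad n) (rad n))) \<longlonglongrightarrow> C * 0"
      by (intro tendsto_mult tendsto_const gap_tendsto rad_bounds rad_tendsto)
    thus "(\<lambda>n. C * (L - circle_inner f (rad n) (rad n))) \<longlonglongrightarrow> 0" by simp
  qed (use bound in auto)
  hence "(\<lambda>n. sqrt ((cmod (f (of_real (rad n) * w) - J))\<^sup>2)) \<longlonglongrightarrow> sqrt 0" by (rule tendsto_real_sqrt)
  hence "(\<lambda>n. f (of_real (rad n) * w)) \<longlonglongrightarrow> J" by (simp add: tendsto_norm_zero_iff LIM_zero_iff)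
  moreover have "(\<lambda>n. f (of_real (rad n) * w)) \<longlonglongrightarrow> f (of_real 1 * w)"
  proof (rule continuous_on_tendsto_compose[OF continuous_on_harmonic])
    show "(\<lambda>n. of_real (rad n) * w) \<longlonglongrightarrow> of_real 1 * w"
      by (intro tendsto_mult tendsto_of_real tendsto_const rad_tendsto)
    have "cmod (of_real (rad n) * w) < 1" for n
      using rad_bounds[of n] w mult_right_mono[of "rad n" 1 "cmod w"] by (simp add: norm_mult)
    thus "\<forall>\<^sub>F n in sequentially. of_real (rad n) * w \<in> ball 0 1" by simp
  qed (use w in auto)
  ultimately show "f w = J" using LIMSEQ_unique by fastforce
qed

lemma poisson_integral_of_radial_limit:
  obtains F where "F \<in> borel_measurable borel" "AE t in circle. radial_limit f (cis t) = F t"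
    "\<And>w. cmod w < 1 \<Longrightarrow> f w = (\<integral>t. poisson (w * cis (- t)) *\<^sub>R F t \<partial>circle)"
proof (rule that)
  show "AE t in circle. radial_limit f (cis t) = bdry t" using AE_bdry by eventually_elim simp
qed (rule bdry_measurable bdry_representation | assumption)+

end

end

subsection \<open>Integration over the radius\<close>

text \<open>For \<open>p >= 2\<close> one has \<open>x^2 <= 1 + x powr p\<close>, and the constant 1
  integrates to 1 over \<open>circle\<close>.\<close>

lemma harmonic_hardy_imp_circle_inner_bounded:
  assumes p: "2 \<le> p" and f: "f \<in> harmonic_hardy p"
  shows "bdd_above ((\<lambda>r. circle_inner f r r) ` {0<..<1})"
proof -
  have harm: "harmonic_on f (ball 0 1)" using f by (simp add: harmonic_hardy_def)
  obtain C where "\<forall>r\<in>{0<..<1}. integral_mean p r f \<le> C"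
    using f by (auto simp: harmonic_hardy_def bdd_above_def)
  hence C: "\<And>r. 0 < r \<Longrightarrow> r < 1 \<Longrightarrow> integral_mean p r f \<le> C" by simp
  show ?thesis
  proof (rule bdd_aboveI2)
    fix r :: real assume "r \<in> {0<..<1}"
    hence r: "0 < r" "r < 1" by auto
    let ?g = "\<lambda>t. norm (f (of_real r * cis t)) powr p"
    have cg: "continuous_on UNIV ?g"
      using p r by (intro continuous_on_powr' continuous_on_norm continuous_on_harmonic_circle[OF harm] continuous_on_const) auto
    have ig: "?g integrable_on {0..2 * pi}"
      by (intro integrable_continuous_real continuous_on_subset[OF cg]) auto
    have "(?g has_integral integral {0..2 * pi} ?g) {0..2 * pi}" using ig by (rule integrable_integral)
    from integral_circle_has_integral[OF cg this]
    have eq: "(\<integral>t. ?g t \<partial>circle) = 1 / (2 * pi) * integral {0..2 * pi} ?g" by simp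
    have nn: "0 \<le> (\<integral>t. ?g t \<partial>circle)" by simp
    have mean: "(\<integral>t. ?g t \<partial>circle) powr (1 / p) \<le> C"
      using C[OF r] unfolding integral_mean_def eq .
    have "(\<integral>t. ?g t \<partial>circle) = ((\<integral>t. ?g t \<partial>circle) powr (1 / p)) powr p"
      using p nn by (simp add: powr_powr)
    also have "\<dots> \<le> C powr p" using mean p by (intro powr_mono2) auto
    finally have X: "(\<integral>t. ?g t \<partial>circle) \<le> C powr p" .
    have int: "integrable circle ?g"
    proof -
      have "compact (cball 0 r :: complex set)" by simp
      moreover have "continuous_on (cball 0 r) f"
        by (rule continuous_on_subset[OF continuous_on_harmonic[OF harm]]) (use r in auto)
      ultimately have "bounded (f ` cball 0 r)" by (intro compact_imp_bounded compact_continuous_image)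
      then obtain B where B: "\<forall>z\<in>cball 0 r. cmod (f z) \<le> B" by (auto simp: bounded_iff)
      have "norm (?g t) \<le> B powr p" for t
        using B[rule_format, of "of_real r * cis t"] p r by (auto simp: norm_mult intro!: powr_mono2)
      thus ?thesis by (intro integrable_circle_bounded borel_measurable_continuous_onI cg)
    qed
    have "circle_inner f r r \<le> (\<integral>t. 1 + ?g t \<partial>circle)"
      unfolding circle_inner_def
    proof (rule integral_mono)
      show "integrable circle (\<lambda>t. f (of_real r * cis t) \<bullet> f (of_real r * cis t))"
        using r by (intro integrable_harmonic_inner[OF harm]) auto
      show "integrable circle (\<lambda>t. 1 + ?g t)" using int by simp
      show "f (of_real r * cis t) \<bullet> f (of_real r * cis t) \<le> 1 + ?g t" for t
      proof -
        let ?x = "norm (f (of_real r * cis t))"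
        have "?x powr 2 \<le> 1 + ?x powr p"
        proof (cases "?x \<le> 1")
          case True
          hence "?x powr 2 \<le> 1 powr 2" by (intro powr_mono2) auto
          thus ?thesis by (simp add: add_increasing2)
        next
          case False
          hence "?x powr 2 \<le> ?x powr p" using p by (intro powr_mono) auto
          thus ?thesis by simp
        qed
        thus ?thesis by (simp add: powr_numeral power2_norm_eq_inner)
      qed
    qed
    also have "\<dots> = 1 + (\<integral>t. ?g t \<partial>circle)" using int by simp
    also have "\<dots> \<le> 1 + C powr p" using X by simp
    finally show "circle_inner f r r \<le> 1 + C powr p" .
  qed
qed

section \<open>From grid sums to the radial integral\<close>

lemma nn_integral_circle:
  assumes [measurable]: "g \<in> borel_measurable borel"
  shows "(\<integral>\<^sup>+\<theta>\<in>{0..2 * pi}. g \<theta> \<partial>lborel) = ennreal (2 * pi) * (\<integral>\<^sup>+\<theta>. g \<theta> \<partial>circle)"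
proof -
  have "(\<integral>\<^sup>+\<theta>. g \<theta> \<partial>circle) = (\<integral>\<^sup>+\<theta>\<in>{0..2 * pi}. g \<theta> \<partial>lborel) / ennreal (2 * pi)"
    unfolding circle_def by (subst nn_integral_uniform_measure) (auto simp: emeasure_two_pi)
  thus ?thesis
    by (simp add: ennreal_times_divide mult.commute[of "ennreal (2 * pi)"] ennreal_mult_divide_eq)
qed

lemma AE_circle_iff: "(AE \<theta> in circle. P \<theta>) \<longleftrightarrow> (AE \<theta> in lborel. \<theta> \<in> {0..2 * pi} \<longrightarrow> P \<theta>)"
  unfolding circle_def by (rule AE_uniform_measure) (auto simp: emeasure_two_pi)

text \<open>The step function \<open>s N\<close> takes on each cell the value of \<open>m\<close> at
  its left endpoint. Semicontinuity puts \<open>m\<close> below the lower limit of these measurable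
  functions, and Fatou's lemma bounds its integral by their integrals, the grid sums.\<close>

lemma nn_integral_le_of_grid_sums:
  fixes m :: "real \<Rightarrow> ennreal"
  assumes lsc: "\<And>r. 0 < r \<Longrightarrow> r < 1 \<Longrightarrow>
      m r \<le> liminf (\<lambda>n. m (of_int \<lfloor>real (Suc n) * r\<rfloor> / real (Suc n)))"
    and bound: "\<And>N. 0 < N \<Longrightarrow> (\<Sum>j<N. m (real j / real N) * ennreal (1 / real N)) \<le> W"
  shows "(\<integral>\<^sup>+r\<in>{0<..<1}. m r \<partial>lborel) \<le> W"
proof -
  define s where "s N r = (\<Sum>j<N. m (real j / real N) * indicator {real j / real N..<real (Suc j) / real N} r)" for N and r :: real
  have [measurable]: "s N \<in> borel_measurable lborel" for N unfolding s_def[abs_def] by measurable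
  have "m r * indicator {0<..<1} r \<le> liminf (\<lambda>n. s (Suc n) r)" for r
  proof (cases "0 < r \<and> r < 1")
    case True
    have "m (of_int \<lfloor>real (Suc n) * r\<rfloor> / real (Suc n)) \<le> s (Suc n) r" for n
    proof -
      define N where "N = Suc n"
      have N: "0 < real N" by (simp add: N_def)
      define j where "j = nat \<lfloor>real N * r\<rfloor>"
      have j: "real j = of_int \<lfloor>real N * r\<rfloor>" using True by (simp add: j_def)
      have "real j \<le> real N * r" "real N * r < real (Suc j)" unfolding of_nat_Suc j by linarith+
      hence mem: "r \<in> {real j / real N..<real (Suc j) / real N}" using N by (simp add: field_simps)
      have "real j < real N" using \<open>real j \<le> real N * r\<close> True N
        by (smt (verit) mult_less_cancel_left2)
      hence "j < N" by simp
      hence "m (real j / real N) * indicator {real j / real N..<real (Suc j) / real N} r \<le> s N r"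
        unfolding s_def by (intro member_le_sum) auto
      thus ?thesis using mem by (simp add: j N_def)
    qed
    hence "liminf (\<lambda>n. m (of_int \<lfloor>real (Suc n) * r\<rfloor> / real (Suc n))) \<le> liminf (\<lambda>n. s (Suc n) r)"
      by (intro Liminf_mono always_eventually allI)
    with lsc[of r] True have "m r \<le> liminf (\<lambda>n. s (Suc n) r)" by (blast intro: order.trans)
    thus ?thesis using True by simp
  qed auto
  hence "(\<integral>\<^sup>+r\<in>{0<..<1}. m r \<partial>lborel) \<le> (\<integral>\<^sup>+r. liminf (\<lambda>n. s (Suc n) r) \<partial>lborel)"
    by (intro nn_integral_mono)
  also have "\<dots> \<le> liminf (\<lambda>n. \<integral>\<^sup>+r. s (Suc n) r \<partial>lborel)"
    by (intro nn_integral_liminf) measurable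
  also have "\<dots> \<le> limsup (\<lambda>n. \<integral>\<^sup>+r. s (Suc n) r \<partial>lborel)" by (intro Liminf_le_Limsup) simp
  also have "\<dots> \<le> W"
  proof (intro Limsup_bounded always_eventually allI)
    fix n
    have "(\<integral>\<^sup>+r. s (Suc n) r \<partial>lborel) = (\<Sum>j<Suc n. m (real j / real (Suc n)) *
        emeasure lborel {real j / real (Suc n)..<real (Suc j) / real (Suc n)})"
      unfolding s_def
      by (subst nn_integral_sum, measurable) (intro sum.cong refl nn_integral_cmult_indicator, simp)
    also have "\<dots> = (\<Sum>j<Suc n. m (real j / real (Suc n)) * ennreal (1 / real (Suc n)))"
    proof (intro sum.cong refl)
      fix j
      have "real (Suc j) / real (Suc n) - real j / real (Suc n) = 1 / real (Suc n)"
        unfolding diff_divide_distrib[symmetric] by simp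
      thus "m (real j / real (Suc n)) * emeasure lborel {real j / real (Suc n)..<real (Suc j) / real (Suc n)}
          = m (real j / real (Suc n)) * ennreal (1 / real (Suc n))"
        by (subst emeasure_lborel_Ico) (auto simp: divide_right_mono simp del: of_nat_Suc)
    qed
    also have "\<dots> \<le> W" by (rule bound) simp
    finally show "(\<integral>\<^sup>+r. s (Suc n) r \<partial>lborel) \<le> W" .
  qed
  finally show ?thesis .
qed

lemma sphere_norm_powr_SUP_attained:
  fixes f :: "complex \<Rightarrow> complex"
  assumes f: "continuous_on (ball 0 1) f" and r: "0 \<le> r" "r < 1" and p: "0 \<le> p"
  obtains z where "cmod z = r" "(SUP z\<in>sphere 0 r. ennreal (norm (f z) powr p)) = ennreal (norm (f z) powr p)"
proof -
  have "\<exists>z\<in>sphere 0 r. \<forall>y\<in>sphere 0 r. norm (f y) \<le> norm (f z)"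
  proof (rule continuous_attains_sup)
    show "(sphere 0 r :: complex set) \<noteq> {}" using r by simp
    show "continuous_on (sphere 0 r) (\<lambda>z. norm (f z))"
      by (intro continuous_on_norm continuous_on_subset[OF f]) (use r in auto)
  qed simp
  then obtain z where z: "z \<in> sphere 0 r" "\<And>y. y \<in> sphere 0 r \<Longrightarrow> norm (f y) \<le> norm (f z)" by blast
  show thesis
  proof (rule that)
    show "cmod z = r" using z by simp
    show "(SUP z\<in>sphere 0 r. ennreal (norm (f z) powr p)) = ennreal (norm (f z) powr p)"
    proof (rule antisym)
      show "(SUP z\<in>sphere 0 r. ennreal (norm (f z) powr p)) \<le> ennreal (norm (f z) powr p)"
        using z(2) p by (intro SUP_least ennreal_leI powr_mono2) auto
      show "ennreal (norm (f z) powr p) \<le> (SUP z\<in>sphere 0 r. ennreal (norm (f z) powr p))"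
        using z(1) by (rule SUP_upper)
    qed
  qed
qed

text \<open>Slide a maximal point of the circle of radius \<open>r\<close> along its ray: by
  continuity its values approach the maximum, and each is a lower bound for the supremum on its own
  circle.\<close>

lemma sphere_norm_powr_SUP_lsc:
  fixes f :: "complex \<Rightarrow> complex"
  assumes f: "continuous_on (ball 0 1) f" and r: "0 < r" "r < 1" and p: "0 < p"
    and x: "x \<longlonglongrightarrow> r" "\<And>n. 0 \<le> x n" "\<And>n. x n < 1"
  shows "(SUP z\<in>sphere 0 r. ennreal (norm (f z) powr p))
      \<le> liminf (\<lambda>n. SUP z\<in>sphere 0 (x n). ennreal (norm (f z) powr p))"
proof -
  obtain z where z: "cmod z = r" "(SUP z\<in>sphere 0 r. ennreal (norm (f z) powr p)) = ennreal (norm (f z) powr p)"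
    using sphere_norm_powr_SUP_attained[OF f] r p by (metis less_imp_le)
  define u where "u = z / of_real r"
  have u: "cmod u = 1" "z = of_real r * u" using z r by (auto simp: u_def norm_divide)
  have "(\<lambda>n. f (of_real (x n) * u)) \<longlonglongrightarrow> f (of_real r * u)"
  proof (rule continuous_on_tendsto_compose[OF f])
    show "(\<lambda>n. of_real (x n) * u) \<longlonglongrightarrow> of_real r * u"
      by (intro tendsto_mult tendsto_of_real x tendsto_const)
  qed (use u r x in \<open>auto simp: norm_mult\<close>)
  hence "(\<lambda>n. ennreal (norm (f (of_real (x n) * u)) powr p)) \<longlonglongrightarrow> ennreal (norm (f z) powr p)"
    unfolding u(2) using p by (intro tendsto_ennrealI tendsto_powr' tendsto_norm tendsto_const) auto
  hence "ennreal (norm (f z) powr p) = liminf (\<lambda>n. ennreal (norm (f (of_real (x n) * u)) powr p))"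
    using lim_imp_Liminf[OF trivial_limit_sequentially] by metis
  also have "\<dots> \<le> liminf (\<lambda>n. SUP z\<in>sphere 0 (x n). ennreal (norm (f z) powr p))"
    using u x by (intro Liminf_mono always_eventually allI SUP_upper) (auto simp: norm_mult)
  finally show ?thesis unfolding z(2) .
qed

theorem theorem5:
  fixes f :: "complex \<Rightarrow> complex" and p :: real
  assumes "p \<ge> 2" and "f \<in> harmonic_hardy p"
  shows "(\<integral>\<^sup>+r\<in>{0<..<1}. (SUP z\<in>sphere 0 r. ennreal (norm (f z) powr p)) \<partial>lborel)
       \<le> (\<integral>\<^sup>+\<theta>\<in>{0..2 * pi}. ennreal (norm (radial_limit f (cis \<theta>)) powr p) \<partial>lborel)"
proof -
  have harm: "harmonic_on f (ball 0 1)" using assms by (simp add: harmonic_hardy_def)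
  have cont: "continuous_on (ball 0 1) f" by (rule continuous_on_harmonic[OF harm])
  obtain F where F [measurable]: "F \<in> borel_measurable borel"
    and AE_F: "AE t in circle. radial_limit f (cis t) = F t"
    and rep: "\<And>w. cmod w < 1 \<Longrightarrow> f w = (\<integral>t. poisson (w * cis (- t)) *\<^sub>R F t \<partial>circle)"
    using poisson_integral_of_radial_limit[OF harm harmonic_hardy_imp_circle_inner_bounded[OF assms]]
    by blast
  define T where "T = (\<integral>\<^sup>+t. ennreal (norm (F t) powr p) \<partial>circle)"
  have "(\<integral>\<^sup>+\<theta>\<in>{0..2 * pi}. ennreal (norm (radial_limit f (cis \<theta>)) powr p) \<partial>lborel)
      = (\<integral>\<^sup>+\<theta>\<in>{0..2 * pi}. ennreal (norm (F \<theta>) powr p) \<partial>lborel)"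
  proof (rule nn_integral_cong_AE)
    show "AE \<theta> in lborel. ennreal (norm (radial_limit f (cis \<theta>)) powr p) * indicator {0..2 * pi} \<theta>
        = ennreal (norm (F \<theta>) powr p) * indicator {0..2 * pi} \<theta>"
      using AE_F unfolding AE_circle_iff by eventually_elim (auto split: split_indicator)
  qed
  also have "\<dots> = ennreal (2 * pi) * T"
    unfolding T_def by (rule nn_integral_circle) measurable
  finally have rhs: "(\<integral>\<^sup>+\<theta>\<in>{0..2 * pi}. ennreal (norm (radial_limit f (cis \<theta>)) powr p) \<partial>lborel)
      = ennreal (2 * pi) * T" .
  \<comment> \<open>Finiteness of \<open>T\<close> is not among the facts obtained about
    \<open>F\<close>; if \<open>T\<close> is infinite, so is the right-hand side.\<close>
  show ?thesis
  proof (cases "T = \<infinity>")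
    case True
    thus ?thesis unfolding rhs by (simp add: ennreal_mult_top)
  next
    case False
    \<comment> \<open>The hypothesis \<open>p >= 2\<close> makes this exponent admissible for
      Jensen's inequality, and squaring restores \<open>p\<close>.\<close>
    define q where "q = p / 2"
    have q: "1 \<le> q" using assms(1) by (simp add: q_def)
    have iFp: "integrable circle (\<lambda>t. norm (F t) powr p)"
      using False by (intro integrableI_nonneg) (auto simp: T_def less_top)
    define G where "G t = norm (F t) powr q" for t
    have [measurable]: "G \<in> borel_measurable borel" unfolding G_def[abs_def] by measurable
    have G2: "(G t)\<^sup>2 = norm (F t) powr p" for t
      by (simp add: G_def q_def power2_eq_square flip: powr_add)
    have iG2: "integrable circle (\<lambda>t. (G t)\<^sup>2)" unfolding G2 by (rule iFp)
    have "integrable circle G"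
    proof (rule Bochner_Integration.integrable_bound)
      show "integrable circle (\<lambda>t. 1 + (G t)\<^sup>2)" using iG2 by simp
      have "G t \<le> 1 + (G t)\<^sup>2" for t
      proof -
        have "0 \<le> G t" by (simp add: G_def)
        moreover have "2 * G t \<le> 1 + (G t)\<^sup>2" using sum_squares_bound[of 1 "G t"] by simp
        ultimately show ?thesis by linarith
      qed
      thus "AE t in circle. norm (G t) \<le> norm (1 + (G t)\<^sup>2)" by (simp add: G_def)
    qed measurable
    hence iFq: "integrable circle (\<lambda>t. norm (F t) powr q)" by (simp add: G_def[abs_def])
    have pt: "norm (f z) powr q \<le> (\<integral>t. poisson (z * cis (- t)) * G t \<partial>circle)" if z: "cmod z < 1" for z
    proof -
      have "norm (f z) \<le> (\<integral>t. norm (poisson (z * cis (- t)) *\<^sub>R F t) \<partial>circle)"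
        unfolding rep[OF z] by (rule integral_norm_bound)
      also have "\<dots> = (\<integral>t. poisson (z * cis (- t)) * norm (F t) \<partial>circle)"
        using poisson_kernel_nonneg[OF z] by simp
      finally have "norm (f z) powr q \<le> (\<integral>t. poisson (z * cis (- t)) * norm (F t) \<partial>circle) powr q"
        using q by (intro powr_mono2) auto
      also have "\<dots> \<le> (\<integral>t. poisson (z * cis (- t)) * norm (F t) powr q \<partial>circle)"
        using iFq by (intro poisson_jensen(3)[OF z q]) auto
      finally show ?thesis by (simp add: G_def)
    qed
    let ?m = "\<lambda>r. SUP z\<in>sphere 0 r. ennreal (norm (f z) powr p)"
    have "(\<integral>\<^sup>+r\<in>{0<..<1}. ?m r \<partial>lborel) \<le> ennreal (2 * pi * (\<integral>t. (G t)\<^sup>2 \<partial>circle))"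
    proof (rule nn_integral_le_of_grid_sums)
      fix r :: real assume r: "0 < r" "r < 1"
      have "of_int \<lfloor>real (Suc n) * r\<rfloor> / real (Suc n) < 1" for n
      proof -
        have "of_int \<lfloor>real (Suc n) * r\<rfloor> \<le> real (Suc n) * r" by (rule of_int_floor_le)
        also have "\<dots> < real (Suc n)" using r by (simp del: of_nat_Suc)
        finally show ?thesis by (simp del: of_nat_Suc)
      qed
      thus "?m r \<le> liminf (\<lambda>n. ?m (of_int \<lfloor>real (Suc n) * r\<rfloor> / real (Suc n)))"
        using r assms(1) by (intro sphere_norm_powr_SUP_lsc[OF cont _ _ _ floor_grid_tendsto]) (auto simp del: of_nat_Suc)
    next
      fix N :: nat assume N: "0 < N"
      \<comment> \<open>Only finitely many maximal points are chosen, one per grid circle, with no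
        relation between their arguments.\<close>
      have "\<exists>z. cmod z = real j / real N \<and> ?m (real j / real N) = ennreal (norm (f z) powr p)" if "j < N" for j
        using sphere_norm_powr_SUP_attained[OF cont, of "real j / real N" p] that assms(1) by auto
      then obtain z where z: "\<And>j. j < N \<Longrightarrow> cmod (z j) = real j / real N"
        "\<And>j. j < N \<Longrightarrow> ?m (real j / real N) = ennreal (norm (f (z j)) powr p)" by metis
      have "(\<Sum>j<N. ?m (real j / real N) * ennreal (1 / real N))
          = (\<Sum>j<N. ennreal ((norm (f (z j)) powr q)\<^sup>2 / real N))"
        by (intro sum.cong refl)
           (simp add: z(2) q_def power2_eq_square flip: powr_add ennreal_mult)
      also have "\<dots> = ennreal (\<Sum>j<N. (norm (f (z j)) powr q)\<^sup>2 / real N)"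
        by (intro sum_ennreal) auto
      also have "\<dots> \<le> ennreal (2 * pi * (\<integral>t. (G t)\<^sup>2 \<partial>circle))"
        using z(1) by (intro ennreal_leI discrete_radial_bound[where z = z] N iG2 pt) (auto simp: G_def)
      finally show "(\<Sum>j<N. ?m (real j / real N) * ennreal (1 / real N))
          \<le> ennreal (2 * pi * (\<integral>t. (G t)\<^sup>2 \<partial>circle))" .
    qed
    also have "\<dots> = ennreal (2 * pi) * ennreal (\<integral>t. (G t)\<^sup>2 \<partial>circle)" by (simp add: ennreal_mult)
    also have "ennreal (\<integral>t. (G t)\<^sup>2 \<partial>circle) = T"
      unfolding T_def G2 using iFp by (intro nn_integral_eq_integral[symmetric]) auto
    finally show ?thesis unfolding rhs .
  qed
qed

end
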